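(* Let $n\ge1$, let $\psi\in\mathcal{T}_n^0$ with representing measure $\mu$, and suppose that for every $t>0$ there is $f_t\in L^1(\mathbb{R}_+^n)$ with $g_t(s):=e^{t\psi(s)}=\mathcal{L}f_t(-s)$ for $s\in(-\infty,0)^n$. Put $$k(f_t,\mu):=\int_{\mathbb{R}_+^n}\int_{\mathbb{R}_+^n}|f_t(r-u)-f_t(r)|\,dr\,d\mu(u).$$ If $\limsup_{t\to0+}t\,k(f_t,\mu)<\infty$, then $\psi\in\mathcal{T}_n^Y$ (i.e. for every complex Banach space $X$ and every $n$-tuple $A$ of commuting generators of bounded $C_0$-semigroups on $X$, $\psi(A)$ is the generator of a quasibounded holomorphic semigroup $g(A)$ in $X$).
   Context: $\mathbb{R}_+=[0,\infty)$. $\mathcal{L}f(z)=\int_{\mathbb{R}_+^n}e^{-z\cdot u}f(u)\,du$ is the $n$-dimensional Laplace transform; functions in $L^1(\mathbb{R}_+^n)$ are extended by $0$ to $\mathbb{R}^n\setminus\mathbb{R}_+^n$. $\mathcal{T}_n$ is the set of nonpositive $\psi\in C^\infty((-\infty,0)^n)$ all of whose first partial derivatives are absolutely monotone (nonnegative together with all their partial derivatives of all orders). Every $\psi\in\mathcal{T}_n$ has a representation $\psi(s)=c_0+c_1\cdot s+\int_{\mathbb{R}_+^n\setminus\{0\}}(e^{s\cdot v}-1)\,d\mu(v)$ with $c_0=\lim_{s\to-0}\psi(s)$, $c_1\in\mathbb{R}_+^n$ and a positive measure $\mu$ on $\mathbb{R}_+^n\setminus\{0\}$ (the representing measure, regarded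 as a measure on $\mathbb{R}_+^n$ with $\mu(\{0\})=0$), all determined by $\psi$. $\mathcal{T}_n^0$ is the subclass with $c_0=0$, $c_1=0$. For $\psi\in\mathcal{T}_n^0$ and $t\ge0$, $\nu_t$ is the unique probability measure on $\mathbb{R}_+^n$ with $\int e^{z\cdot u}d\nu_t(u)=e^{t\psi(z)}$, $z\in(-\infty,0)^n$. A bounded $C_0$-semigroup is a strongly continuous one-parameter operator semigroup with uniformly bounded norms. Generators commute if the corresponding semigroups commute. If $A=(A_1,\dots,A_n)$ is an $n$-tuple of commuting generators of bounded $C_0$-semigroups $T_1,\dots,T_n$ on $X$, then $g_t(A)x=\int_{\mathbb{R}_+^n}T_1(u_1)\cdots T_n(u_n)x\,d\nu_t(u)$ defines a bounded $C_0$-semigroup $g(A)$ on $X$, and $\psi(A)$ denotes its generator. A bounded $C_0$-semigroup $U$ with generator $G$ on $X$ satisfies condition (Y), and is then called a quasibounded holomorphic semigroup, if $U(t)X\subset D(G)$ for all $t>0$ and $\limsup_{t\to0+}t\|GU(t)\|<\infty$. $\mathcal{T}_n^Y$ is the set of all $\psi\in\mathcal{T}_n^0$ such that, for every complex Banach space $X$ and every $n$-tuple $A$ of commuting generators of bounded $C_0$-semigroups on $X$, $\psi(A)$ generates a bounded $C_0$-semigroup with property (Y). *)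

theory Defs
  imports "HOL-Probability.Probability"
begin

section \<open>Orthants, partial derivatives, the classes \<open>T\<^sub>n\<close> and \<open>T\<^sub>n\<^sup>0\<close>\<close>

text \<open>The dimension \<open>n \<ge> 1\<close> is \<open>CARD('n)\<close>; functions on \<open>(-\<infinity>,0)\<^sup>n\<close> are total functions on
  \<open>\<real>\<^sup>n\<close> whose values outside the open negative orthant are never used.\<close>

definition nonneg_orthant :: "(real^'n) set" where
  "nonneg_orthant = {u. \<forall>i. 0 \<le> u $ i}"

definition neg_orthant :: "(real^'n) set" where
  "neg_orthant = {s. \<forall>i. s $ i < 0}"

definition partial_deriv :: "'n \<Rightarrow> (real^'n \<Rightarrow> real) \<Rightarrow> real^'n \<Rightarrow> real" where
  "partial_deriv i f s = deriv (\<lambda>h. f (s + h *\<^sub>R axis i 1)) 0"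

definition iter_partial :: "'n list \<Rightarrow> (real^'n \<Rightarrow> real) \<Rightarrow> real^'n \<Rightarrow> real" where
  "iter_partial js f = foldr partial_deriv js f"

definition smooth_on_neg :: "(real^'n \<Rightarrow> real) \<Rightarrow> bool" where
  "smooth_on_neg f \<longleftrightarrow>
     (\<forall>js. continuous_on neg_orthant (iter_partial js f) \<and>
       (\<forall>i. \<forall>s\<in>neg_orthant.
          (\<lambda>h. iter_partial js f (s + h *\<^sub>R axis i 1)) field_differentiable at 0))"

definition absolutely_monotone :: "(real^'n \<Rightarrow> real) \<Rightarrow> bool" where
  "absolutely_monotone f \<longleftrightarrow>
     smooth_on_neg f \<and> (\<forall>js. \<forall>s\<in>neg_orthant. 0 \<le> iter_partial js f s)"

definition Tn :: "(real^'n \<Rightarrow> real) set" where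
  "Tn = {\<psi>. smooth_on_neg \<psi> \<and> (\<forall>s\<in>neg_orthant. \<psi> s \<le> 0) \<and>
             (\<forall>i. absolutely_monotone (partial_deriv i \<psi>))}"

text \<open>A measure on \<open>\<real>\<^sub>+\<^sup>n\<close> is encoded as a Borel measure on \<open>\<real>\<^sup>n\<close> for which the complement of
  \<open>\<real>\<^sub>+\<^sup>n\<close> is a null set.\<close>

definition measure_on_orthant :: "(real^'n) measure \<Rightarrow> bool" where
  "measure_on_orthant M \<longleftrightarrow> sets M = sets borel \<and> emeasure M (- nonneg_orthant) = 0"

text \<open>\<open>represents \<psi> c0 c1 \<mu>\<close>: the triple \<open>(c0, c1, \<mu>)\<close> is the integral representation of \<open>\<psi>\<close>.
  Integrability is required explicitly because a divergent Bochner integral has value \<open>0\<close>.\<close>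

definition represents ::
  "(real^'n \<Rightarrow> real) \<Rightarrow> real \<Rightarrow> real^'n \<Rightarrow> (real^'n) measure \<Rightarrow> bool" where
  "represents \<psi> c0 c1 \<mu> \<longleftrightarrow>
     (\<psi> \<longlongrightarrow> c0) (at 0 within neg_orthant) \<and>
     c1 \<in> nonneg_orthant \<and>
     measure_on_orthant \<mu> \<and> emeasure \<mu> {0} = 0 \<and>
     (\<forall>s\<in>neg_orthant.
        set_integrable \<mu> (nonneg_orthant - {0}) (\<lambda>v. exp (s \<bullet> v) - 1) \<and>
        \<psi> s = c0 + c1 \<bullet> s + (LINT v:(nonneg_orthant - {0})|\<mu>. exp (s \<bullet> v) - 1))"

definition Tn0 :: "(real^'n \<Rightarrow> real) set" where
  "Tn0 = {\<psi> \<in> Tn. \<exists>\<mu>. represents \<psi> 0 0 \<mu>}"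

definition nu :: "(real^'n \<Rightarrow> real) \<Rightarrow> real \<Rightarrow> (real^'n) measure" where
  "nu \<psi> t = (THE \<nu>. prob_space \<nu> \<and> measure_on_orthant \<nu> \<and>
     (\<forall>z\<in>neg_orthant. (LINT u:nonneg_orthant|\<nu>. exp (z \<bullet> u)) = exp (t * \<psi> z)))"


section \<open>Complex Banach spaces and the Bochner integral\<close>

class complex_banach = banach +
  fixes scaleC :: "complex \<Rightarrow> 'a \<Rightarrow> 'a"
  assumes scaleC_add_right: "scaleC a (x + y) = scaleC a x + scaleC a y"
    and scaleC_add_left: "scaleC (a + b) x = scaleC a x + scaleC b x"
    and scaleC_scaleC: "scaleC a (scaleC b x) = scaleC (a * b) x"
    and scaleC_of_real: "scaleC (complex_of_real r) x = scaleR r x"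
    and norm_scaleC: "norm (scaleC a x) = cmod a * norm x"

definition bounded_operator :: "('x::complex_banach \<Rightarrow> 'x) \<Rightarrow> bool" where
  "bounded_operator f \<longleftrightarrow> bounded_linear f \<and> (\<forall>c x. f (scaleC c x) = scaleC c (f x))"

text \<open>The library's \<^const>\<open>has_bochner_integral\<close> and \<^const>\<open>lebesgue_integral\<close> are restricted to
  second countable (i.e. separable) spaces. The following is the same definition
  for arbitrary Banach spaces.\<close>

definition has_vector_bochner_integral ::
  "'a measure \<Rightarrow> ('a \<Rightarrow> 'x::banach) \<Rightarrow> 'x \<Rightarrow> bool" where
  "has_vector_bochner_integral M f y \<longleftrightarrow>
     f \<in> borel_measurable M \<and>
     (\<exists>s. (\<forall>i::nat. Bochner_Integration.simple_bochner_integrable M (s i)) \<and>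
          (\<lambda>i. \<integral>\<^sup>+u. ennreal (norm (f u - s i u)) \<partial>M) \<longlonglongrightarrow> 0 \<and>
          (\<lambda>i. Bochner_Integration.simple_bochner_integral M (s i)) \<longlonglongrightarrow> y)"

definition vector_bochner_integral :: "'a measure \<Rightarrow> ('a \<Rightarrow> 'x::banach) \<Rightarrow> 'x" where
  "vector_bochner_integral M f = (THE y. has_vector_bochner_integral M f y)"


section \<open>Semigroups and generators\<close>

text \<open>Semigroups are functions on \<open>\<real>\<close> of which only the values at \<open>t \<ge> 0\<close> matter.\<close>

definition bounded_C0_semigroup :: "(real \<Rightarrow> 'x::complex_banach \<Rightarrow> 'x) \<Rightarrow> bool" where
  "bounded_C0_semigroup U \<longleftrightarrow>
     (\<forall>t\<ge>0. bounded_operator (U t)) \<and>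
     U 0 = id \<and>
     (\<forall>s\<ge>0. \<forall>t\<ge>0. U (s + t) = U s \<circ> U t) \<and>
     (\<forall>x. continuous_on {0..} (\<lambda>t. U t x)) \<and>
     (\<exists>M. \<forall>t\<ge>0. onorm (U t) \<le> M)"

text \<open>Unbounded operators are represented by their graphs, so that \<^term>\<open>Domain G\<close> is \<open>D(G)\<close>.\<close>

definition generator :: "(real \<Rightarrow> 'x::complex_banach \<Rightarrow> 'x) \<Rightarrow> ('x \<times> 'x) set" where
  "generator U = {(x, y). ((\<lambda>t. (U t x - x) /\<^sub>R t) \<longlongrightarrow> y) (at_right 0)}"

definition apply_op :: "('x \<times> 'x) set \<Rightarrow> 'x \<Rightarrow> 'x" where
  "apply_op G x = (THE y. (x, y) \<in> G)"

definition generates :: "('x \<times> 'x) set \<Rightarrow> (real \<Rightarrow> 'x::complex_banach \<Rightarrow> 'x) \<Rightarrow> bool" where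
  "generates G U \<longleftrightarrow> bounded_C0_semigroup U \<and> G = generator U"

text \<open>A generator determines its semigroup on \<open>[0,\<infinity>)\<close>; the values at negative times, which the
  choice leaves open, are never used.\<close>

definition semigroup_of :: "('x \<times> 'x) set \<Rightarrow> real \<Rightarrow> 'x::complex_banach \<Rightarrow> 'x" where
  "semigroup_of G = (SOME U. generates G U)"

definition commuting_generators :: "('n \<Rightarrow> ('x::complex_banach \<times> 'x) set) \<Rightarrow> bool" where
  "commuting_generators A \<longleftrightarrow>
     (\<forall>i. \<exists>U. generates (A i) U) \<and>
     (\<forall>i j. \<forall>s\<ge>0. \<forall>t\<ge>0.
        semigroup_of (A i) s \<circ> semigroup_of (A j) t = semigroup_of (A j) t \<circ> semigroup_of (A i) s)"

text \<open>The conjunct \<^const>\<open>bounded_operator\<close> (automatic by the closed graph theorem) ensures that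
  \<^const>\<open>onorm\<close>, a supremum in the reals, is the genuine operator norm.\<close>

definition condition_Y :: "(real \<Rightarrow> 'x::complex_banach \<Rightarrow> 'x) \<Rightarrow> bool" where
  "condition_Y U \<longleftrightarrow> (let G = generator U in
     (\<forall>t>0. range (U t) \<subseteq> Domain G \<and> bounded_operator (\<lambda>x. apply_op G (U t x))) \<and>
     Limsup (at_right 0) (\<lambda>t. ereal (t * onorm (\<lambda>x. apply_op G (U t x)))) < \<infinity>)"

definition quasibounded_holomorphic :: "(real \<Rightarrow> 'x::complex_banach \<Rightarrow> 'x) \<Rightarrow> bool" where
  "quasibounded_holomorphic U \<longleftrightarrow> bounded_C0_semigroup U \<and> condition_Y U"


section \<open>The calculus \<open>\<psi>(A)\<close> and the class \<open>T\<^sub>n\<^sup>Y\<close>\<close>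

text \<open>\<open>T\<^sub>1(u\<^sub>1) \<cdots> T\<^sub>n(u\<^sub>n)\<close>. The index type is not ordered; since the factors commute for
  \<open>u \<in> \<real>\<^sub>+\<^sup>n\<close>, the fold does not depend on the order.\<close>

definition multi_semigroup ::
  "('n::finite \<Rightarrow> ('x::complex_banach \<times> 'x) set) \<Rightarrow> real^'n \<Rightarrow> 'x \<Rightarrow> 'x" where
  "multi_semigroup A u = Finite_Set.fold (\<lambda>i S. semigroup_of (A i) (u $ i) \<circ> S) id UNIV"

definition g_semigroup ::
  "(real^'n \<Rightarrow> real) \<Rightarrow> ('n \<Rightarrow> ('x::complex_banach \<times> 'x) set) \<Rightarrow> real \<Rightarrow> 'x \<Rightarrow> 'x" where
  "g_semigroup \<psi> A t x =
     vector_bochner_integral (nu \<psi> t) (\<lambda>u. indicator nonneg_orthant u *\<^sub>R multi_semigroup A u x)"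

definition psi_op ::
  "(real^'n \<Rightarrow> real) \<Rightarrow> ('n \<Rightarrow> ('x::complex_banach \<times> 'x) set) \<Rightarrow> ('x \<times> 'x) set" where
  "psi_op \<psi> A = generator (g_semigroup \<psi> A)"

text \<open>HOL cannot quantify over types inside a formula, so the Banach space is a type parameter; a
  statement about \<open>TnY TYPE('x)\<close> with \<open>'x\<close> a type variable covers all complex Banach spaces.\<close>

definition TnY :: "'x::complex_banach itself \<Rightarrow> (real^'n \<Rightarrow> real) set" where
  "TnY _ = {\<psi> \<in> Tn0. \<forall>A :: 'n \<Rightarrow> ('x \<times> 'x) set. commuting_generators A \<longrightarrow>
     generates (psi_op \<psi> A) (g_semigroup \<psi> A) \<and> quasibounded_holomorphic (g_semigroup \<psi> A)}"


section \<open>The Laplace transform and the functional \<open>k\<close>\<close>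

text \<open>Elements of \<open>L\<^sup>1(\<real>\<^sub>+\<^sup>n)\<close> are given by complex-valued Borel representatives; only real
  arguments \<open>z\<close> of the transform are needed.\<close>

definition laplace :: "(real^'n \<Rightarrow> complex) \<Rightarrow> real^'n \<Rightarrow> complex" where
  "laplace f z = (LINT u:nonneg_orthant|lborel. exp (- (z \<bullet> u)) *\<^sub>R f u)"

definition zero_extension :: "(real^'n \<Rightarrow> complex) \<Rightarrow> real^'n \<Rightarrow> complex" where
  "zero_extension f r = (if r \<in> nonneg_orthant then f r else 0)"

definition k_functional :: "(real^'n \<Rightarrow> complex) \<Rightarrow> (real^'n) measure \<Rightarrow> ennreal" where
  "k_functional f \<mu> =
     (\<integral>\<^sup>+u\<in>nonneg_orthant. (\<integral>\<^sup>+r\<in>nonneg_orthant.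
        ennreal (cmod (zero_extension f (r - u) - zero_extension f r)) \<partial>lborel) \<partial>\<mu>)"

end

(* Positivity and uniqueness of Laplace transforms come from Stone-Weierstrass: under x = exp(-u)
   exponential sums become polynomials on the unit cube. Truncating the representing measure shows
   that exp(t psi) is positive on exponential sums, so f_t >= 0 and nu_t = f_t du.

   Let alpha and beta be the images under (u,r) -> r of the positive and the negative part of
   (f_t(r-u) - f_t(r)) dmu(u) dr. By Fubini, L(alpha) - L(beta) = psi exp(t psi), so with
   N_h = int_0^h nu_tau dtau uniqueness of Laplace transforms gives
   nu_(t+h) - nu_t = N_h * (alpha - beta). Integrating T_1(u_1)...T_n(u_n) x against this identity,
   dividing by h and letting h -> 0, where N_h / h concentrates at 0, shows that g_t(A) maps X into
   the domain of psi(A) and that ||psi(A) g_t(A)|| <= C k(f_t, mu) as soon as k(f_t, mu) is finite;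
   larger t are reached by the semigroup property. *)
theory Submission
  imports Defs
begin

section \<open>Exponential sums\<close>

text \<open>Three obstacles shape the proof. \<open>nu\<close> is a definite description, so the
  measures must be shown to exist: f_t supplies a candidate density, and its sign is the real
  question. Signed measures are avoided: the increment identity is stated as an equality between
  sums of positive finite measures, which a comparison of Laplace transforms settles. The Banach
  space may be nonseparable, where sums of Borel measurable functions can fail to be measurable; so
  vector integrals are computed as limits of finite sums over one rounding of the orthant shared by
  all measures, and additivity in the measure and compatibility with convolution are read off from
  these sums. The point (-1,...,-1) is the test point for the estimates near the origin: on the
  orthant, 1 - exp(-(u_1+...+u_n)) is bounded below off each ball about 0. This gives finiteness of
  \<mu> away from 0 and the concentration of nu_h and of N_h / h. The constant C of the final bound
  is a bound for the norms of T_1(u_1)...T_n(u_n), and k(f_t, \<mu>) enters as a bound for the total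
  mass of alpha and beta.\<close>

text \<open>A list \<open>L\<close> of pairs \<open>(a, s)\<close> stands for the exponential sum \<open>\<Sum> a e\<^bsup>s\<bullet>u\<^esup>\<close>; no uniqueness of the
  representation is ever needed.\<close>

definition lin_ext :: "('a \<Rightarrow> real) \<Rightarrow> (real \<times> 'a) list \<Rightarrow> real" where
  "lin_ext F L = (\<Sum>(a, s)\<leftarrow>L. a * F s)"

lemma lin_ext_Nil [simp]: "lin_ext F [] = 0"
  and lin_ext_Cons [simp]: "lin_ext F (p # L) = fst p * F (snd p) + lin_ext F L"
  by (auto simp: lin_ext_def split: prod.split)

lemma lin_ext_append [simp]: "lin_ext F (L @ L') = lin_ext F L + lin_ext F L'"
  by (induction L) auto

lemma lin_ext_cong: "(\<And>p. p \<in> set L \<Longrightarrow> F (snd p) = G (snd p)) \<Longrightarrow> lin_ext F L = lin_ext G L"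
  by (induction L) auto

text \<open>Moves a factor depending on the exponent into the coefficients. With
  \<open>G s = exp (s \<bullet> v)\<close> this translates the exponential sum by
  \<open>v\<close>.\<close>

lemma lin_ext_map_scale: "lin_ext F (map (\<lambda>p. (fst p * G (snd p), snd p)) L) = lin_ext (\<lambda>s. G s * F s) L"
  by (induction L) auto

text \<open>Adding \<open>d\<close> to all exponents multiplies an exponential sum by
  \<open>exp (d \<bullet> u)\<close>; this serves both for products and for damping.\<close>

lemma lin_ext_map_shift:
  fixes L :: "(real \<times> 'a::monoid_add) list"
  shows "lin_ext F (map (\<lambda>p. (c * fst p, snd p + d)) L) = c * lin_ext (\<lambda>s. F (s + d)) L"
  by (induction L) (auto simp: algebra_simps)

lemma lin_ext_add: "lin_ext (\<lambda>s. F s + G s) L = lin_ext F L + lin_ext G L"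
  by (induction L) (auto simp: algebra_simps)

lemma lin_ext_cmult: "lin_ext (\<lambda>s. c * F s) L = c * lin_ext F L"
  by (induction L) (auto simp: algebra_simps)

lemma lin_ext_tendsto:
  assumes "\<And>p. p \<in> set L \<Longrightarrow> ((\<lambda>k. F k (snd p)) \<longlongrightarrow> G (snd p)) net"
  shows "((\<lambda>k. lin_ext (F k) L) \<longlongrightarrow> lin_ext G L) net"
  using assms by (induction L) (auto intro!: tendsto_intros)

lemma borel_measurable_lin_ext [measurable (raw)]:
  assumes "\<And>p. p \<in> set L \<Longrightarrow> (\<lambda>x. F x (snd p)) \<in> borel_measurable M"
  shows "(\<lambda>x. lin_ext (F x) L) \<in> borel_measurable M"
  using assms by (induction L) (auto intro!: borel_measurable_add borel_measurable_times)

lemma integral_lin_ext: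
  assumes "\<And>p. p \<in> set L \<Longrightarrow> integrable M (\<lambda>x. F x (snd p))"
  shows "integrable M (\<lambda>x. lin_ext (F x) L)"
    and "(\<integral>x. lin_ext (F x) L \<partial>M) = lin_ext (\<lambda>s. \<integral>x. F x s \<partial>M) L"
proof -
  have "integrable M (\<lambda>x. lin_ext (F x) L) \<and> (\<integral>x. lin_ext (F x) L \<partial>M) = lin_ext (\<lambda>s. \<integral>x. F x s \<partial>M) L"
    using assms by (induction L) auto
  then show "integrable M (\<lambda>x. lin_ext (F x) L)"
    and "(\<integral>x. lin_ext (F x) L \<partial>M) = lin_ext (\<lambda>s. \<integral>x. F x s \<partial>M) L" by auto
qed

section \<open>The orthant, and polynomials on the cube as exponential sums\<close>

lemma closed_nonneg_orthant: "closed (nonneg_orthant :: (real^'n) set)"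
proof -
  have "nonneg_orthant = (\<Inter>i. {u :: real^'n. 0 \<le> u $ i})" by (auto simp: nonneg_orthant_def)
  also have "closed \<dots>"
    by (intro closed_INT ballI closed_Collect_le continuous_intros)
  finally show ?thesis .
qed

lemma nonneg_orthant_borel [measurable]: "(nonneg_orthant :: (real^'n) set) \<in> sets borel"
  using closed_nonneg_orthant by (rule borel_closed)

lemma inner_nonpos:
  fixes s u :: "real^'n"
  assumes "\<And>i. s $ i \<le> 0" "u \<in> nonneg_orthant"
  shows "s \<bullet> u \<le> 0"
  using assms by (auto simp: inner_vec_def nonneg_orthant_def intro!: sum_nonpos mult_nonpos_nonneg)

lemma neg_inner_nonpos: "s \<in> neg_orthant \<Longrightarrow> u \<in> nonneg_orthant \<Longrightarrow> s \<bullet> u \<le> 0"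
  by (intro inner_nonpos) (auto simp: neg_orthant_def less_imp_le)

text \<open>The substitution that turns exponential sums into polynomials on the cube.\<close>

definition exp_vec :: "real^'n \<Rightarrow> real^'n" where
  "exp_vec u = (\<chi> i. exp (- (u $ i)))"

definition is_exp_sum :: "(real^'n \<Rightarrow> real) \<Rightarrow> bool" where
  "is_exp_sum q \<longleftrightarrow> (\<exists>L. (\<forall>p\<in>set L. \<forall>i. snd p $ i \<le> 0) \<and> (\<forall>u. q u = lin_ext (\<lambda>s. exp (s \<bullet> u)) L))"

lemma is_exp_sum_exp: "(\<And>i. s $ i \<le> 0) \<Longrightarrow> is_exp_sum (\<lambda>u. a * exp (s \<bullet> u))"
  unfolding is_exp_sum_def by (rule exI[of _ "[(a, s)]"]) auto

lemma is_exp_sum_add: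
  assumes "is_exp_sum p" "is_exp_sum q" shows "is_exp_sum (\<lambda>u. p u + q u)"
proof -
  obtain L where L: "\<forall>p\<in>set L. \<forall>i. snd p $ i \<le> 0" "\<And>u. p u = lin_ext (\<lambda>s. exp (s \<bullet> u)) L"
    using assms(1) unfolding is_exp_sum_def by blast
  obtain L' where L': "\<forall>p\<in>set L'. \<forall>i. snd p $ i \<le> 0" "\<And>u. q u = lin_ext (\<lambda>s. exp (s \<bullet> u)) L'"
    using assms(2) unfolding is_exp_sum_def by blast
  show ?thesis
    unfolding is_exp_sum_def using L L' by (intro exI[of _ "L @ L'"]) auto
qed

lemma is_exp_sum_sum:
  "finite A \<Longrightarrow> (\<And>i. i \<in> A \<Longrightarrow> is_exp_sum (f i)) \<Longrightarrow> is_exp_sum (\<lambda>u. \<Sum>i\<in>A. f i u)"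
proof (induction A rule: finite_induct)
  case empty
  then show ?case unfolding is_exp_sum_def by (auto intro!: exI[of _ "[]"])
next
  case (insert x F)
  then show ?case by (auto intro: is_exp_sum_add)
qed

lemma is_exp_sum_mult_exp:
  assumes q: "is_exp_sum q" and s: "\<And>i. s $ i \<le> 0"
  shows "is_exp_sum (\<lambda>u. a * exp (s \<bullet> u) * q u)"
proof -
  obtain L where L: "\<forall>p\<in>set L. \<forall>i. snd p $ i \<le> 0" "\<And>u. q u = lin_ext (\<lambda>s. exp (s \<bullet> u)) L"
    using q unfolding is_exp_sum_def by blast
  have "\<forall>p\<in>set (map (\<lambda>p. (a * fst p, snd p + s)) L). \<forall>i. snd p $ i \<le> 0"
    using L(1) s by (fastforce intro: add_nonpos_nonpos)
  moreover have "a * exp (s \<bullet> u) * q u = lin_ext (\<lambda>s. exp (s \<bullet> u)) (map (\<lambda>p. (a * fst p, snd p + s)) L)" for u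
    by (simp add: lin_ext_map_shift L(2) inner_add_left exp_add lin_ext_cmult[symmetric] mult_ac)
  ultimately show ?thesis unfolding is_exp_sum_def by blast
qed

lemma is_exp_sum_mult:
  assumes "is_exp_sum p" "is_exp_sum q" shows "is_exp_sum (\<lambda>u. p u * q u)"
proof -
  obtain L where L: "\<forall>p\<in>set L. \<forall>i. snd p $ i \<le> 0" "\<And>u. p u = lin_ext (\<lambda>s. exp (s \<bullet> u)) L"
    using assms(1) unfolding is_exp_sum_def by blast
  have "is_exp_sum (\<lambda>u. lin_ext (\<lambda>s. exp (s \<bullet> u)) L * q u)"
    using L(1)
  proof (induction L)
    case Nil
    show ?case unfolding is_exp_sum_def by (auto intro!: exI[of _ "[]"])
  next
    case (Cons p L)
    then have "is_exp_sum (\<lambda>u. fst p * exp (snd p \<bullet> u) * q u + lin_ext (\<lambda>s. exp (s \<bullet> u)) L * q u)"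
      by (intro is_exp_sum_add is_exp_sum_mult_exp assms) auto
    then show ?case by (simp add: distrib_right)
  qed
  then show ?thesis by (simp add: L(2))
qed

text \<open>A coordinate of \<open>exp_vec u\<close> is the exponential whose exponent is minus a
  unit vector, a constant has exponent 0, and sums and products stay in the class.\<close>

lemma is_exp_sum_polynomial:
  fixes q :: "real^'n \<Rightarrow> real"
  assumes "real_polynomial_function q"
  shows "is_exp_sum (\<lambda>u. q (exp_vec u))"
  using assms
proof (induction q)
  case (linear f)
  interpret bounded_linear f by fact
  have "f (exp_vec u) = (\<Sum>i\<in>UNIV. f (axis i 1) * exp (axis i (-1) \<bullet> u))" for u
  proof -
    have "f (exp_vec u) = f (\<Sum>i\<in>UNIV. (exp_vec u $ i) *\<^sub>R axis i 1)"
      using basis_expansion[of "exp_vec u"] by (simp add: scalar_mult_eq_scaleR)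
    also have "\<dots> = (\<Sum>i\<in>UNIV. f (axis i 1) * exp (axis i (-1) \<bullet> u))"
      by (simp add: sum scale inner_axis' exp_vec_def mult.commute)
    finally show ?thesis .
  qed
  then show ?case
    by (auto intro!: is_exp_sum_sum is_exp_sum_exp simp: axis_def)
next
  case (const c)
  show ?case using is_exp_sum_exp[of 0 c] by simp
qed (auto intro: is_exp_sum_add is_exp_sum_mult)

lemma exp_vec_cube: "u \<in> nonneg_orthant \<Longrightarrow> exp_vec u \<in> cbox 0 1"
  by (auto simp: mem_box_cart exp_vec_def nonneg_orthant_def)

lemma exp_vec_inj: "exp_vec u = exp_vec v \<longleftrightarrow> u = v"
  by (auto simp: exp_vec_def vec_eq_iff)

lemma continuous_on_exp_vec: "continuous_on S (exp_vec :: real^'n \<Rightarrow> real^'n)"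
  unfolding exp_vec_def by (intro continuous_intros)

text \<open>The injective map \<open>exp_vec\<close> carries \<open>D\<close> to a compact set,
  whose indicator is a limit of continuous functions; Stone-Weierstrass on the cube replaces these
  by polynomials, that is, by exponential sums. The uniform bound is there for dominated
  convergence.\<close>

lemma indicator_compact_limit:
  fixes D :: "(real^'n) set"
  assumes D: "compact D"
  obtains L :: "nat \<Rightarrow> (real \<times> (real^'n)) list"
  where "\<And>k p. p \<in> set (L k) \<Longrightarrow> snd p \<in> neg_orthant"
    and "\<And>k u. u \<in> nonneg_orthant \<Longrightarrow> 0 \<le> lin_ext (\<lambda>s. exp (s \<bullet> u)) (L k)"
    and "\<And>k u. u \<in> nonneg_orthant \<Longrightarrow> lin_ext (\<lambda>s. exp (s \<bullet> u)) (L k) \<le> 3"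
    and "\<And>u. u \<in> nonneg_orthant \<Longrightarrow> (\<lambda>k. lin_ext (\<lambda>s. exp (s \<bullet> u)) (L k)) \<longlonglongrightarrow> indicator D u"
\<comment> \<open>The distance to the empty set is 0 by convention, so the functions
  \<open>h k\<close> below would be 1 instead of 0.\<close>
proof (cases "D = {}")
  case True
  then show ?thesis by (intro that[of "\<lambda>_. []"]) auto
next
  case False
  define C where "C = exp_vec ` D"
  have C: "closed C" "C \<noteq> {}"
    using False D unfolding C_def by (auto intro!: compact_imp_closed compact_continuous_image continuous_on_exp_vec)
  \<comment> \<open>Continuous bumps that equal 1 on \<open>C\<close> and, at each point off the
    closed set \<open>C\<close>, vanish for all large \<open>k\<close>.\<close>
  define h where "h k x = max 0 (1 - real k * infdist x C)" for k x
  define d where "d k = 1 / real (Suc k)" for k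
  have d: "0 < d k" "d k \<le> 1" for k by (auto simp: d_def)
  \<comment> \<open>Approximating \<open>h k + d k\<close> within \<open>d k\<close> places the sum
    between \<open>h k\<close> and \<open>h k + 2 * d k\<close>: it is nonnegative, at most 3, and
    has the same limit as \<open>h k\<close>.\<close>
  have "\<exists>L. (\<forall>p\<in>set L. \<forall>i. snd p $ i \<le> 0) \<and>
        (\<forall>u\<in>nonneg_orthant. \<bar>h k (exp_vec u) + d k - lin_ext (\<lambda>s. exp (s \<bullet> u)) L\<bar> < d k)" for k
  proof -
    have "continuous_on (cbox 0 1) (\<lambda>x. h k x + d k)"
      unfolding h_def by (intro continuous_intros)
    then obtain g where g: "real_polynomial_function g" "\<And>x. x \<in> cbox 0 1 \<Longrightarrow> \<bar>h k x + d k - g x\<bar> < d k"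
      using Stone_Weierstrass_real_polynomial_function[OF compact_cbox _ d(1)] by blast
    from is_exp_sum_polynomial[OF g(1)] obtain L where
      L: "\<forall>p\<in>set L. \<forall>i. snd p $ i \<le> 0" "\<And>u. g (exp_vec u) = lin_ext (\<lambda>s. exp (s \<bullet> u)) L"
      unfolding is_exp_sum_def by blast
    show ?thesis
      using L g(2) exp_vec_cube by (intro exI[of _ L]) (auto simp: L(2)[symmetric])
  qed
  then obtain L0 where L0: "\<And>k p i. p \<in> set (L0 k) \<Longrightarrow> snd p $ i \<le> 0"
    "\<And>k u. u \<in> nonneg_orthant \<Longrightarrow> \<bar>h k (exp_vec u) + d k - lin_ext (\<lambda>s. exp (s \<bullet> u)) (L0 k)\<bar> < d k"
    by metis
  \<comment> \<open>The factor \<open>exp (c k \<bullet> u)\<close> tends to 1 and moves all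
    exponents into the open orthant; being at most 1 on the closed orthant, it respects the
    bounds.\<close>
  define c :: "nat \<Rightarrow> real^'n" where "c k = (\<chi> i. - d k)" for k
  define L where "L k = map (\<lambda>p. (1 * fst p, snd p + c k)) (L0 k)" for k
  have L: "lin_ext (\<lambda>s. exp (s \<bullet> u)) (L k) = exp (c k \<bullet> u) * lin_ext (\<lambda>s. exp (s \<bullet> u)) (L0 k)" for k u
    unfolding L_def lin_ext_map_shift by (simp add: inner_add_left exp_add lin_ext_cmult[symmetric] mult_ac)
  have h01: "0 \<le> h k x" "h k x \<le> 1" for k x
    unfolding h_def using infdist_nonneg[of x C] by auto
  have ec: "0 \<le> exp (c k \<bullet> u)" "exp (c k \<bullet> u) \<le> 1" if "u \<in> nonneg_orthant" for k u
    using inner_nonpos[of "c k" u] that d(1)[of k] by (auto simp: c_def)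
  have lin: "0 \<le> lin_ext (\<lambda>s. exp (s \<bullet> u)) (L0 k)" "lin_ext (\<lambda>s. exp (s \<bullet> u)) (L0 k) \<le> 3"
    if "u \<in> nonneg_orthant" for k u
    using L0(2)[OF that, of k] h01[of k "exp_vec u"] d[of k] by linarith+
  have dlim: "d \<longlonglongrightarrow> 0"
    unfolding d_def by (rule LIMSEQ_Suc[OF lim_1_over_n])
  show ?thesis
  proof (rule that[of L])
    show "snd p \<in> neg_orthant" if p: "p \<in> set (L k)" for k p
    proof -
      obtain q where "q \<in> set (L0 k)" "snd p = snd q + c k"
        using p by (fastforce simp: L_def)
      then show ?thesis
        using L0(1)[of q k] d(1)[of k] by (auto simp: neg_orthant_def c_def intro: le_less_trans)
    qed
    show "0 \<le> lin_ext (\<lambda>s. exp (s \<bullet> u)) (L k)" if "u \<in> nonneg_orthant" for k u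
      unfolding L using ec[OF that] lin[OF that] by simp
    show "lin_ext (\<lambda>s. exp (s \<bullet> u)) (L k) \<le> 3" if "u \<in> nonneg_orthant" for k u
      unfolding L using mult_mono[OF ec(2)[OF that] lin(2)[OF that]] ec[OF that] lin[OF that] by simp
    show "(\<lambda>k. lin_ext (\<lambda>s. exp (s \<bullet> u)) (L k)) \<longlonglongrightarrow> indicator D u" if u: "u \<in> nonneg_orthant" for u
    proof -
      have hlim: "(\<lambda>k. h k (exp_vec u)) \<longlonglongrightarrow> indicator D u"
      proof (cases "u \<in> D")
        case True
        then have "infdist (exp_vec u) C = 0" by (simp add: C_def)
        then show ?thesis using True by (simp add: h_def)
      next
        case nD: False
        then have "exp_vec u \<notin> C" by (auto simp: C_def exp_vec_inj)
        then have pos: "infdist (exp_vec u) C > 0"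
          using C infdist_pos_not_in_closed by blast
        obtain N :: nat where "1 / infdist (exp_vec u) C < real N" using reals_Archimedean2 by blast
        have "h k (exp_vec u) = 0" if "k \<ge> N" for k
        proof -
          have "1 / infdist (exp_vec u) C < real k" using \<open>_ < real N\<close> that by linarith
          then have "1 \<le> real k * infdist (exp_vec u) C" using pos by (simp add: field_simps)
          then show ?thesis by (simp add: h_def)
        qed
        then have "eventually (\<lambda>k. h k (exp_vec u) = 0) sequentially"
          unfolding eventually_sequentially by blast
        then show ?thesis using nD tendsto_eventually by fastforce
      qed
      have "(\<lambda>k. lin_ext (\<lambda>s. exp (s \<bullet> u)) (L0 k) - h k (exp_vec u)) \<longlonglongrightarrow> 0"
      proof (rule tendsto_sandwich[OF _ _ tendsto_const])
        show "eventually (\<lambda>k. 0 \<le> lin_ext (\<lambda>s. exp (s \<bullet> u)) (L0 k) - h k (exp_vec u)) sequentially"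
          using L0(2)[OF u] by (intro always_eventually allI) (smt (verit))
        show "eventually (\<lambda>k. lin_ext (\<lambda>s. exp (s \<bullet> u)) (L0 k) - h k (exp_vec u) \<le> 2 * d k) sequentially"
          using L0(2)[OF u] by (intro always_eventually allI) (smt (verit))
        show "(\<lambda>k. 2 * d k) \<longlonglongrightarrow> 0" using tendsto_mult_right[OF dlim, of 2] by simp
      qed
      from tendsto_add[OF this hlim]
      have l0: "(\<lambda>k. lin_ext (\<lambda>s. exp (s \<bullet> u)) (L0 k)) \<longlonglongrightarrow> indicator D u" by simp
      have "(\<lambda>k. c k \<bullet> u) = (\<lambda>k. d k * (- (\<Sum>i\<in>UNIV. u $ i)))"
        by (auto simp: c_def inner_vec_def sum_distrib_left sum_negf)
      then have "(\<lambda>k. c k \<bullet> u) \<longlonglongrightarrow> 0"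
        using tendsto_mult_right[OF dlim, of "- (\<Sum>i\<in>UNIV. u $ i)"] tendsto_mult_left_zero[OF dlim] by simp
      then have "(\<lambda>k. exp (c k \<bullet> u)) \<longlonglongrightarrow> exp 0" by (rule tendsto_exp)
      from tendsto_mult[OF this l0] show ?thesis unfolding L by simp
    qed
  qed
qed

section \<open>Finite measures on the orthant\<close>

definition orth_measure :: "(real^'n) measure \<Rightarrow> bool" where
  "orth_measure M \<longleftrightarrow> finite_measure M \<and> measure_on_orthant M"

lemma AE_on_orthant:
  assumes "measure_on_orthant M" shows "AE u in M. u \<in> nonneg_orthant"
proof -
  have "- nonneg_orthant \<in> null_sets M"
    using assms by (auto simp: measure_on_orthant_def null_sets_def)
  then show ?thesis by (rule AE_I') auto
qed

lemma orth_measureD: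
  assumes "orth_measure M"
  shows "finite_measure M" "sets M = sets borel" "space M = UNIV" "AE u in M. u \<in> nonneg_orthant"
proof -
  show "finite_measure M" and s: "sets M = sets borel"
    using assms by (auto simp: orth_measure_def measure_on_orthant_def)
  show "space M = UNIV" using sets_eq_imp_space_eq[OF s] by simp
  show "AE u in M. u \<in> nonneg_orthant"
    using assms by (intro AE_on_orthant) (simp add: orth_measure_def)
qed

lemma orth_measure_integrable_exp:
  assumes M: "orth_measure M" and s: "s \<in> neg_orthant"
  shows "integrable M (\<lambda>u. exp (s \<bullet> u))"
proof -
  interpret finite_measure M using orth_measureD[OF M] by simp
  have [measurable_cong]: "sets M = sets borel" using orth_measureD[OF M] by simp
  show ?thesis
    using orth_measureD(4)[OF M] neg_inner_nonpos[OF s]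
    by (intro integrable_const_bound[of _ 1]) auto
qed

text \<open>The order of quantifiers matters: one sequence \<open>L\<close> serves all finite
  measures on the orthant. This permits comparing two measures, and also following the mass of
  \<open>D\<close> along a family of measures, as in \<open>nu_kernel\<close>.\<close>

lemma compact_measure_limit:
  fixes D :: "(real^'n) set"
  assumes D: "compact D"
  obtains L :: "nat \<Rightarrow> (real \<times> (real^'n)) list"
  where "\<And>k p. p \<in> set (L k) \<Longrightarrow> snd p \<in> neg_orthant"
    and "\<And>k u. u \<in> nonneg_orthant \<Longrightarrow> 0 \<le> lin_ext (\<lambda>s. exp (s \<bullet> u)) (L k)"
    and "\<And>K. orth_measure K \<Longrightarrow> (\<lambda>k. lin_ext (\<lambda>s. \<integral>u. exp (s \<bullet> u) \<partial>K) (L k)) \<longlonglongrightarrow> measure K D"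
proof -
  have [measurable]: "D \<in> sets borel" using D by (simp add: borel_compact)
  obtain L :: "nat \<Rightarrow> (real \<times> (real^'n)) list" where
    L: "\<And>k p. p \<in> set (L k) \<Longrightarrow> snd p \<in> neg_orthant"
      "\<And>k u. u \<in> nonneg_orthant \<Longrightarrow> 0 \<le> lin_ext (\<lambda>s. exp (s \<bullet> u)) (L k)"
      "\<And>k u. u \<in> nonneg_orthant \<Longrightarrow> lin_ext (\<lambda>s. exp (s \<bullet> u)) (L k) \<le> 3"
      "\<And>u. u \<in> nonneg_orthant \<Longrightarrow> (\<lambda>k. lin_ext (\<lambda>s. exp (s \<bullet> u)) (L k)) \<longlonglongrightarrow> indicator D u"
    using indicator_compact_limit[OF D] by metis
  show ?thesis
  proof (rule that[of L, OF L(1,2)])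
    fix K :: "(real^'n) measure" assume K: "orth_measure K"
    interpret K: finite_measure K using orth_measureD[OF K] by simp
    have [measurable_cong]: "sets K = sets borel" using orth_measureD[OF K] by auto
    have "(\<lambda>k. \<integral>u. lin_ext (\<lambda>s. exp (s \<bullet> u)) (L k) \<partial>K) \<longlonglongrightarrow> (\<integral>u. indicator D u \<partial>K)"
    proof (rule integral_dominated_convergence[where w="\<lambda>_. 3"])
      show "AE u in K. (\<lambda>k. lin_ext (\<lambda>s. exp (s \<bullet> u)) (L k)) \<longlonglongrightarrow> indicator D u"
        using orth_measureD(4)[OF K] L(4) by auto
      show "AE u in K. norm (lin_ext (\<lambda>s. exp (s \<bullet> u)) (L k)) \<le> 3" for k
        using orth_measureD(4)[OF K] L(2,3) by auto
    qed auto
    moreover have "(\<integral>u. lin_ext (\<lambda>s. exp (s \<bullet> u)) (L k) \<partial>K) = lin_ext (\<lambda>s. \<integral>u. exp (s \<bullet> u) \<partial>K) (L k)" for k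
      by (rule integral_lin_ext) (use L(1) orth_measure_integrable_exp[OF K] in auto)
    ultimately show "(\<lambda>k. lin_ext (\<lambda>s. \<integral>u. exp (s \<bullet> u) \<partial>K) (L k)) \<longlonglongrightarrow> measure K D" by simp
  qed auto
qed

text \<open>The hypothesis gives the inequality on compact sets through
  \<open>compact_measure_limit\<close>, and inner regularity extends it to Borel sets. Both
  uniqueness of Laplace transforms and the sign of f_t rest on this.\<close>

lemma orth_measure_le:
  fixes M N :: "(real^'n) measure"
  assumes M: "orth_measure M" and N: "orth_measure N"
    and le: "\<And>L. (\<And>p. p \<in> set L \<Longrightarrow> snd p \<in> neg_orthant) \<Longrightarrow>
        (\<And>u. u \<in> nonneg_orthant \<Longrightarrow> 0 \<le> lin_ext (\<lambda>s. exp (s \<bullet> u)) L) \<Longrightarrow>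
        lin_ext (\<lambda>s. \<integral>u. exp (s \<bullet> u) \<partial>N) L \<le> lin_ext (\<lambda>s. \<integral>u. exp (s \<bullet> u) \<partial>M) L"
    and B: "B \<in> sets borel"
  shows "emeasure N B \<le> emeasure M B"
proof -
  interpret M: finite_measure M using orth_measureD[OF M] by simp
  interpret N: finite_measure N using orth_measureD[OF N] by simp
  have [measurable_cong]: "sets M = sets borel" "sets N = sets borel" 
    using orth_measureD[OF M] orth_measureD[OF N] by auto
  have "emeasure N D \<le> emeasure M D" if D: "compact D" for D
  proof -
    obtain L :: "nat \<Rightarrow> (real \<times> (real^'n)) list" where
      L: "\<And>k p. p \<in> set (L k) \<Longrightarrow> snd p \<in> neg_orthant"
        "\<And>k u. u \<in> nonneg_orthant \<Longrightarrow> 0 \<le> lin_ext (\<lambda>s. exp (s \<bullet> u)) (L k)"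
        "\<And>K. orth_measure K \<Longrightarrow> (\<lambda>k. lin_ext (\<lambda>s. \<integral>u. exp (s \<bullet> u) \<partial>K) (L k)) \<longlonglongrightarrow> measure K D"
      using compact_measure_limit[OF D] by metis
    have "measure N D \<le> measure M D"
      by (rule LIMSEQ_le[OF L(3)[OF N] L(3)[OF M]]) (use L(1,2) le in blast)
    then show ?thesis by (simp add: M.emeasure_eq_measure N.emeasure_eq_measure)
  qed
  then have *: "(SUP K \<in> {K. K \<subseteq> B \<and> compact K}. emeasure N K) \<le> (SUP K \<in> {K. K \<subseteq> B \<and> compact K}. emeasure M K)"
    by (intro SUP_mono) auto
  show ?thesis
    using * inner_regular[of M B] inner_regular[of N B] B orth_measureD(2)[OF M] orth_measureD(2)[OF N]
    by (simp add: M.emeasure_finite N.emeasure_finite)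
qed

lemma orth_measure_eqI:
  fixes M N :: "(real^'n) measure"
  assumes M: "orth_measure M" and N: "orth_measure N"
    and eq: "\<And>s. s \<in> neg_orthant \<Longrightarrow> (\<integral>u. exp (s \<bullet> u) \<partial>M) = (\<integral>u. exp (s \<bullet> u) \<partial>N)"
  shows "M = N"
proof (rule measure_eqI)
  show "sets M = sets N" using orth_measureD(2)[OF M] orth_measureD(2)[OF N] by simp
  fix A assume "A \<in> sets M"
  then have A: "A \<in> sets borel" using orth_measureD(2)[OF M] by simp
  have 1: "lin_ext (\<lambda>s. \<integral>u. exp (s \<bullet> u) \<partial>N) L = lin_ext (\<lambda>s. \<integral>u. exp (s \<bullet> u) \<partial>M) L"
    if "\<And>p. p \<in> set L \<Longrightarrow> snd p \<in> neg_orthant" for L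
    using that eq by (auto intro!: lin_ext_cong)
  show "emeasure M A = emeasure N A"
    by (rule antisym[OF orth_measure_le[OF N M _ A] orth_measure_le[OF M N _ A]]) (simp_all add: 1)
qed

lemma orth_measureI:
  assumes "finite_measure M" "sets M = sets borel" "AE u in M. u \<in> nonneg_orthant"
  shows "orth_measure M"
proof -
  have "(- nonneg_orthant) \<in> sets M" using assms(2) by simp
  moreover have sp: "space M = UNIV" using sets_eq_imp_space_eq[OF assms(2)] by simp
  ultimately have "emeasure M (- nonneg_orthant) = 0"
    using assms(3) AE_iff_measurable[of "- nonneg_orthant" M "\<lambda>u. u \<in> nonneg_orthant"] by (auto simp: Compl_eq)
  then show ?thesis using assms by (auto simp: orth_measure_def measure_on_orthant_def)
qed

lemma orth_measure_return_0: "orth_measure (return borel (0 :: real^'n))"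
proof -
  interpret prob_space "return borel (0 :: real^'n)" by (rule prob_space_return) simp
  show ?thesis
    by (rule orth_measureI[OF finite_measure_axioms]) (auto simp: AE_return nonneg_orthant_def)
qed

lemma laplace_return_0: "(\<integral>u. exp (s \<bullet> u) \<partial>return borel (0 :: real^'n)) = 1"
  by (subst integral_return) auto

lemma neg_one_in_neg_orthant [simp]: "(- 1 :: real^'n) \<in> neg_orthant"
  by (simp add: neg_orthant_def)

text \<open>On the orthant, \<open>(- 1) \<bullet> v\<close> is minus the l1 norm of
  \<open>v\<close>, which dominates the Euclidean norm.\<close>

lemma exp_neg_one_gap:
  fixes v :: "real^'n"
  assumes "v \<in> nonneg_orthant" "\<delta> \<le> norm v"
  shows "1 - exp (- \<delta>) \<le> 1 - exp ((- 1) \<bullet> v)"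
proof -
  have "\<delta> \<le> (\<Sum>i\<in>UNIV. \<bar>v $ i\<bar>)" using norm_le_l1_cart[of v] assms(2) by linarith
  also have "\<dots> = - ((- 1) \<bullet> v)"
    using assms(1) by (auto simp: inner_vec_def nonneg_orthant_def sum_negf)
  finally show ?thesis by simp
qed

section \<open>Convolutions and sums of finite measures, and concentration near the origin\<close>

lemma orth_measure_nn_exp:
  assumes M: "orth_measure M" and s: "s \<in> neg_orthant"
  shows "(\<integral>\<^sup>+u. ennreal (exp (s \<bullet> u)) \<partial>M) = ennreal (\<integral>u. exp (s \<bullet> u) \<partial>M)"
  by (intro nn_integral_eq_integral orth_measure_integrable_exp[OF M s]) auto

lemma orth_measure_conv:
  assumes a: "orth_measure a" and b: "orth_measure b"
  shows "orth_measure (a \<star> b)"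
    and "s \<in> neg_orthant \<Longrightarrow>
      (\<integral>u. exp (s \<bullet> u) \<partial>(a \<star> b)) = (\<integral>u. exp (s \<bullet> u) \<partial>a) * (\<integral>u. exp (s \<bullet> u) \<partial>b)"
proof -
  interpret a: finite_measure a using orth_measureD[OF a] by simp
  interpret b: finite_measure b using orth_measureD[OF b] by simp
  have [measurable_cong, simp]: "sets a = sets borel" "sets b = sets borel" "space a = UNIV" "space b = UNIV"
    using orth_measureD[OF a] orth_measureD[OF b] by auto
  have "emeasure (a \<star> b) (- nonneg_orthant) = (\<integral>\<^sup>+x. \<integral>\<^sup>+y. indicator (- nonneg_orthant) (x + y) \<partial>b \<partial>a)"
    by (intro convolution_emeasure' a.finite_measure_axioms b.finite_measure_axioms) auto
  also have "\<dots> = (\<integral>\<^sup>+x. 0 \<partial>a)"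
  proof (rule nn_integral_cong_AE)
    show "AE x in a. (\<integral>\<^sup>+y. indicator (- nonneg_orthant) (x + y) \<partial>b) = 0"
      using orth_measureD(4)[OF a]
    proof eventually_elim
      case (elim x)
      have "(\<integral>\<^sup>+y. indicator (- nonneg_orthant) (x + y) \<partial>b) = (\<integral>\<^sup>+y. 0 \<partial>b)"
      proof (rule nn_integral_cong_AE)
        show "AE y in b. indicator (- nonneg_orthant) (x + y) = (0::ennreal)"
          using orth_measureD(4)[OF b]
            by eventually_elim (use elim in \<open>auto simp: nonneg_orthant_def indicator_def\<close>)
      qed
      then show ?case by simp
    qed
  qed
  finally have "emeasure (a \<star> b) (- nonneg_orthant) = 0" by simp
  then show conv: "orth_measure (a \<star> b)"
    by (auto simp: orth_measure_def measure_on_orthant_def intro!: convolution_finite a.finite_measure_axioms b.finite_measure_axioms)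
  assume s: "s \<in> neg_orthant"
  have "ennreal (\<integral>u. exp (s \<bullet> u) \<partial>(a \<star> b)) = (\<integral>\<^sup>+u. ennreal (exp (s \<bullet> u)) \<partial>(a \<star> b))"
    by (rule orth_measure_nn_exp[OF conv s, symmetric])
  also have "\<dots> = (\<integral>\<^sup>+x. \<integral>\<^sup>+y. ennreal (exp (s \<bullet> (x + y))) \<partial>b \<partial>a)"
    by (intro nn_integral_convolution a.finite_measure_axioms b.finite_measure_axioms) auto
  also have "\<dots> = (\<integral>\<^sup>+x. ennreal (exp (s \<bullet> x)) * (\<integral>\<^sup>+y. ennreal (exp (s \<bullet> y)) \<partial>b) \<partial>a)"
    by (subst nn_integral_cmult[symmetric]) (auto simp: inner_add_right exp_add ennreal_mult)
  also have "\<dots> = ennreal (\<integral>u. exp (s \<bullet> u) \<partial>a) * ennreal (\<integral>u. exp (s \<bullet> u) \<partial>b)"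
    by (subst nn_integral_multc) (auto simp: orth_measure_nn_exp[OF a s] orth_measure_nn_exp[OF b s])
  also have "\<dots> = ennreal ((\<integral>u. exp (s \<bullet> u) \<partial>a) * (\<integral>u. exp (s \<bullet> u) \<partial>b))"
    by (simp add: ennreal_mult)
  finally show "(\<integral>u. exp (s \<bullet> u) \<partial>(a \<star> b)) = (\<integral>u. exp (s \<bullet> u) \<partial>a) * (\<integral>u. exp (s \<bullet> u) \<partial>b)"
    by (subst (asm) ennreal_inj) auto
qed

text \<open>Lets an identity a - b = c - d between differences of measures be stated with positive
  measures, as a + d = c + b.\<close>

definition add_measure :: "'a::topological_space measure \<Rightarrow> 'a measure \<Rightarrow> 'a measure" where
  "add_measure M N = measure_of UNIV (sets borel) (\<lambda>A. emeasure M A + emeasure N A)"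

lemma sets_add_measure [simp, measurable_cong]: "sets (add_measure M N) = sets borel"
  and space_add_measure [simp]: "space (add_measure M N) = UNIV"
proof -
  have "sigma_sets UNIV (sets borel) = (sets borel :: 'a set set)"
    using sets.sigma_sets_eq[of borel] by simp
  then show "sets (add_measure M N) = sets borel" "space (add_measure M N) = UNIV"
    by (simp_all add: add_measure_def)
qed

lemma emeasure_add_measure:
  assumes "sets M = sets borel" "sets N = sets borel" "A \<in> sets borel"
  shows "emeasure (add_measure M N) A = emeasure M A + emeasure N A"
proof (rule emeasure_measure_of[OF add_measure_def])
  show "countably_additive (sets (add_measure M N)) (\<lambda>A. emeasure M A + emeasure N A)"
    using assms by (auto simp: countably_additive_def suminf_add[symmetric] suminf_emeasure)
qed (use assms in \<open>auto simp: positive_def\<close>)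

lemma nn_integral_add_measure:
  assumes [measurable_cong]: "sets M = sets borel" "sets N = sets borel" and f: "f \<in> borel_measurable borel"
  shows "(\<integral>\<^sup>+x. f x \<partial>add_measure M N) = (\<integral>\<^sup>+x. f x \<partial>M) + (\<integral>\<^sup>+x. f x \<partial>N)"
  using f
proof (induction rule: borel_measurable_induct)
  case (cong f g)
  then have "f = g" by auto
  then show ?case using cong by simp
next
  case (set A)
  then show ?case using assms by (simp add: emeasure_add_measure)
next
  case (mult u c)
  then show ?case by (simp add: nn_integral_cmult distrib_left)
next
  case (add u v)
  then show ?case by (simp add: nn_integral_add ac_simps)
next
  case (seq U)
  have mono: "incseq (\<lambda>i. \<integral>\<^sup>+x. U i x \<partial>K)" for K :: "'a measure"
    using seq(3) by (auto simp: incseq_def le_fun_def intro!: nn_integral_mono)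
  have *: "(\<integral>\<^sup>+x. (SUP i. U i x) \<partial>K) = (SUP i. \<integral>\<^sup>+x. U i x \<partial>K)" if "sets K = sets borel" for K
    using seq(1,3) measurable_cong_sets[OF that refl] by (intro nn_integral_monotone_convergence_SUP) auto
  have "(SUP i. U i) = (\<lambda>x. SUP i. U i x)" by (simp add: fun_eq_iff image_comp comp_def)
  moreover have "(SUP i. \<integral>\<^sup>+x. U i x \<partial>add_measure M N) = (SUP i. (\<integral>\<^sup>+x. U i x \<partial>M) + (\<integral>\<^sup>+x. U i x \<partial>N))"
    using seq.IH by simp
  ultimately show ?case
    using assms mono by (simp add: * ennreal_SUP_add)
qed

lemma orth_measure_add:
  assumes a: "orth_measure a" and b: "orth_measure b"
  shows "orth_measure (add_measure a b)"
    and "s \<in> neg_orthant \<Longrightarrow>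
      (\<integral>u. exp (s \<bullet> u) \<partial>(add_measure a b)) = (\<integral>u. exp (s \<bullet> u) \<partial>a) + (\<integral>u. exp (s \<bullet> u) \<partial>b)"
proof -
  interpret a: finite_measure a using orth_measureD[OF a] by simp
  interpret b: finite_measure b using orth_measureD[OF b] by simp
  have [measurable_cong, simp]: "sets a = sets borel" "sets b = sets borel"
    using orth_measureD[OF a] orth_measureD[OF b] by auto
  have "emeasure a (- nonneg_orthant) = 0" "emeasure b (- nonneg_orthant) = 0"
    using a b by (auto simp: orth_measure_def measure_on_orthant_def)
  then show add: "orth_measure (add_measure a b)"
    by (auto simp: orth_measure_def measure_on_orthant_def emeasure_add_measure intro!: finite_measureI)
  assume s: "s \<in> neg_orthant"
  have "ennreal (\<integral>u. exp (s \<bullet> u) \<partial>(add_measure a b)) = ennreal (\<integral>u. exp (s \<bullet> u) \<partial>a) + ennreal (\<integral>u. exp (s \<bullet> u) \<partial>b)"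
    by (simp add: orth_measure_nn_exp[OF _ s, symmetric] a b add nn_integral_add_measure)
  also have "\<dots> = ennreal ((\<integral>u. exp (s \<bullet> u) \<partial>a) + (\<integral>u. exp (s \<bullet> u) \<partial>b))" by simp
  finally show "(\<integral>u. exp (s \<bullet> u) \<partial>(add_measure a b)) = (\<integral>u. exp (s \<bullet> u) \<partial>a) + (\<integral>u. exp (s \<bullet> u) \<partial>b)"
    by (subst (asm) ennreal_inj) auto
qed

text \<open>Markov's inequality for \<open>1 - exp ((- 1) \<bullet> u)\<close>. A measure whose
  transform at this single point nearly equals its mass must live near 0.\<close>

lemma orth_measure_concentration:
  fixes M :: "(real^'n) measure"
  assumes M: "orth_measure M" and \<delta>: "0 < \<delta>"
  shows "measure M {u. \<delta> \<le> norm u} * (1 - exp (- \<delta>)) \<le> measure M UNIV - (\<integral>u. exp ((- 1) \<bullet> u) \<partial>M)"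
proof -
  interpret finite_measure M using orth_measureD[OF M] by simp
  have [measurable_cong, simp]: "sets M = sets borel" "space M = UNIV" using orth_measureD[OF M] by auto
  note int = orth_measure_integrable_exp[OF M neg_one_in_neg_orthant]
  have "measure M {u. \<delta> \<le> norm u} * (1 - exp (- \<delta>)) = (\<integral>u. indicator {u. \<delta> \<le> norm u} u * (1 - exp (- \<delta>)) \<partial>M)"
    by simp
  also have "\<dots> \<le> (\<integral>u. 1 - exp ((- 1) \<bullet> u) \<partial>M)"
  proof (rule integral_mono_AE)
    show "AE u in M. indicator {u. \<delta> \<le> norm u} u * (1 - exp (- \<delta>)) \<le> 1 - exp ((- 1) \<bullet> u)"
      using orth_measureD(4)[OF M]
    proof eventually_elim
      case (elim u)
      then show ?case using exp_neg_one_gap[of u \<delta>] neg_inner_nonpos[of "- 1" u]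
        by (cases "\<delta> \<le> norm u") auto
    qed
    show "integrable M (\<lambda>u. 1 - exp ((- 1) \<bullet> u))" using int by auto
    show "integrable M (\<lambda>u. indicator {u. \<delta> \<le> norm u} u * (1 - exp (- \<delta>)))"
      by (intro integrable_const_bound[of _ "\<bar>1 - exp (- \<delta>)\<bar>"]) (auto simp: indicator_def)
  qed
  also have "\<dots> = measure M UNIV - (\<integral>u. exp ((- 1) \<bullet> u) \<partial>M)"
    by (subst Bochner_Integration.integral_diff) (use int in auto)
  finally show ?thesis .
qed

section \<open>Positive functionals on exponential sums\<close>

definition pos_functional :: "(real^'n \<Rightarrow> real) \<Rightarrow> bool" where
  "pos_functional F \<longleftrightarrow> (\<forall>L. (\<forall>p\<in>set L. snd p \<in> neg_orthant) \<longrightarrow>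
     (\<forall>u\<in>nonneg_orthant. 0 \<le> lin_ext (\<lambda>s. exp (s \<bullet> u)) L) \<longrightarrow> 0 \<le> lin_ext F L)"

text \<open>This is evaluation at \<open>u = 0\<close>, the transform of the unit mass
  there.\<close>

lemma pos_functional_one: "pos_functional (\<lambda>_. 1)"
  unfolding pos_functional_def
proof (intro allI impI)
  fix L :: "(real \<times> (real^'n)) list"
  assume "\<forall>u\<in>nonneg_orthant. 0 \<le> lin_ext (\<lambda>s. exp (s \<bullet> u)) L"
  moreover have "(0 :: real^'n) \<in> nonneg_orthant" by (simp add: nonneg_orthant_def)
  ultimately have "0 \<le> lin_ext (\<lambda>s. exp (s \<bullet> 0)) L" by blast
  then show "0 \<le> lin_ext (\<lambda>_. 1) L" by simp
qed

lemma pos_functional_add: "pos_functional F \<Longrightarrow> pos_functional G \<Longrightarrow> pos_functional (\<lambda>s. F s + G s)"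
  by (simp add: pos_functional_def lin_ext_add)

lemma pos_functional_cmult: "0 \<le> c \<Longrightarrow> pos_functional F \<Longrightarrow> pos_functional (\<lambda>s. c * F s)"
  by (simp add: pos_functional_def lin_ext_cmult)

text \<open>Stability under pointwise limits is the advantage of positivity over exhibiting a
  measure with transform \<open>F\<close>.\<close>

lemma pos_functional_limit:
  fixes G :: "real^'n \<Rightarrow> real"
  assumes F: "\<And>k. pos_functional (F k)"
    and lim: "\<And>s. s \<in> neg_orthant \<Longrightarrow> (\<lambda>k. F k s) \<longlonglongrightarrow> G s"
  shows "pos_functional G"
  unfolding pos_functional_def
proof (intro allI impI)
  fix L :: "(real \<times> (real^'n)) list" assume L: "\<forall>p\<in>set L. snd p \<in> neg_orthant" "\<forall>u\<in>nonneg_orthant. 0 \<le> lin_ext (\<lambda>s. exp (s \<bullet> u)) L"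
  show "0 \<le> lin_ext G L"
  proof (rule LIMSEQ_le_const)
    show "(\<lambda>k. lin_ext (F k) L) \<longlonglongrightarrow> lin_ext G L" using L lim by (intro lin_ext_tendsto) auto
    show "\<exists>N. \<forall>k\<ge>N. 0 \<le> lin_ext (F k) L" using F L by (auto simp: pos_functional_def)
  qed
qed

text \<open>The functional analogue of convolving with \<open>K\<close>. For fixed \<open>v\<close>
  in the orthant, weighting the coefficients by \<open>exp (s \<bullet> v)\<close> translates the
  sum by \<open>v\<close>, and the orthant is closed under addition, so the translate is still
  nonnegative there; \<open>F\<close> is positive on each translate, and integrating over
  \<open>v\<close> keeps the sign.\<close>

lemma pos_functional_mult_laplace:
  fixes F :: "real^'n \<Rightarrow> real"
  assumes K: "orth_measure K" and F: "pos_functional F"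
  shows "pos_functional (\<lambda>s. (\<integral>v. exp (s \<bullet> v) \<partial>K) * F s)"
  unfolding pos_functional_def
proof (intro allI impI)
  fix L :: "(real \<times> (real^'n)) list" assume L: "\<forall>p\<in>set L. snd p \<in> neg_orthant" "\<forall>u\<in>nonneg_orthant. 0 \<le> lin_ext (\<lambda>s. exp (s \<bullet> u)) L"
  let ?L = "map (\<lambda>p. (fst p * F (snd p), snd p)) L"
  have "lin_ext (\<lambda>s. (\<integral>v. exp (s \<bullet> v) \<partial>K) * F s) L = lin_ext (\<lambda>s. \<integral>v. exp (s \<bullet> v) \<partial>K) ?L"
    by (simp add: lin_ext_map_scale mult.commute)
  also have "\<dots> = (\<integral>v. lin_ext (\<lambda>s. exp (s \<bullet> v)) ?L \<partial>K)"
    by (rule integral_lin_ext(2)[symmetric]) (use L(1) orth_measure_integrable_exp[OF K] in auto)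
  also have "0 \<le> \<dots>"
  proof (rule integral_nonneg_AE)
    show "AE v in K. 0 \<le> lin_ext (\<lambda>s. exp (s \<bullet> v)) ?L"
      using orth_measureD(4)[OF K]
    proof eventually_elim
      case (elim v)
      let ?L' = "map (\<lambda>p. (fst p * exp (snd p \<bullet> v), snd p)) L"
      have "0 \<le> lin_ext F ?L'"
      proof -
        have "0 \<le> lin_ext (\<lambda>s. exp (s \<bullet> u)) ?L'" if "u \<in> nonneg_orthant" for u
        proof -
          have "v + u \<in> nonneg_orthant" using that elim by (auto simp: nonneg_orthant_def)
          then have "0 \<le> lin_ext (\<lambda>s. exp (s \<bullet> (v + u))) L" using L(2) by blast
          then show ?thesis by (simp add: lin_ext_map_scale[where G="\<lambda>s. exp (s \<bullet> v)"] inner_add_right exp_add)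
        qed
        moreover have "\<forall>p\<in>set ?L'. snd p \<in> neg_orthant" using L(1) by auto
        ultimately show ?thesis using F unfolding pos_functional_def by blast
      qed
      then show ?case by (simp add: lin_ext_map_scale lin_ext_map_scale[where G="\<lambda>s. exp (s \<bullet> v)"] mult.commute)
    qed
  qed
  finally show "0 \<le> lin_ext (\<lambda>s. (\<integral>v. exp (s \<bullet> v) \<partial>K) * F s) L" .
qed

text \<open>With F the transform of \<open>K\<close>, each power (1 + t F / m)^j is positive by
  induction on j, and (1 + t F / m)^m converges to exp(t F).\<close>

lemma pos_functional_exp_laplace:
  assumes K: "orth_measure K" and t: "0 \<le> t"
  shows "pos_functional (\<lambda>s. exp (t * (\<integral>v. exp (s \<bullet> v) \<partial>K)))"
proof (rule pos_functional_limit)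
  fix m :: nat
  have *: "pos_functional (\<lambda>s. (1 + t * (\<integral>v. exp (s \<bullet> v) \<partial>K) / real m) ^ j)" for j
  proof (induction j)
    case 0
    show ?case using pos_functional_one by simp
  next
    case (Suc j)
    have "pos_functional (\<lambda>s. (1 + t * (\<integral>v. exp (s \<bullet> v) \<partial>K) / real m) ^ j +
        (t / real m) * ((\<integral>v. exp (s \<bullet> v) \<partial>K) * (1 + t * (\<integral>v. exp (s \<bullet> v) \<partial>K) / real m) ^ j))"
      using t by (intro pos_functional_add pos_functional_cmult pos_functional_mult_laplace[OF K] Suc) auto
    then show ?case by (simp add: algebra_simps)
  qed
  show "pos_functional (\<lambda>s. (1 + t * (\<integral>v. exp (s \<bullet> v) \<partial>K) / real m) ^ m)" by (rule *)
qed (rule tendsto_exp_limit_sequentially)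

section \<open>The convolution semigroup and its increments\<close>

locale levy_rep =
  fixes \<psi> :: "real^'n \<Rightarrow> real" and \<mu> :: "(real^'n) measure"
  assumes rep: "represents \<psi> 0 0 \<mu>"
begin

lemma sets_mu [simp, measurable_cong]: "sets \<mu> = sets borel"
  and space_mu [simp]: "space \<mu> = UNIV"
proof -
  show s: "sets \<mu> = sets borel" using rep by (auto simp: represents_def measure_on_orthant_def)
  show "space \<mu> = UNIV" using sets_eq_imp_space_eq[OF s] by simp
qed

lemma AE_mu: "AE v in \<mu>. v \<in> nonneg_orthant"
  using rep by (intro AE_on_orthant) (auto simp: represents_def)

text \<open>The integrand vanishes at 0 and the complement of the orthant is null, so the set
  integrals of the representation become plain ones.\<close>

lemma psi_rep:
  assumes "s \<in> neg_orthant"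
  shows "integrable \<mu> (\<lambda>v. exp (s \<bullet> v) - 1)" "\<psi> s = (\<integral>v. exp (s \<bullet> v) - 1 \<partial>\<mu>)"
proof -
  have *: "AE v in \<mu>. indicator (nonneg_orthant - {0}) v *\<^sub>R (exp (s \<bullet> v) - 1) = exp (s \<bullet> v) - 1"
    using AE_mu by eventually_elim (auto simp: indicator_def)
  have r: "integrable \<mu> (\<lambda>v. indicator (nonneg_orthant - {0}) v *\<^sub>R (exp (s \<bullet> v) - 1))"
    "\<psi> s = (\<integral>v. indicator (nonneg_orthant - {0}) v *\<^sub>R (exp (s \<bullet> v) - 1) \<partial>\<mu>)"
    using rep assms unfolding represents_def set_integrable_def set_lebesgue_integral_def by auto
  show "integrable \<mu> (\<lambda>v. exp (s \<bullet> v) - 1)"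
    by (rule integrable_cong_AE_imp[OF r(1)]) (use * in auto)
  show "\<psi> s = (\<integral>v. exp (s \<bullet> v) - 1 \<partial>\<mu>)"
    unfolding r(2) by (rule integral_cong_AE) (use * in auto)
qed

lemma psi_nonpos: "s \<in> neg_orthant \<Longrightarrow> \<psi> s \<le> 0"
  using integral_mono_AE[of \<mu> "\<lambda>v. exp (s \<bullet> v) - 1" "\<lambda>_. 0"] psi_rep[of s]
    AE_mp[OF AE_mu AE_I2[of \<mu> "\<lambda>v. v \<in> nonneg_orthant \<longrightarrow> s \<bullet> v \<le> 0"]] neg_inner_nonpos[of s]
  by auto

definition truncated :: "nat \<Rightarrow> (real^'n) measure" where
  "truncated k = density \<mu> (indicator {v. 1 / real (Suc k) \<le> norm v})"

text \<open>Only near 0 can \<mu> have infinite mass: \<open>1 - exp ((- 1) \<bullet> v)\<close> is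
  \<mu>-integrable and bounded below off a ball about 0.\<close>

lemma emeasure_mu_away: "emeasure \<mu> {v. 1 / real (Suc k) \<le> norm v} < \<infinity>"
proof -
  define e where "e = 1 - exp (- (1 / real (Suc k)))"
  have e: "e > 0" by (auto simp: e_def)
  have "ennreal e * emeasure \<mu> {v. 1 / real (Suc k) \<le> norm v} = (\<integral>\<^sup>+v. ennreal e * indicator {v. 1 / real (Suc k) \<le> norm v} v \<partial>\<mu>)"
    by (subst nn_integral_cmult_indicator) auto
  also have "\<dots> \<le> (\<integral>\<^sup>+v. norm (exp ((- 1) \<bullet> v) - 1) \<partial>\<mu>)"
  proof (rule nn_integral_mono_AE)
    show "AE v in \<mu>. ennreal e * indicator {v. 1 / real (Suc k) \<le> norm v} v \<le> ennreal (norm (exp ((- 1) \<bullet> v) - 1))"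
      using AE_mu
    proof eventually_elim
      case (elim v)
      have "exp ((- 1) \<bullet> v) \<le> 1" using neg_inner_nonpos[OF neg_one_in_neg_orthant elim] by simp
      then have "e \<le> norm (exp ((- 1) \<bullet> v) - 1)" if "1 / real (Suc k) \<le> norm v"
        using exp_neg_one_gap[OF elim that] unfolding e_def real_norm_def by linarith
      then show ?case
        by (cases "1 / real (Suc k) \<le> norm v") (auto intro!: ennreal_leI)
    qed
  qed
  also have "\<dots> < \<infinity>" using psi_rep(1)[of "- 1"] by (auto simp: integrable_iff_bounded)
  finally show ?thesis using e by (auto simp: ennreal_mult_less_top)
qed

lemma orth_measure_truncated: "orth_measure (truncated k)"
proof (rule orth_measureI)
  show "finite_measure (truncated k)"
    using emeasure_mu_away[of k] by (intro finite_measureI) (auto simp: truncated_def emeasure_density)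
  show "sets (truncated k) = sets borel" by (simp add: truncated_def)
  show "AE u in truncated k. u \<in> nonneg_orthant"
    using AE_mu unfolding truncated_def by (subst AE_density) (auto elim: eventually_mono)
qed

text \<open>Needed for Fubini on the product of \<mu> with Lebesgue measure. The cover consists of
  the null set {0} and the complements of balls about 0.\<close>

lemma sigma_finite_mu: "sigma_finite_measure \<mu>"
proof
  let ?A = "insert {0} (range (\<lambda>k. {v. 1 / real (Suc k) \<le> norm v}))"
  have "emeasure \<mu> {0} = 0" using rep by (auto simp: represents_def)
  moreover have "v \<in> \<Union> ?A" for v
  proof (cases "v = 0")
    case False
    then obtain k where "inverse (real (Suc k)) < norm v" using reals_Archimedean[of "norm v"] by auto
    then show ?thesis by (auto intro!: exI[of _ k] simp: divide_inverse)
  qed auto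
  ultimately show "\<exists>A. countable A \<and> A \<subseteq> sets \<mu> \<and> \<Union> A = space \<mu> \<and> (\<forall>a\<in>A. emeasure \<mu> a \<noteq> \<infinity>)"
    using emeasure_mu_away by (intro exI[of _ ?A]) (auto simp: less_top)
qed

text \<open>For a truncated measure the exponential is of compound Poisson type: a positive
  constant, coming from the finite total mass, times the exponential of a Laplace transform.
  Dominated convergence removes the truncation.\<close>

lemma pos_functional_exp_psi:
  assumes t: "0 \<le> t"
  shows "pos_functional (\<lambda>s. exp (t * \<psi> s))"
proof (rule pos_functional_limit)
  fix k
  have "pos_functional (\<lambda>s. exp (- t * measure (truncated k) UNIV) * exp (t * (\<integral>v. exp (s \<bullet> v) \<partial>truncated k)))"
    by (intro pos_functional_cmult pos_functional_exp_laplace orth_measure_truncated t) auto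
  then show "pos_functional (\<lambda>s. exp (t * ((\<integral>v. exp (s \<bullet> v) \<partial>truncated k) - measure (truncated k) UNIV)))"
    by (simp add: exp_add[symmetric] algebra_simps)
next
  fix s :: "real^'n" assume s: "s \<in> neg_orthant"
  have eq: "(\<integral>v. exp (s \<bullet> v) \<partial>truncated k) - measure (truncated k) UNIV =
      (\<integral>v. indicator {v. 1 / real (Suc k) \<le> norm v} v * (exp (s \<bullet> v) - 1) \<partial>\<mu>)" for k
  proof -
    interpret finite_measure "truncated k" using orth_measureD[OF orth_measure_truncated] by simp
    have sp: "space (truncated k) = UNIV" by (simp add: truncated_def)
    have "(\<integral>v. exp (s \<bullet> v) \<partial>truncated k) - measure (truncated k) UNIV = (\<integral>v. exp (s \<bullet> v) - 1 \<partial>truncated k)"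
      using orth_measure_integrable_exp[OF orth_measure_truncated s, of k] by (simp add: sp)
    also have "\<dots> = (\<integral>v. exp (s \<bullet> v) - 1 \<partial>density \<mu> (\<lambda>v. ennreal (indicator {v. 1 / real (Suc k) \<le> norm v} v)))"
      by (simp add: truncated_def ennreal_indicator)
    also have "\<dots> = (\<integral>v. indicator {v. 1 / real (Suc k) \<le> norm v} v *\<^sub>R (exp (s \<bullet> v) - 1) \<partial>\<mu>)"
      by (rule integral_density) auto
    finally show ?thesis by simp
  qed
  have "(\<lambda>k. \<integral>v. indicator {v. 1 / real (Suc k) \<le> norm v} v * (exp (s \<bullet> v) - 1) \<partial>\<mu>) \<longlonglongrightarrow> (\<integral>v. exp (s \<bullet> v) - 1 \<partial>\<mu>)"
  proof (rule integral_dominated_convergence[where w="\<lambda>v. norm (exp (s \<bullet> v) - 1)"])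
    show "AE v in \<mu>. (\<lambda>k. indicator {v. 1 / real (Suc k) \<le> norm v} v * (exp (s \<bullet> v) - 1)) \<longlonglongrightarrow> exp (s \<bullet> v) - 1"
    proof (rule AE_I2)
      fix v :: "real^'n"
      show "(\<lambda>k. indicator {v. 1 / real (Suc k) \<le> norm v} v * (exp (s \<bullet> v) - 1)) \<longlonglongrightarrow> exp (s \<bullet> v) - 1"
      proof (cases "v = 0")
        case False
        then obtain k0 where k0: "inverse (real (Suc k0)) < norm v" using reals_Archimedean[of "norm v"] by auto
        have "1 / real (Suc k) \<le> norm v" if "k \<ge> k0" for k
        proof -
          have "inverse (real (Suc k)) \<le> inverse (real (Suc k0))" using that by (intro le_imp_inverse_le) auto
          then show ?thesis using k0 unfolding inverse_eq_divide by linarith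
        qed
        then have "eventually (\<lambda>k. indicator {v. 1 / real (Suc k) \<le> norm v} v * (exp (s \<bullet> v) - 1) = exp (s \<bullet> v) - 1) sequentially"
          unfolding eventually_sequentially by (intro exI[of _ k0]) auto
        then show ?thesis by (rule tendsto_eventually)
      qed auto
    qed
  qed (use psi_rep(1)[OF s] in \<open>auto simp: indicator_def abs_mult\<close>)
  then show "(\<lambda>k. exp (t * ((\<integral>v. exp (s \<bullet> v) \<partial>truncated k) - measure (truncated k) UNIV))) \<longlonglongrightarrow> exp (t * \<psi> s)"
    unfolding eq psi_rep(2)[OF s] by (intro tendsto_intros)
qed

end

section \<open>Images of the positive and negative parts of a density\<close>

text \<open>The image of \<open>g\<^sup>+ dP\<close>; \<^const>\<open>ennreal\<close> truncates negative reals to \<open>0\<close>.\<close>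

definition weighted_image :: "'a measure \<Rightarrow> ('a \<Rightarrow> real) \<Rightarrow> ('a \<Rightarrow> real^'n) \<Rightarrow> (real^'n) measure" where
  "weighted_image P g \<phi> = distr (density P (\<lambda>x. ennreal (g x))) borel \<phi>"

lemma weighted_image_max: "weighted_image P g \<phi> = distr (density P (\<lambda>x. ennreal (max 0 (g x)))) borel \<phi>"
proof -
  have "ennreal (g x) = ennreal (max 0 (g x))" for x by (auto simp: max_def ennreal_neg)
  then show ?thesis by (simp add: weighted_image_def)
qed

lemma weighted_image:
  assumes g: "integrable P g" and phi [measurable]: "\<phi> \<in> borel_measurable P"
    and orth: "AE x in P. g x \<noteq> 0 \<longrightarrow> \<phi> x \<in> nonneg_orthant"
  shows "orth_measure (weighted_image P g \<phi>)"
    and "measure (weighted_image P g \<phi>) UNIV = (\<integral>x. max 0 (g x) \<partial>P)"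
    and "(\<integral>u. exp (s \<bullet> u) \<partial>weighted_image P g \<phi>) = (\<integral>x. max 0 (g x) * exp (s \<bullet> \<phi> x) \<partial>P)"
    and "s \<in> neg_orthant \<Longrightarrow> integrable P (\<lambda>x. max 0 (g x) * exp (s \<bullet> \<phi> x))"
proof -
  have [measurable]: "g \<in> borel_measurable P" using g by auto
  have em: "emeasure (weighted_image P g \<phi>) UNIV = ennreal (\<integral>x. max 0 (g x) \<partial>P)"
  proof -
    have "emeasure (weighted_image P g \<phi>) UNIV = (\<integral>\<^sup>+x. ennreal (max 0 (g x)) \<partial>P)"
      unfolding weighted_image_max by (subst emeasure_distr) (auto simp: emeasure_density intro!: nn_integral_cong)
    also have "\<dots> = ennreal (\<integral>x. max 0 (g x) \<partial>P)"
      using g by (intro nn_integral_eq_integral) auto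
    finally show ?thesis .
  qed
  then show "measure (weighted_image P g \<phi>) UNIV = (\<integral>x. max 0 (g x) \<partial>P)"
    by (simp add: measure_def)
  show "orth_measure (weighted_image P g \<phi>)"
  proof (rule orth_measureI)
    show "finite_measure (weighted_image P g \<phi>)"
      using em by (intro finite_measureI) (auto simp: weighted_image_def)
    show "AE u in weighted_image P g \<phi>. u \<in> nonneg_orthant"
      unfolding weighted_image_def using orth
      by (subst AE_distr_iff) (auto simp: AE_density elim!: eventually_mono)
  qed (simp add: weighted_image_def)
  have "(\<integral>u. exp (s \<bullet> u) \<partial>weighted_image P g \<phi>) = (\<integral>x. exp (s \<bullet> \<phi> x) \<partial>density P (\<lambda>x. ennreal (max 0 (g x))))"
    unfolding weighted_image_max by (rule integral_distr) auto
  also have "\<dots> = (\<integral>x. max 0 (g x) *\<^sub>R exp (s \<bullet> \<phi> x) \<partial>P)"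
    by (rule integral_density) auto
  finally show "(\<integral>u. exp (s \<bullet> u) \<partial>weighted_image P g \<phi>) = (\<integral>x. max 0 (g x) * exp (s \<bullet> \<phi> x) \<partial>P)"
    by simp
  assume s: "s \<in> neg_orthant"
  show "integrable P (\<lambda>x. max 0 (g x) * exp (s \<bullet> \<phi> x))"
  proof (rule Bochner_Integration.integrable_bound[OF g])
    show "AE x in P. norm (max 0 (g x) * exp (s \<bullet> \<phi> x)) \<le> norm (g x)"
      using orth
    proof eventually_elim
      case (elim x)
      show ?case
      proof (cases "g x = 0")
        case False
        then have "exp (s \<bullet> \<phi> x) \<le> 1" using elim neg_inner_nonpos[OF s] by auto
        then have "max 0 (g x) * exp (s \<bullet> \<phi> x) \<le> max 0 (g x) * 1" by (intro mult_left_mono) auto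
        then show ?thesis by (auto simp: abs_mult)
      qed auto
    qed
  qed auto
qed

text \<open>The two images may overlap after the push-forward, so this is no Jordan decomposition;
  yet their masses add up to the integral of \<open>\<bar>g\<bar>\<close>, and the difference of
  their transforms is the transform of the signed image.\<close>

lemma weighted_image_diff:
  assumes g: "integrable P g" and phi [measurable]: "\<phi> \<in> borel_measurable P"
    and orth: "AE x in P. g x \<noteq> 0 \<longrightarrow> \<phi> x \<in> nonneg_orthant"
  shows "orth_measure (weighted_image P (\<lambda>x. - g x) \<phi>)"
    and "measure (weighted_image P g \<phi>) UNIV + measure (weighted_image P (\<lambda>x. - g x) \<phi>) UNIV = (\<integral>x. \<bar>g x\<bar> \<partial>P)"
    and "s \<in> neg_orthant \<Longrightarrow> integrable P (\<lambda>x. g x * exp (s \<bullet> \<phi> x))"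
    and "s \<in> neg_orthant \<Longrightarrow> (\<integral>u. exp (s \<bullet> u) \<partial>weighted_image P g \<phi>) -
      (\<integral>u. exp (s \<bullet> u) \<partial>weighted_image P (\<lambda>x. - g x) \<phi>) = (\<integral>x. g x * exp (s \<bullet> \<phi> x) \<partial>P)"
proof -
  have g': "integrable P (\<lambda>x. - g x)" "AE x in P. - g x \<noteq> 0 \<longrightarrow> \<phi> x \<in> nonneg_orthant"
    using g orth by auto
  note w = weighted_image[OF g phi orth] and w' = weighted_image[OF g'(1) phi g'(2)]
  show "orth_measure (weighted_image P (\<lambda>x. - g x) \<phi>)" by (rule w')
  have "(\<integral>x. \<bar>g x\<bar> \<partial>P) = (\<integral>x. max 0 (g x) + max 0 (- g x) \<partial>P)"
    by (intro Bochner_Integration.integral_cong) auto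
  also have "\<dots> = (\<integral>x. max 0 (g x) \<partial>P) + (\<integral>x. max 0 (- g x) \<partial>P)"
    by (rule Bochner_Integration.integral_add) (use g in auto)
  finally show "measure (weighted_image P g \<phi>) UNIV + measure (weighted_image P (\<lambda>x. - g x) \<phi>) UNIV = (\<integral>x. \<bar>g x\<bar> \<partial>P)"
    by (simp add: w w')
  assume s: "s \<in> neg_orthant"
  have eq: "(\<lambda>x. g x * exp (s \<bullet> \<phi> x)) = (\<lambda>x. max 0 (g x) * exp (s \<bullet> \<phi> x) - max 0 (- g x) * exp (s \<bullet> \<phi> x))"
    by (auto simp: fun_eq_iff max_def)
  show "integrable P (\<lambda>x. g x * exp (s \<bullet> \<phi> x))"
    unfolding eq using w(4)[OF s] w'(4)[OF s] by (rule Bochner_Integration.integrable_diff)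
  show "(\<integral>u. exp (s \<bullet> u) \<partial>weighted_image P g \<phi>) -
      (\<integral>u. exp (s \<bullet> u) \<partial>weighted_image P (\<lambda>x. - g x) \<phi>) = (\<integral>x. g x * exp (s \<bullet> \<phi> x) \<partial>P)"
    unfolding eq w(3) w'(3) using w(4)[OF s] w'(4)[OF s] by (rule Bochner_Integration.integral_diff[symmetric])
qed

lemma zero_extension_eq: "zero_extension f r = indicator nonneg_orthant r *\<^sub>R f r"
  by (simp add: zero_extension_def indicator_def)

text \<open>The given densities are complex-valued with real Laplace transform. The real part has
  the same transform at real arguments, and passing to it can only decrease the integrals in
  \<open>k_functional\<close>.\<close>

definition re_ext :: "(real^'n \<Rightarrow> complex) \<Rightarrow> real^'n \<Rightarrow> real" where
  "re_ext f r = Re (zero_extension f r)"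

lemma re_ext_outside: "r \<notin> nonneg_orthant \<Longrightarrow> re_ext f r = 0"
  by (simp add: re_ext_def zero_extension_def)

lemma integrable_re_ext:
  assumes "set_integrable lborel nonneg_orthant f"
  shows "integrable lborel (re_ext f)"
  using assms unfolding set_integrable_def re_ext_def zero_extension_eq[abs_def]
  by (rule integrable_Re)

lemma zero_extension_measurable:
  assumes "set_integrable lborel nonneg_orthant f"
  shows "zero_extension f \<in> borel_measurable borel"
  using assms borel_measurable_integrable
  unfolding set_integrable_def zero_extension_eq[abs_def] by force

lemma laplace_re_ext:
  assumes f: "set_integrable lborel nonneg_orthant f" and s: "s \<in> neg_orthant"
    and F: "complex_of_real F = laplace f (- s)"
  shows "(\<integral>u. re_ext f u * exp (s \<bullet> u) \<partial>lborel) = F"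
proof -
  have [measurable]: "zero_extension f \<in> borel_measurable borel" by (rule zero_extension_measurable[OF f])
  have "integrable lborel (zero_extension f)"
    using f unfolding set_integrable_def zero_extension_eq[abs_def] .
  then have int: "integrable lborel (\<lambda>u. exp (s \<bullet> u) *\<^sub>R zero_extension f u)"
  proof (rule Bochner_Integration.integrable_bound)
    show "AE u in lborel. norm (exp (s \<bullet> u) *\<^sub>R zero_extension f u) \<le> norm (zero_extension f u)"
      using neg_inner_nonpos[OF s] by (intro AE_I2) (auto simp: zero_extension_def mult_left_le_one_le)
  qed auto
  have "complex_of_real F = (\<integral>u. exp (s \<bullet> u) *\<^sub>R zero_extension f u \<partial>lborel)"
    unfolding F laplace_def set_lebesgue_integral_def zero_extension_eq
    by (intro Bochner_Integration.integral_cong) (auto simp: ac_simps)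
  then have "F = Re (\<integral>u. exp (s \<bullet> u) *\<^sub>R zero_extension f u \<partial>lborel)"
    by (metis Re_complex_of_real)
  also have "\<dots> = (\<integral>u. re_ext f u * exp (s \<bullet> u) \<partial>lborel)"
    by (subst integral_Re[OF int, symmetric]) (simp add: re_ext_def mult.commute)
  finally show ?thesis by simp
qed

lemma set_lint_orthant:
  fixes M :: "(real^'n) measure"
  assumes "measure_on_orthant M"
  shows "(LINT u:nonneg_orthant|M. exp (z \<bullet> u)) = (\<integral>u. exp (z \<bullet> u) \<partial>M)"
proof -
  have [measurable_cong]: "sets M = sets borel" using assms by (auto simp: measure_on_orthant_def)
  show ?thesis
    unfolding set_lebesgue_integral_def
    by (intro integral_cong_AE) (use AE_on_orthant[OF assms] in \<open>auto elim!: eventually_mono\<close>)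
qed

section \<open>Positivity of the densities and identification of \<open>nu\<close>\<close>

context levy_rep
begin

text \<open>Let M and N be the measures whose densities are the positive and the negative part.
  Their transforms differ by the positive functional exp(t \<psi>), so N is dominated by M. On the
  set where the density is negative M vanishes, hence so does N.\<close>

lemma re_ext_nonneg:
  assumes f: "set_integrable lborel nonneg_orthant f" and t: "0 \<le> t"
    and lap: "\<And>s. s \<in> neg_orthant \<Longrightarrow> complex_of_real (exp (t * \<psi> s)) = laplace f (- s)"
  shows "AE u in lborel. 0 \<le> re_ext f u"
proof -
  let ?h = "re_ext f"
  let ?M = "weighted_image lborel ?h (\<lambda>u. u)" and ?N = "weighted_image lborel (\<lambda>u. - ?h u) (\<lambda>u. u)"
  note int = integrable_re_ext[OF f]
  then have [measurable]: "?h \<in> borel_measurable borel" by auto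
  have orth: "AE x in lborel. ?h x \<noteq> 0 \<longrightarrow> x \<in> nonneg_orthant" using re_ext_outside by blast
  have id: "(\<lambda>u. u) \<in> borel_measurable lborel" by simp
  note w = weighted_image[OF int id orth] and w' = weighted_image_diff[OF int id orth]
  let ?B = "{u. ?h u < 0}"
  have "emeasure ?N ?B \<le> emeasure ?M ?B"
  proof (rule orth_measure_le[OF w(1) w'(1)])
    fix L :: "(real \<times> (real^'n)) list"
    assume L: "\<And>p. p \<in> set L \<Longrightarrow> snd p \<in> neg_orthant"
      "\<And>u. u \<in> nonneg_orthant \<Longrightarrow> 0 \<le> lin_ext (\<lambda>s. exp (s \<bullet> u)) L"
    have "lin_ext (\<lambda>s. \<integral>u. exp (s \<bullet> u) \<partial>?M) L =
        lin_ext (\<lambda>s. (\<integral>u. exp (s \<bullet> u) \<partial>?N) + exp (t * \<psi> s)) L"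
    proof (rule lin_ext_cong)
      fix p assume "p \<in> set L"
      then have "snd p \<in> neg_orthant" by (rule L)
      then show "(\<integral>u. exp (snd p \<bullet> u) \<partial>?M) = (\<integral>u. exp (snd p \<bullet> u) \<partial>?N) + exp (t * \<psi> (snd p))"
        using w'(4)[of "snd p"] laplace_re_ext[OF f _ lap] by simp
    qed
    also have "\<dots> = lin_ext (\<lambda>s. \<integral>u. exp (s \<bullet> u) \<partial>?N) L + lin_ext (\<lambda>s. exp (t * \<psi> s)) L"
      by (rule lin_ext_add)
    finally have eq: "lin_ext (\<lambda>s. \<integral>u. exp (s \<bullet> u) \<partial>?M) L =
        lin_ext (\<lambda>s. \<integral>u. exp (s \<bullet> u) \<partial>?N) L + lin_ext (\<lambda>s. exp (t * \<psi> s)) L" .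
    have "0 \<le> lin_ext (\<lambda>s. exp (t * \<psi> s)) L"
      using pos_functional_exp_psi[OF t] L unfolding pos_functional_def by blast
    then show "lin_ext (\<lambda>s. \<integral>u. exp (s \<bullet> u) \<partial>?N) L \<le> lin_ext (\<lambda>s. \<integral>u. exp (s \<bullet> u) \<partial>?M) L"
      unfolding eq by simp
  qed measurable
  also have "emeasure ?M ?B = (\<integral>\<^sup>+u. ennreal (?h u) * indicator ?B u \<partial>lborel)"
    unfolding weighted_image_def by (simp add: emeasure_distr emeasure_density)
  also have "\<dots> = (\<integral>\<^sup>+u. 0 \<partial>(lborel :: (real^'n) measure))"
    by (intro nn_integral_cong) (auto simp: indicator_def ennreal_neg)
  finally have "emeasure ?N ?B = 0" by simp
  also have "emeasure ?N ?B = (\<integral>\<^sup>+u. ennreal (- ?h u) * indicator ?B u \<partial>lborel)"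
    unfolding weighted_image_def by (simp add: emeasure_distr emeasure_density)
  finally have "AE u in lborel. ennreal (- ?h u) * indicator ?B u = 0"
    by (subst (asm) nn_integral_0_iff_AE) auto
  then show ?thesis
  proof eventually_elim
    case (elim u)
    then show ?case by (auto simp: indicator_def ennreal_eq_0_iff split: if_splits)
  qed
qed

text \<open>The condition c_0 = 0, read along the diagonal; it is what makes the total mass 1 in
  \<open>prob_spaceI_laplace\<close>.\<close>

lemma tendsto_psi_0: "(\<lambda>k. \<psi> (\<chi> i. - (1 / real (Suc k)))) \<longlonglongrightarrow> 0"
proof -
  have l: "(\<lambda>k. 1 / real (Suc k)) \<longlonglongrightarrow> 0" by (rule LIMSEQ_Suc[OF lim_1_over_n])
  have lim: "(\<lambda>k. (\<chi> i. - (1 / real (Suc k))) :: real^'n) \<longlonglongrightarrow> (\<chi> i. 0)"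
    using tendsto_minus[OF l] by (intro tendsto_vec_lambda) simp
  have ne: "((\<chi> i. - (1 / real (Suc k))) :: real^'n) \<noteq> 0" for k
    by (simp add: vec_eq_iff)
  have "filterlim (\<lambda>k. (\<chi> i. - (1 / real (Suc k))) :: real^'n) (at 0 within neg_orthant) sequentially"
    unfolding filterlim_at using lim ne by (auto simp: neg_orthant_def zero_vec_def)
  moreover have "(\<psi> \<longlongrightarrow> 0) (at 0 within neg_orthant)" using rep by (simp add: represents_def)
  ultimately show ?thesis by (rule filterlim_compose[rotated])
qed

lemma prob_spaceI_laplace:
  fixes M :: "(real^'n) measure"
  assumes M: "orth_measure M" and lap: "\<And>s. s \<in> neg_orthant \<Longrightarrow> (\<integral>u. exp (s \<bullet> u) \<partial>M) = exp (t * \<psi> s)"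
  shows "prob_space M"
proof -
  interpret finite_measure M using orth_measureD[OF M] by simp
  have [measurable_cong, simp]: "sets M = sets borel" "space M = UNIV" using orth_measureD[OF M] by auto
  define s :: "nat \<Rightarrow> real^'n" where "s k = (\<chi> i. - (1 / real (Suc k)))" for k
  have s: "s k \<in> neg_orthant" for k by (simp add: s_def neg_orthant_def)
  have "(\<lambda>k. \<integral>u. exp (s k \<bullet> u) \<partial>M) \<longlonglongrightarrow> (\<integral>u. 1 \<partial>M)"
  proof (rule integral_dominated_convergence[where w="\<lambda>_. 1"])
    show "AE u in M. (\<lambda>k. exp (s k \<bullet> u)) \<longlonglongrightarrow> 1"
    proof (rule AE_I2)
      fix u :: "real^'n"
      have "(\<lambda>k. - (1 / real (Suc k)) * (\<Sum>i\<in>UNIV. u $ i)) \<longlonglongrightarrow> - 0 * (\<Sum>i\<in>UNIV. u $ i)"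
        by (intro tendsto_mult tendsto_minus LIMSEQ_Suc[OF lim_1_over_n] tendsto_const)
      moreover have "s k \<bullet> u = - (1 / real (Suc k)) * (\<Sum>i\<in>UNIV. u $ i)" for k
        by (simp add: s_def inner_vec_def sum_distrib_left)
      ultimately have "(\<lambda>k. s k \<bullet> u) \<longlonglongrightarrow> 0" by simp
      then show "(\<lambda>k. exp (s k \<bullet> u)) \<longlonglongrightarrow> 1" using tendsto_exp by fastforce
    qed
    show "AE u in M. norm (exp (s k \<bullet> u)) \<le> 1" for k
      using orth_measureD(4)[OF M] neg_inner_nonpos[OF s, of _ k] by (auto elim!: eventually_mono)
  qed auto
  moreover have "(\<lambda>k. \<integral>u. exp (s k \<bullet> u) \<partial>M) \<longlonglongrightarrow> exp (t * 0)"
    unfolding lap[OF s] using tendsto_psi_0 unfolding s_def by (intro tendsto_intros)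
  ultimately have "(\<integral>u. 1 \<partial>M) = exp (t * 0)" by (rule LIMSEQ_unique)
  then have "measure M UNIV = 1" by simp
  then show ?thesis by (intro prob_spaceI) (simp add: emeasure_eq_measure)
qed

text \<open>The way to handle the definite description: exhibit a measure with the right transform;
  uniqueness comes from \<open>orth_measure_eqI\<close>. The value at time 0, the densities and the
  convolution law all follow through it.\<close>

lemma nu_eqI:
  assumes M: "orth_measure M" and lap: "\<And>s. s \<in> neg_orthant \<Longrightarrow> (\<integral>u. exp (s \<bullet> u) \<partial>M) = exp (t * \<psi> s)"
  shows "nu \<psi> t = M"
  unfolding nu_def
proof (rule the_equality)
  have "measure_on_orthant M" using M by (simp add: orth_measure_def)
  then show "prob_space M \<and> measure_on_orthant M \<and>
    (\<forall>z\<in>neg_orthant. (LINT u:nonneg_orthant|M. exp (z \<bullet> u)) = exp (t * \<psi> z))"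
    using prob_spaceI_laplace[OF M lap] lap by (simp add: set_lint_orthant)
  fix N assume N: "prob_space N \<and> measure_on_orthant N \<and>
    (\<forall>z\<in>neg_orthant. (LINT u:nonneg_orthant|N. exp (z \<bullet> u)) = exp (t * \<psi> z))"
  then interpret prob_space N by simp
  have "orth_measure N" using N finite_measure_axioms by (simp add: orth_measure_def)
  then show "N = M" using N lap by (intro orth_measure_eqI M) (auto simp: set_lint_orthant)
qed

end

section \<open>The convolution semigroup, its time integrals and its increments\<close>

locale levy_density = levy_rep \<psi> \<mu>
  for \<psi> :: "real^'n \<Rightarrow> real" and \<mu> :: "(real^'n) measure" +
  fixes f :: "real \<Rightarrow> real^'n \<Rightarrow> complex"
  assumes int_f: "\<And>t. t > 0 \<Longrightarrow> set_integrable lborel nonneg_orthant (f t)"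
    and lap_f: "\<And>t s. t > 0 \<Longrightarrow> s \<in> neg_orthant \<Longrightarrow> complex_of_real (exp (t * \<psi> s)) = laplace (f t) (- s)"
begin

lemma nu_density:
  assumes t: "0 < t"
  shows "orth_measure (nu \<psi> t)"
    and "\<And>s. s \<in> neg_orthant \<Longrightarrow> (\<integral>u. exp (s \<bullet> u) \<partial>nu \<psi> t) = exp (t * \<psi> s)"
proof -
  let ?h = "re_ext (f t)"
  let ?M = "weighted_image lborel ?h (\<lambda>u. u)"
  note int = integrable_re_ext[OF int_f[OF t]]
  have [measurable]: "?h \<in> borel_measurable borel" using int by auto
  have orth: "AE x in lborel. ?h x \<noteq> 0 \<longrightarrow> x \<in> nonneg_orthant" using re_ext_outside by blast
  have id: "(\<lambda>u. u) \<in> borel_measurable lborel" by simp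
  note w = weighted_image[OF int id orth]
  have lap: "(\<integral>u. exp (s \<bullet> u) \<partial>?M) = exp (t * \<psi> s)" if s: "s \<in> neg_orthant" for s
  proof -
    have "(\<integral>u. exp (s \<bullet> u) \<partial>?M) = (\<integral>u. ?h u * exp (s \<bullet> u) \<partial>lborel)"
      unfolding w(3)
    proof (rule integral_cong_AE)
      show "AE x in lborel. max 0 (?h x) * exp (s \<bullet> x) = ?h x * exp (s \<bullet> x)"
        using re_ext_nonneg[OF int_f[OF t] _ lap_f[OF t]] t by (auto elim!: eventually_mono)
    qed auto
    also have "\<dots> = exp (t * \<psi> s)" by (rule laplace_re_ext[OF int_f[OF t] s lap_f[OF t s]])
    finally show ?thesis .
  qed
  have eq: "nu \<psi> t = ?M" by (rule nu_eqI[OF w(1) lap])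
  show "orth_measure (nu \<psi> t)" "\<And>s. s \<in> neg_orthant \<Longrightarrow> (\<integral>u. exp (s \<bullet> u) \<partial>nu \<psi> t) = exp (t * \<psi> s)"
    unfolding eq by (fact w(1), fact lap)
qed

lemma nu_0: "nu \<psi> 0 = return borel 0"
  by (rule nu_eqI) (simp_all add: orth_measure_return_0 laplace_return_0)

lemma nu:
  assumes t: "0 \<le> t"
  shows orth_measure_nu: "orth_measure (nu \<psi> t)"
    and laplace_nu: "s \<in> neg_orthant \<Longrightarrow> (\<integral>u. exp (s \<bullet> u) \<partial>nu \<psi> t) = exp (t * \<psi> s)"
    and prob_space_nu: "prob_space (nu \<psi> t)"
proof -
  have *: "orth_measure (nu \<psi> t) \<and> (\<forall>s\<in>neg_orthant. (\<integral>u. exp (s \<bullet> u) \<partial>nu \<psi> t) = exp (t * \<psi> s))"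
  proof (cases "t = 0")
    case True
    then show ?thesis by (simp add: orth_measure_return_0 laplace_return_0 nu_0)
  next
    case False
    then show ?thesis using nu_density t by auto
  qed
  then show "orth_measure (nu \<psi> t)"
    and "s \<in> neg_orthant \<Longrightarrow> (\<integral>u. exp (s \<bullet> u) \<partial>nu \<psi> t) = exp (t * \<psi> s)" by auto
  show "prob_space (nu \<psi> t)" using * by (intro prob_spaceI_laplace) auto
qed

lemma nu_add:
  assumes "0 \<le> s" "0 \<le> t"
  shows "nu \<psi> (s + t) = (nu \<psi> s \<star> nu \<psi> t)"
  using assms
  by (intro nu_eqI) (auto simp: orth_measure_conv nu distrib_right exp_add)

text \<open>Measurability in \<tau> need only be checked on boxes. These are compact, so the mass of
  a box is a pointwise limit of finite combinations of the continuous functions exp(\<tau>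
  \<psi>(s)). Clipping at 0 keeps the kernel away from negative times, where \<open>nu\<close> is
  not controlled.\<close>

lemma nu_kernel: "(\<lambda>\<tau>. nu \<psi> (max 0 \<tau>)) \<in> borel \<rightarrow>\<^sub>M subprob_algebra borel"
proof (rule measurable_subprob_algebra_generated)
  let ?G = "range (\<lambda>(a, b). {a..b} :: (real^'n) set)"
  show "sets borel = sigma_sets UNIV ?G" by (simp add: borel_eq_atLeastAtMost)
  show "Int_stable ?G"
  proof (rule Int_stableI)
    fix A B assume "A \<in> ?G" "B \<in> ?G"
    then obtain a b c d where "A = {a..b}" "B = {c..d}" by auto
    then have "A \<inter> B = {sup a c..inf b d}" by auto
    then show "A \<inter> B \<in> ?G" by auto
  qed
  show "subprob_space (nu \<psi> (max 0 a))" for a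
    by (intro prob_space_imp_subprob_space prob_space_nu) auto
  show "sets (nu \<psi> (max 0 a)) = sets borel" for a
    by (intro orth_measureD(2) orth_measure_nu) auto
  show "(\<lambda>a. emeasure (nu \<psi> (max 0 a)) D) \<in> borel_measurable borel" if "D \<in> ?G" for D
  proof -
    have "compact D" using that by (auto simp: cbox_interval[symmetric])
    then obtain L :: "nat \<Rightarrow> (real \<times> (real^'n)) list" where
      L: "\<And>k p. p \<in> set (L k) \<Longrightarrow> snd p \<in> neg_orthant"
        "\<And>K. orth_measure K \<Longrightarrow> (\<lambda>k. lin_ext (\<lambda>s. \<integral>u. exp (s \<bullet> u) \<partial>K) (L k)) \<longlonglongrightarrow> measure K D"
      using compact_measure_limit by metis
    have "(\<lambda>a. measure (nu \<psi> (max 0 a)) D) \<in> borel_measurable borel"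
    proof (rule borel_measurable_LIMSEQ_real)
      show "(\<lambda>k. lin_ext (\<lambda>s. exp (max 0 a * \<psi> s)) (L k)) \<longlonglongrightarrow> measure (nu \<psi> (max 0 a)) D" for a
      proof -
        have "lin_ext (\<lambda>s. exp (max 0 a * \<psi> s)) (L k) = lin_ext (\<lambda>s. \<integral>u. exp (s \<bullet> u) \<partial>nu \<psi> (max 0 a)) (L k)" for k
          by (rule lin_ext_cong) (use L(1) in \<open>auto simp: laplace_nu\<close>)
        then show ?thesis using L(2)[OF orth_measure_nu[of "max 0 a"]] by simp
      qed
    qed auto
    moreover have "emeasure (nu \<psi> (max 0 a)) D = ennreal (measure (nu \<psi> (max 0 a)) D)" for a
    proof -
      interpret prob_space "nu \<psi> (max 0 a)" by (rule prob_space_nu) auto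
      show ?thesis by (rule emeasure_eq_measure)
    qed
    ultimately show ?thesis by simp
  qed
  have "emeasure (nu \<psi> (max 0 a)) UNIV = 1" for a
  proof -
    interpret prob_space "nu \<psi> (max 0 a)" by (rule prob_space_nu) auto
    show ?thesis using emeasure_space_1 orth_measureD(3)[OF orth_measure_nu[of "max 0 a"]] by simp
  qed
  then show "(\<lambda>a. emeasure (nu \<psi> (max 0 a)) UNIV) \<in> borel_measurable borel" by simp
qed auto

definition nu_integral :: "real \<Rightarrow> (real^'n) measure" where
  "nu_integral h = density lborel (indicator {0..h}) \<bind> (\<lambda>\<tau>. nu \<psi> (max 0 \<tau>))"

lemma nn_integral_nu_integral:
  assumes "F \<in> borel_measurable borel"
  shows "(\<integral>\<^sup>+u. F u \<partial>nu_integral h) = (\<integral>\<^sup>+\<tau>. (\<integral>\<^sup>+u. F u \<partial>nu \<psi> (max 0 \<tau>)) * indicator {0..h} \<tau> \<partial>lborel)"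
proof -
  have m: "(\<lambda>\<tau>. nu \<psi> (max 0 \<tau>)) \<in> density lborel (indicator {0..h}) \<rightarrow>\<^sub>M subprob_algebra borel"
    using nu_kernel by simp
  have m': "(\<lambda>\<tau>. \<integral>\<^sup>+u. F u \<partial>nu \<psi> (max 0 \<tau>)) \<in> borel_measurable lborel"
    using measurable_compose[OF nu_kernel nn_integral_measurable_subprob_algebra[OF assms]] by simp
  show ?thesis
    unfolding nu_integral_def nn_integral_bind[OF assms m]
    by (subst nn_integral_density[OF _ m']) (auto simp: mult.commute)
qed

text \<open>The transform is the integral of exp(\<tau> \<psi>(s)) over [0,h]. It is evaluated after
  multiplication by \<open>\<psi> s\<close>, which avoids a division. The lower bound holds because
  the integrand decreases in \<tau>; it is the input for \<open>average_tendsto\<close>.\<close>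

lemma nu_integral:
  assumes h: "0 < h"
  shows orth_measure_nu_integral: "orth_measure (nu_integral h)"
    and measure_nu_integral: "measure (nu_integral h) UNIV = h"
    and laplace_nu_integral: "s \<in> neg_orthant \<Longrightarrow> \<psi> s * (\<integral>u. exp (s \<bullet> u) \<partial>nu_integral h) = exp (h * \<psi> s) - 1"
    and laplace_nu_integral_ge: "s \<in> neg_orthant \<Longrightarrow> h * exp (h * \<psi> s) \<le> (\<integral>u. exp (s \<bullet> u) \<partial>nu_integral h)"
proof -
  have sets: "sets (nu_integral h) = sets borel"
    unfolding nu_integral_def using orth_measureD(2)[OF orth_measure_nu] by (intro sets_bind) auto
  then have sp: "space (nu_integral h) = UNIV" by (metis sets_eq_imp_space_eq space_borel)
  have [measurable_cong]: "sets (nu_integral h) = sets borel" by (fact sets)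
  have em: "emeasure (nu_integral h) B = (\<integral>\<^sup>+\<tau>. emeasure (nu \<psi> (max 0 \<tau>)) B * indicator {0..h} \<tau> \<partial>lborel)"
    if "B \<in> sets borel" for B
    using nn_integral_nu_integral[of "indicator B" h] that sets orth_measureD(2)[OF orth_measure_nu]
    by simp
  have "emeasure (nu_integral h) UNIV = (\<integral>\<^sup>+\<tau>. indicator {0..h} \<tau> \<partial>lborel)"
  proof (subst em)
    show "(\<integral>\<^sup>+\<tau>. emeasure (nu \<psi> (max 0 \<tau>)) UNIV * indicator {0..h} \<tau> \<partial>lborel) = (\<integral>\<^sup>+\<tau>. indicator {0..h} \<tau> \<partial>lborel)"
    proof (rule nn_integral_cong)
      fix \<tau> :: real
      interpret prob_space "nu \<psi> (max 0 \<tau>)" by (rule prob_space_nu) auto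
      show "emeasure (nu \<psi> (max 0 \<tau>)) UNIV * indicator {0..h} \<tau> = indicator {0..h} \<tau>"
        using emeasure_space_1 orth_measureD(3)[OF orth_measure_nu[of "max 0 \<tau>"]] by simp
    qed
  qed auto
  also have "\<dots> = ennreal h" using h by simp
  finally have em1: "emeasure (nu_integral h) UNIV = ennreal h" .
  then show "measure (nu_integral h) UNIV = h" using h by (simp add: measure_def)
  have "emeasure (nu_integral h) (- nonneg_orthant) = (\<integral>\<^sup>+\<tau>. 0 \<partial>(lborel :: real measure))"
    by (subst em) (use orth_measure_nu in \<open>auto simp: orth_measure_def measure_on_orthant_def intro!: nn_integral_cong\<close>)
  then show N: "orth_measure (nu_integral h)"
    using em1 sets sp by (auto simp: orth_measure_def measure_on_orthant_def intro!: finite_measureI)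
  assume s: "s \<in> neg_orthant"
  have L: "ennreal (\<integral>u. exp (s \<bullet> u) \<partial>nu_integral h) = (\<integral>\<^sup>+\<tau>. ennreal (exp (\<tau> * \<psi> s)) * indicator {0..h} \<tau> \<partial>lborel)"
  proof -
    have "(\<integral>\<^sup>+\<tau>. (\<integral>\<^sup>+u. ennreal (exp (s \<bullet> u)) \<partial>nu \<psi> (max 0 \<tau>)) * indicator {0..h} \<tau> \<partial>lborel) =
        (\<integral>\<^sup>+\<tau>. ennreal (exp (\<tau> * \<psi> s)) * indicator {0..h} \<tau> \<partial>lborel)"
      using s by (intro nn_integral_cong)
        (auto simp: orth_measure_nn_exp orth_measure_nu laplace_nu max_def indicator_def)
    then show ?thesis
      using nn_integral_nu_integral[of "\<lambda>u. ennreal (exp (s \<bullet> u))" h] orth_measure_nn_exp[OF N s] by simp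
  qed
  have neg: "\<psi> s \<le> 0" by (rule psi_nonpos[OF s])
  \<comment> \<open>With the nonnegative factor \<open>- \<psi> s\<close> the fundamental theorem of
    calculus applies in the extended nonnegative reals, where negative values would be cut to 0;
    \<open>p1\<close> and \<open>p2\<close> bring the equation back to the reals.\<close>
  have p1: "0 \<le> - \<psi> s * (\<integral>u. exp (s \<bullet> u) \<partial>nu_integral h)"
    using neg by (intro mult_nonneg_nonneg) auto
  have p2: "0 \<le> - exp (h * \<psi> s) - (- exp (0 * \<psi> s))"
    using neg h by (simp add: mult_nonneg_nonpos)
  have "ennreal (- \<psi> s * (\<integral>u. exp (s \<bullet> u) \<partial>nu_integral h)) =
      (\<integral>\<^sup>+\<tau>. ennreal (- \<psi> s) * (ennreal (exp (\<tau> * \<psi> s)) * indicator {0..h} \<tau>) \<partial>lborel)"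
    using neg by (subst nn_integral_cmult) (auto simp: L[symmetric] ennreal_mult[symmetric])
  also have "\<dots> = (\<integral>\<^sup>+\<tau>. ennreal (- \<psi> s * exp (\<tau> * \<psi> s)) * indicator {0..h} \<tau> \<partial>lborel)"
    using neg by (intro nn_integral_cong) (auto simp: ennreal_mult[symmetric] indicator_def)
  also have "\<dots> = ennreal (- exp (h * \<psi> s) - (- exp (0 * \<psi> s)))"
    by (rule nn_integral_FTC_Icc) (use neg h in \<open>auto intro!: derivative_eq_intros mult_nonpos_nonneg\<close>)
  finally have "- \<psi> s * (\<integral>u. exp (s \<bullet> u) \<partial>nu_integral h) = - exp (h * \<psi> s) - (- exp (0 * \<psi> s))"
    by (subst (asm) ennreal_inj[OF p1 p2])
  then show "\<psi> s * (\<integral>u. exp (s \<bullet> u) \<partial>nu_integral h) = exp (h * \<psi> s) - 1" by simp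
  have "ennreal (h * exp (h * \<psi> s)) = (\<integral>\<^sup>+\<tau>. ennreal (exp (h * \<psi> s)) * indicator {0..h} \<tau> \<partial>lborel)"
    using h by (subst nn_integral_cmult_indicator) (auto simp: ennreal_mult mult.commute)
  also have "\<dots> \<le> ennreal (\<integral>u. exp (s \<bullet> u) \<partial>nu_integral h)"
    unfolding L using neg
    by (intro nn_integral_mono) (auto simp: indicator_def intro!: ennreal_leI mult_right_mono_neg)
  finally show "h * exp (h * \<psi> s) \<le> (\<integral>u. exp (s \<bullet> u) \<partial>nu_integral h)"
    by (subst (asm) ennreal_le_iff) auto
qed

definition increment :: "real \<Rightarrow> (real^'n) \<times> (real^'n) \<Rightarrow> real" where
  "increment t = (\<lambda>(u, r). re_ext (f t) (r - u) - re_ext (f t) r)"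

text \<open>Finiteness of k makes the increment jointly integrable, so Fubini allows integrating
  over \<open>r\<close> first. Translation by \<open>u\<close> multiplies a transform by
  \<open>exp (s \<bullet> u)\<close>, which leaves \<open>exp (s \<bullet> u) - 1\<close> to be
  integrated against \<mu>; that integral is \<open>\<psi> s\<close>.\<close>

lemma increment:
  assumes t: "0 < t" and k: "k_functional (f t) \<mu> < \<infinity>"
  shows integrable_increment: "integrable (\<mu> \<Otimes>\<^sub>M lborel) (increment t)"
    and integral_increment_le: "ennreal (\<integral>x. \<bar>increment t x\<bar> \<partial>(\<mu> \<Otimes>\<^sub>M lborel)) \<le> k_functional (f t) \<mu>"
    and increment_orthant: "AE x in \<mu> \<Otimes>\<^sub>M lborel. increment t x \<noteq> 0 \<longrightarrow> snd x \<in> nonneg_orthant"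
    and laplace_increment: "s \<in> neg_orthant \<Longrightarrow>
      (\<integral>x. increment t x * exp (s \<bullet> snd x) \<partial>(\<mu> \<Otimes>\<^sub>M lborel)) = \<psi> s * exp (t * \<psi> s)"
proof -
  interpret mu: sigma_finite_measure \<mu> by (rule sigma_finite_mu)
  interpret pair_sigma_finite \<mu> lborel ..
  let ?h = "re_ext (f t)"
  note int = integrable_re_ext[OF int_f[OF t]]
  have [measurable]: "?h \<in> borel_measurable borel" using int by auto
  have [measurable]: "zero_extension (f t) \<in> borel_measurable borel"
    by (rule zero_extension_measurable[OF int_f[OF t]])
  have [measurable]: "increment t \<in> borel_measurable (\<mu> \<Otimes>\<^sub>M lborel)" unfolding increment_def by measurable
  \<comment> \<open>Subtracting a vector of the orthant cannot lead back into the orthant, so both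
    terms of the increment vanish.\<close>
  have out: "increment t (u, r) = 0" if u: "u \<in> nonneg_orthant" and r: "r \<notin> nonneg_orthant" for u r
  proof -
    obtain i where i: "r $ i < 0" using r by (auto simp: nonneg_orthant_def not_le)
    moreover have "0 \<le> u $ i" using u by (simp add: nonneg_orthant_def)
    ultimately have "(r - u) $ i < 0" by simp
    then have "r - u \<notin> nonneg_orthant" unfolding nonneg_orthant_def mem_Collect_eq by (metis not_le)
    then show ?thesis using r by (simp add: increment_def re_ext_outside)
  qed
  have "(\<integral>\<^sup>+x. ennreal (norm (increment t x)) \<partial>(\<mu> \<Otimes>\<^sub>M lborel)) = (\<integral>\<^sup>+u. \<integral>\<^sup>+r. ennreal (norm (increment t (u, r))) \<partial>lborel \<partial>\<mu>)"
    by (rule lborel.nn_integral_fst[symmetric]) measurable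
  \<comment> \<open>By \<open>out\<close>, restricting \<open>r\<close> to the orthant loses
    nothing; real parts are bounded by moduli.\<close>
  also have "\<dots> \<le> k_functional (f t) \<mu>"
    unfolding k_functional_def
  proof (rule nn_integral_mono_AE)
    show "AE u in \<mu>. (\<integral>\<^sup>+r. ennreal (norm (increment t (u, r))) \<partial>lborel)
      \<le> (\<integral>\<^sup>+r\<in>nonneg_orthant. ennreal (cmod (zero_extension (f t) (r - u) - zero_extension (f t) r)) \<partial>lborel) * indicator nonneg_orthant u"
      using AE_mu
    proof eventually_elim
      case (elim u)
      have "norm (increment t (u, r)) \<le> cmod (zero_extension (f t) (r - u) - zero_extension (f t) r)" for r
        unfolding increment_def re_ext_def using abs_Re_le_cmod[of "zero_extension (f t) (r - u) - zero_extension (f t) r"] by simp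
      then show ?case
        using elim out[OF elim] by (auto intro!: nn_integral_mono ennreal_leI simp: indicator_def)
    qed
  qed
  finally have le: "(\<integral>\<^sup>+x. ennreal (norm (increment t x)) \<partial>(\<mu> \<Otimes>\<^sub>M lborel)) \<le> k_functional (f t) \<mu>" .
  then show I: "integrable (\<mu> \<Otimes>\<^sub>M lborel) (increment t)"
    using k by (intro integrableI_bounded) auto
  show "ennreal (\<integral>x. \<bar>increment t x\<bar> \<partial>(\<mu> \<Otimes>\<^sub>M lborel)) \<le> k_functional (f t) \<mu>"
    using le I by (subst nn_integral_eq_integral[symmetric]) auto
  show O: "AE x in \<mu> \<Otimes>\<^sub>M lborel. increment t x \<noteq> 0 \<longrightarrow> snd x \<in> nonneg_orthant"
  proof -
    have "AE x in \<mu> \<Otimes>\<^sub>M lborel. fst x \<in> nonneg_orthant"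
    proof -
      have "{x \<in> space (\<mu> \<Otimes>\<^sub>M lborel). fst x \<in> nonneg_orthant} \<in> sets (\<mu> \<Otimes>\<^sub>M lborel)" by measurable
      then show ?thesis using AE_mu by (intro AE_pair_measure) auto
    qed
    then show ?thesis
    proof eventually_elim
      case (elim x)
      then show ?case using out[of "fst x" "snd x"] by auto
    qed
  qed
  assume s: "s \<in> neg_orthant"
  have id: "(\<lambda>u. u) \<in> borel_measurable lborel" by simp
  have orth: "AE x in lborel. ?h x \<noteq> 0 \<longrightarrow> x \<in> nonneg_orthant" using re_ext_outside by blast
  note ih = weighted_image_diff(3)[OF int id orth s]
  have lap: "(\<integral>r. ?h r * exp (s \<bullet> r) \<partial>lborel) = exp (t * \<psi> s)"
    by (rule laplace_re_ext[OF int_f[OF t] s lap_f[OF t s]])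
  have inner: "(\<integral>r. increment t (u, r) * exp (s \<bullet> r) \<partial>lborel) = (exp (s \<bullet> u) - 1) * exp (t * \<psi> s)" for u
  proof -
    \<comment> \<open>Lebesgue measure is invariant under translation by \<open>- u\<close>.\<close>
    have "integrable (distr lborel borel ((+) (- u))) (\<lambda>r. ?h r * exp (s \<bullet> r))"
      using ih by (simp add: lborel_distr_plus)
    then have "integrable lborel (\<lambda>r. ?h (- u + r) * exp (s \<bullet> (- u + r)))"
      by (subst (asm) integrable_distr_eq) auto
    from integrable_mult_right[OF this, of "exp (s \<bullet> u)"]
    have sh: "integrable lborel (\<lambda>r. ?h (r - u) * exp (s \<bullet> r))"
      by (simp add: inner_add_right inner_diff_right exp_add exp_diff exp_minus field_simps)
    have "(\<integral>r. ?h r * exp (s \<bullet> r) \<partial>lborel) = (\<integral>r. ?h r * exp (s \<bullet> r) \<partial>distr lborel borel ((+) (- u)))"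
      by (simp add: lborel_distr_plus)
    also have "\<dots> = (\<integral>r. ?h (- u + r) * exp (s \<bullet> (- u + r)) \<partial>lborel)"
      by (rule integral_distr) auto
    also have "\<dots> = (\<integral>r. exp (- (s \<bullet> u)) * (?h (r - u) * exp (s \<bullet> r)) \<partial>lborel)"
      by (simp add: inner_add_right inner_diff_right exp_add exp_diff exp_minus field_simps)
    also have "\<dots> = exp (- (s \<bullet> u)) * (\<integral>r. ?h (r - u) * exp (s \<bullet> r) \<partial>lborel)"
      by simp
    finally have shi: "(\<integral>r. ?h (r - u) * exp (s \<bullet> r) \<partial>lborel) = exp (s \<bullet> u) * exp (t * \<psi> s)"
      by (simp add: lap exp_minus field_simps)
    have "(\<integral>r. increment t (u, r) * exp (s \<bullet> r) \<partial>lborel) = (\<integral>r. ?h (r - u) * exp (s \<bullet> r) - ?h r * exp (s \<bullet> r) \<partial>lborel)"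
      by (simp add: increment_def left_diff_distrib)
    also have "\<dots> = exp (s \<bullet> u) * exp (t * \<psi> s) - exp (t * \<psi> s)"
      by (subst Bochner_Integration.integral_diff[OF sh ih]) (simp add: shi lap)
    finally show ?thesis by (simp add: algebra_simps)
  qed
  have "snd \<in> borel_measurable (\<mu> \<Otimes>\<^sub>M lborel)" by measurable
  from weighted_image_diff(3)[OF I this O s]
  have "integrable (\<mu> \<Otimes>\<^sub>M lborel) (\<lambda>x. increment t x * exp (s \<bullet> snd x))" .
  from integral_fst'[OF this]
  have "(\<integral>x. increment t x * exp (s \<bullet> snd x) \<partial>(\<mu> \<Otimes>\<^sub>M lborel)) = (\<integral>u. \<integral>r. increment t (u, r) * exp (s \<bullet> r) \<partial>lborel \<partial>\<mu>)"
    by simp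
  also have "\<dots> = (\<integral>u. (exp (s \<bullet> u) - 1) * exp (t * \<psi> s) \<partial>\<mu>)" by (simp add: inner)
  also have "\<dots> = \<psi> s * exp (t * \<psi> s)" by (simp add: psi_rep(2)[OF s])
  finally show "(\<integral>x. increment t x * exp (s \<bullet> snd x) \<partial>(\<mu> \<Otimes>\<^sub>M lborel)) = \<psi> s * exp (t * \<psi> s)" .
qed

text \<open>The formal difference of \<open>inc_pos t\<close> and \<open>inc_neg t\<close> has
  transform \<psi> exp(t \<psi>), the symbol of \<psi>(A) g_t(A).\<close>

definition inc_pos :: "real \<Rightarrow> (real^'n) measure" where
  "inc_pos t = weighted_image (\<mu> \<Otimes>\<^sub>M lborel) (increment t) snd"

definition inc_neg :: "real \<Rightarrow> (real^'n) measure" where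
  "inc_neg t = weighted_image (\<mu> \<Otimes>\<^sub>M lborel) (\<lambda>x. - increment t x) snd"

lemma
  assumes t: "0 < t" and k: "k_functional (f t) \<mu> < \<infinity>"
  shows orth_measure_inc_pos: "orth_measure (inc_pos t)"
    and orth_measure_inc_neg: "orth_measure (inc_neg t)"
    and measure_inc: "ennreal (measure (inc_pos t) UNIV + measure (inc_neg t) UNIV) \<le> k_functional (f t) \<mu>"
    and laplace_inc: "s \<in> neg_orthant \<Longrightarrow>
      (\<integral>u. exp (s \<bullet> u) \<partial>inc_pos t) - (\<integral>u. exp (s \<bullet> u) \<partial>inc_neg t) = \<psi> s * exp (t * \<psi> s)"
proof -
  have m: "snd \<in> borel_measurable (\<mu> \<Otimes>\<^sub>M lborel)" by measurable
  note I = increment[OF t k]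
  note w = weighted_image[OF I(1) m I(3)] and w' = weighted_image_diff[OF I(1) m I(3)]
  show "orth_measure (inc_pos t)" "orth_measure (inc_neg t)"
    unfolding inc_pos_def inc_neg_def by (fact w(1), fact w'(1))
  show "ennreal (measure (inc_pos t) UNIV + measure (inc_neg t) UNIV) \<le> k_functional (f t) \<mu>"
    unfolding inc_pos_def inc_neg_def w'(2) by (fact I(2))
  show "s \<in> neg_orthant \<Longrightarrow>
      (\<integral>u. exp (s \<bullet> u) \<partial>inc_pos t) - (\<integral>u. exp (s \<bullet> u) \<partial>inc_neg t) = \<psi> s * exp (t * \<psi> s)"
    unfolding inc_pos_def inc_neg_def by (simp add: w'(4) I(4))
qed

text \<open>The operator identity \<open>g\<^sub>t\<^sub>+\<^sub>h - g\<^sub>t = (\<integral>\<^sub>0\<^sup>h g\<^sub>\<tau> d\<tau>) \<psi>(A) g\<^sub>t\<close> on the level of measures.\<close>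

lemma nu_increment:
  assumes t: "0 < t" and h: "0 < h" and k: "k_functional (f t) \<mu> < \<infinity>"
  shows "add_measure (nu \<psi> (h + t)) (nu_integral h \<star> inc_neg t) = add_measure (nu \<psi> t) (nu_integral h \<star> inc_pos t)"
proof -
  have o: "orth_measure (nu \<psi> (h + t))" "orth_measure (nu \<psi> t)" "orth_measure (nu_integral h)"
    "orth_measure (inc_pos t)" "orth_measure (inc_neg t)"
    using t h k by (auto intro!: orth_measure_nu orth_measure_nu_integral orth_measure_inc_pos orth_measure_inc_neg)
  note c = orth_measure_conv[OF o(3) o(4)] orth_measure_conv[OF o(3) o(5)]
  show ?thesis
  proof (rule orth_measure_eqI)
    fix s :: "real^'n" assume s: "s \<in> neg_orthant"
    let ?N = "\<integral>u. exp (s \<bullet> u) \<partial>nu_integral h"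
    have "?N * (\<integral>u. exp (s \<bullet> u) \<partial>inc_pos t) - ?N * (\<integral>u. exp (s \<bullet> u) \<partial>inc_neg t) = \<psi> s * ?N * exp (t * \<psi> s)"
      using laplace_inc[OF t k s] by (simp add: right_diff_distrib[symmetric])
    also have "\<dots> = exp ((h + t) * \<psi> s) - exp (t * \<psi> s)"
      unfolding laplace_nu_integral[OF h s] by (simp add: algebra_simps exp_add)
    finally show "(\<integral>u. exp (s \<bullet> u) \<partial>add_measure (nu \<psi> (h + t)) (nu_integral h \<star> inc_neg t)) =
        (\<integral>u. exp (s \<bullet> u) \<partial>add_measure (nu \<psi> t) (nu_integral h \<star> inc_pos t))"
      using s t h by (simp add: orth_measure_add o c laplace_nu)
  qed (intro orth_measure_add o c)+
qed

end

section \<open>Bochner integration in nonseparable spaces\<close>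

abbreviation sbi :: "'a measure \<Rightarrow> ('a \<Rightarrow> 'b::real_vector) \<Rightarrow> 'b" where
  "sbi \<equiv> Bochner_Integration.simple_bochner_integral"

text \<open>In a nonseparable space the difference of two Borel measurable functions need not be
  measurable. Here \<open>s\<close> has finitely many values, and for each value \<open>c\<close>
  the map \<open>norm (F x - c)\<close> is a continuous function of \<open>F x\<close>.\<close>

lemma norm_diff_simple_measurable:
  fixes F :: "'a \<Rightarrow> 'x::real_normed_vector"
  assumes F: "F \<in> borel_measurable M" and s: "simple_function M s"
  shows "(\<lambda>x. norm (F x - s x)) \<in> borel_measurable M"
proof (rule measurable_compose_countable'[where f="\<lambda>c x. norm (F x - c)" and g=s and I="s ` space M"])
  show "(\<lambda>x. norm (F x - c)) \<in> borel_measurable M" for c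
    by (rule measurable_compose[OF F borel_measurable_continuous_onI]) (intro continuous_intros)
  show "s \<in> measurable M (count_space (s ` space M))"
    using simple_functionD[OF s] by (subst measurable_count_space_eq2) auto
  show "countable (s ` space M)" using simple_functionD(1)[OF s] by (rule countable_finite)
qed

lemma simple_bochner_integrable_finite:
  assumes "finite_measure M" "simple_function M s"
  shows "Bochner_Integration.simple_bochner_integrable M s"
  using assms finite_measure.emeasure_finite[OF assms(1)]
  by (intro simple_bochner_integrable.intros) auto

lemma ennreal_norm_sbi_le:
  assumes "Bochner_Integration.simple_bochner_integrable M s"
  shows "ennreal (norm (sbi M s)) \<le> (\<integral>\<^sup>+x. norm (s x) \<partial>M)"
proof -
  have "Bochner_Integration.simple_bochner_integrable M (\<lambda>x. norm (s x))"
    using simple_bochner_integrable_compose2[of "\<lambda>x y. norm x" M s s] assms by simp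
  from simple_bochner_integral_eq_nn_integral[OF this]
  have "(\<integral>\<^sup>+x. norm (s x) \<partial>M) = ennreal (sbi M (\<lambda>x. norm (s x)))" by simp
  then show ?thesis using simple_bochner_integral_norm_bound[OF assms] by (simp add: ennreal_leI)
qed

lemma sbi_diff_le:
  fixes F :: "'a \<Rightarrow> 'x::real_normed_vector"
  assumes F: "F \<in> borel_measurable M"
    and s: "Bochner_Integration.simple_bochner_integrable M s"
    and t: "Bochner_Integration.simple_bochner_integrable M t"
  shows "ennreal (norm (sbi M s - sbi M t)) \<le> (\<integral>\<^sup>+x. norm (F x - s x) \<partial>M) + (\<integral>\<^sup>+x. norm (F x - t x) \<partial>M)"
proof -
  have [measurable]: "(\<lambda>x. norm (F x - s x)) \<in> borel_measurable M" "(\<lambda>x. norm (F x - t x)) \<in> borel_measurable M"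
    using s t by (auto intro: norm_diff_simple_measurable[OF F] elim: simple_bochner_integrable.cases)
  have "Bochner_Integration.simple_bochner_integrable M (\<lambda>x. s x - t x)"
    using simple_bochner_integrable_compose2[of "(-)" M s t] s t by simp
  from ennreal_norm_sbi_le[OF this]
  have "ennreal (norm (sbi M s - sbi M t)) \<le> (\<integral>\<^sup>+x. norm (s x - t x) \<partial>M)"
    using simple_bochner_integral_diff[OF s t] by simp
  also have "\<dots> \<le> (\<integral>\<^sup>+x. ennreal (norm (F x - s x)) + ennreal (norm (F x - t x)) \<partial>M)"
  proof (rule nn_integral_mono)
    fix x
    have "norm (s x - t x) \<le> norm (F x - s x) + norm (F x - t x)"
      using norm_triangle_ineq4[of "F x - t x" "F x - s x"] by simp
    then show "ennreal (norm (s x - t x)) \<le> ennreal (norm (F x - s x)) + ennreal (norm (F x - t x))"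
      by (simp add: ennreal_plus[symmetric] del: ennreal_plus)
  qed
  also have "\<dots> = (\<integral>\<^sup>+x. norm (F x - s x) \<partial>M) + (\<integral>\<^sup>+x. norm (F x - t x) \<partial>M)"
    by (rule nn_integral_add) measurable
  finally show ?thesis .
qed

text \<open>The definition provides some approximating sequence; this shows that every simple
  sequence approximating \<open>F\<close> in L1 computes the integral, so that convenient ones can
  be chosen.\<close>

lemma has_vector_bochner_integral_limit:
  assumes y: "has_vector_bochner_integral M F y"
    and t: "\<And>i. Bochner_Integration.simple_bochner_integrable M (t i)"
    and lim: "(\<lambda>i. \<integral>\<^sup>+u. ennreal (norm (F u - t i u)) \<partial>M) \<longlonglongrightarrow> 0"
  shows "(\<lambda>i. sbi M (t i)) \<longlonglongrightarrow> y"
proof -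
  obtain s where F: "F \<in> borel_measurable M" and s: "\<And>i. Bochner_Integration.simple_bochner_integrable M (s i)"
    "(\<lambda>i. \<integral>\<^sup>+u. ennreal (norm (F u - s i u)) \<partial>M) \<longlonglongrightarrow> 0" "(\<lambda>i. sbi M (s i)) \<longlonglongrightarrow> y"
    using y unfolding has_vector_bochner_integral_def by blast
  have "(\<lambda>i. ennreal (norm (sbi M (t i) - sbi M (s i)))) \<longlonglongrightarrow> 0"
  proof (rule tendsto_sandwich[OF _ _ tendsto_const])
    show "eventually (\<lambda>i. ennreal (norm (sbi M (t i) - sbi M (s i))) \<le>
      (\<integral>\<^sup>+u. norm (F u - t i u) \<partial>M) + (\<integral>\<^sup>+u. norm (F u - s i u) \<partial>M)) sequentially"
      using sbi_diff_le[OF F t s(1)] by (intro always_eventually allI)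
    show "(\<lambda>i. (\<integral>\<^sup>+u. norm (F u - t i u) \<partial>M) + (\<integral>\<^sup>+u. norm (F u - s i u) \<partial>M)) \<longlonglongrightarrow> 0"
      using tendsto_add[OF lim s(2)] by simp
  qed simp
  then have "(\<lambda>i. norm (sbi M (t i) - sbi M (s i))) \<longlonglongrightarrow> 0"
    by (simp add: ennreal_tendsto_0_iff)
  then have "(\<lambda>i. sbi M (t i) - sbi M (s i)) \<longlonglongrightarrow> 0" by (rule tendsto_norm_zero_cancel)
  from tendsto_add[OF this s(3)] show ?thesis by simp
qed

lemma vector_bochner_integral_eq:
  assumes "has_vector_bochner_integral M F y"
  shows "vector_bochner_integral M F = y"
  unfolding vector_bochner_integral_def
proof (rule the_equality[where P="has_vector_bochner_integral M F", OF assms])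
  fix z assume z: "has_vector_bochner_integral M F z"
  then obtain s where s: "\<And>i::nat. Bochner_Integration.simple_bochner_integrable M (s i)"
    "(\<lambda>i. \<integral>\<^sup>+u. ennreal (norm (F u - s i u)) \<partial>M) \<longlonglongrightarrow> 0" "(\<lambda>i. sbi M (s i)) \<longlonglongrightarrow> z"
    unfolding has_vector_bochner_integral_def by blast
  show "z = y" using has_vector_bochner_integral_limit[OF assms s(1,2)] s(3) LIMSEQ_unique by blast
qed

text \<open>Dominated convergence is applied only to the scalar functions
  \<open>norm (F u - s i u)\<close>, bounded by \<open>2 * C\<close>. Completeness of the space then
  provides the integral.\<close>

lemma bounded_simple_limit:
  fixes F :: "'a \<Rightarrow> 'x::banach"
  assumes M: "finite_measure M" and F: "F \<in> borel_measurable M"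
    and s: "\<And>i. simple_function M (s i)"
    and bound: "\<And>i x. x \<in> space M \<Longrightarrow> norm (s i x) \<le> C"
    and lim: "AE x in M. (\<lambda>i. s i x) \<longlonglongrightarrow> F x"
  shows "(\<lambda>i. \<integral>\<^sup>+u. ennreal (norm (F u - s i u)) \<partial>M) \<longlonglongrightarrow> 0"
    and "\<exists>y. has_vector_bochner_integral M F y"
proof -
  interpret finite_measure M by fact
  have "(\<lambda>i. \<integral>\<^sup>+u. ennreal (norm (F u - s i u)) \<partial>M) \<longlonglongrightarrow> (\<integral>\<^sup>+u. 0 \<partial>M)"
  proof (rule nn_integral_dominated_convergence[where w="\<lambda>_. ennreal (2 * C)"])
    show "(\<lambda>x. ennreal (norm (F x - s i x))) \<in> borel_measurable M" for i
      using norm_diff_simple_measurable[OF F s] by simp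
    show "(\<integral>\<^sup>+x. ennreal (2 * C) \<partial>M) < \<infinity>"
      using emeasure_finite by (simp add: ennreal_mult_eq_top_iff less_top[symmetric])
    show "AE x in M. ennreal (norm (F x - s i x)) \<le> ennreal (2 * C)" for i
      using lim AE_space
    proof eventually_elim
      case (elim x)
      have "norm (F x) \<le> C"
        by (rule LIMSEQ_le_const2[OF tendsto_norm[OF elim(1)]]) (use bound elim in auto)
      then show ?case
        using norm_triangle_ineq4[of "F x" "s i x"] bound[OF elim(2), of i] by (intro ennreal_leI) linarith
    qed
    show "AE x in M. (\<lambda>i. ennreal (norm (F x - s i x))) \<longlonglongrightarrow> 0"
      using lim
    proof eventually_elim
      case (elim x)
      have "(\<lambda>i. norm (F x - s i x)) \<longlonglongrightarrow> norm (F x - F x)" by (intro tendsto_intros elim)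
      then show ?case by (simp add: ennreal_tendsto_0_iff)
    qed
  qed auto
  then show lim0: "(\<lambda>i. \<integral>\<^sup>+u. ennreal (norm (F u - s i u)) \<partial>M) \<longlonglongrightarrow> 0" by simp
  have si: "Bochner_Integration.simple_bochner_integrable M (s i)" for i
    by (rule simple_bochner_integrable_finite[OF M s])
  have "Cauchy (\<lambda>i. sbi M (s i))"
  proof (rule metric_CauchyI)
    fix e :: real assume e: "0 < e"
    have "eventually (\<lambda>i. (\<integral>\<^sup>+u. norm (F u - s i u) \<partial>M) < ennreal (e / 2)) sequentially"
      by (rule order_tendstoD(2)[OF lim0]) (use e in simp)
    then obtain N where N: "\<And>i. i \<ge> N \<Longrightarrow> (\<integral>\<^sup>+u. norm (F u - s i u) \<partial>M) < ennreal (e / 2)"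
      unfolding eventually_sequentially by blast
    have "dist (sbi M (s i)) (sbi M (s j)) < e" if "i \<ge> N" "j \<ge> N" for i j
    proof -
      have "ennreal (norm (sbi M (s i) - sbi M (s j))) \<le> (\<integral>\<^sup>+u. norm (F u - s i u) \<partial>M) + (\<integral>\<^sup>+u. norm (F u - s j u) \<partial>M)"
        by (rule sbi_diff_le[OF F si si])
      also have "\<dots> < ennreal (e / 2) + ennreal (e / 2)"
        by (rule add_strict_mono[OF N[OF that(1)] N[OF that(2)]])
      also have "\<dots> = ennreal e" using e by (simp add: ennreal_plus[symmetric] del: ennreal_plus)
      finally show ?thesis using e by (simp add: dist_norm ennreal_less_iff)
    qed
    then show "\<exists>N. \<forall>i\<ge>N. \<forall>j\<ge>N. dist (sbi M (s i)) (sbi M (s j)) < e" by blast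
  qed
  then obtain y where "(\<lambda>i. sbi M (s i)) \<longlonglongrightarrow> y" using Cauchy_convergent convergent_def by blast
  then show "\<exists>y. has_vector_bochner_integral M F y"
    unfolding has_vector_bochner_integral_def using F si lim0 by blast
qed

lemma has_vector_bochner_integral_norm_bound:
  assumes y: "has_vector_bochner_integral M F y"
  shows "ennreal (norm y) \<le> (\<integral>\<^sup>+u. norm (F u) \<partial>M)"
proof -
  obtain s where F: "F \<in> borel_measurable M" and s: "\<And>i. Bochner_Integration.simple_bochner_integrable M (s i)"
    "(\<lambda>i. \<integral>\<^sup>+u. ennreal (norm (F u - s i u)) \<partial>M) \<longlonglongrightarrow> 0" "(\<lambda>i. sbi M (s i)) \<longlonglongrightarrow> y"
    using y unfolding has_vector_bochner_integral_def by blast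
  have [measurable]: "(\<lambda>x. norm (F x - s i x)) \<in> borel_measurable M" for i
    using s(1)[of i] by (auto intro: norm_diff_simple_measurable[OF F] elim: simple_bochner_integrable.cases)
  have [measurable]: "(\<lambda>x. norm (F x)) \<in> borel_measurable M"
    using norm_diff_simple_measurable[OF F, of "\<lambda>_. 0"] by simp
  have le: "ennreal (norm (sbi M (s i))) \<le> (\<integral>\<^sup>+u. norm (F u - s i u) \<partial>M) + (\<integral>\<^sup>+u. norm (F u) \<partial>M)" for i
  proof -
    have "ennreal (norm (sbi M (s i))) \<le> (\<integral>\<^sup>+u. norm (s i u) \<partial>M)" by (rule ennreal_norm_sbi_le[OF s(1)])
    also have "\<dots> \<le> (\<integral>\<^sup>+u. ennreal (norm (F u - s i u)) + ennreal (norm (F u)) \<partial>M)"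
    proof (rule nn_integral_mono)
      fix u
      have "norm (s i u) \<le> norm (F u - s i u) + norm (F u)"
        using norm_triangle_ineq4[of "F u" "F u - s i u"] by simp
      then show "ennreal (norm (s i u)) \<le> ennreal (norm (F u - s i u)) + ennreal (norm (F u))"
        by (simp add: ennreal_plus[symmetric] del: ennreal_plus)
    qed
    also have "\<dots> = (\<integral>\<^sup>+u. norm (F u - s i u) \<partial>M) + (\<integral>\<^sup>+u. norm (F u) \<partial>M)"
      by (rule nn_integral_add) measurable
    finally show ?thesis .
  qed
  have l1: "(\<lambda>i. ennreal (norm (sbi M (s i)))) \<longlonglongrightarrow> ennreal (norm y)"
    by (intro tendsto_ennrealI tendsto_norm s(3))
  have l2: "(\<lambda>i. (\<integral>\<^sup>+u. norm (F u - s i u) \<partial>M) + (\<integral>\<^sup>+u. norm (F u) \<partial>M)) \<longlonglongrightarrow> 0 + (\<integral>\<^sup>+u. norm (F u) \<partial>M)"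
    by (intro tendsto_add s(2) tendsto_const)
  show ?thesis using LIMSEQ_le[OF l1 l2] le by simp
qed

text \<open>Subtracting a constant is harmless for measurability, being composition with a
  continuous map, unlike subtracting a general function.\<close>

lemma has_vector_bochner_integral_diff_const:
  assumes M: "finite_measure M" and y: "has_vector_bochner_integral M F y"
  shows "has_vector_bochner_integral M (\<lambda>u. F u - z) (y - measure M (space M) *\<^sub>R z)"
proof -
  obtain s where F: "F \<in> borel_measurable M" and s: "\<And>i. Bochner_Integration.simple_bochner_integrable M (s i)"
    "(\<lambda>i. \<integral>\<^sup>+u. ennreal (norm (F u - s i u)) \<partial>M) \<longlonglongrightarrow> 0" "(\<lambda>i. sbi M (s i)) \<longlonglongrightarrow> y"
    using y unfolding has_vector_bochner_integral_def by blast
  have c: "Bochner_Integration.simple_bochner_integrable M (\<lambda>_. z)"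
    by (rule simple_bochner_integrable_finite[OF M]) simp
  have z: "sbi M (\<lambda>_. z) = measure M (space M) *\<^sub>R z"
    by (auto simp: simple_bochner_integral_def image_constant_conv)
  have "(\<lambda>u. F u - z) \<in> borel_measurable M"
    by (rule measurable_compose[OF F borel_measurable_continuous_onI]) (intro continuous_intros)
  moreover have "Bochner_Integration.simple_bochner_integrable M (\<lambda>u. s i u - z)" for i
    using simple_bochner_integrable_compose2[of "(-)" M "s i" "\<lambda>_. z"] s(1) c by simp
  moreover have "(\<lambda>i. sbi M (\<lambda>u. s i u - z)) \<longlonglongrightarrow> y - measure M (space M) *\<^sub>R z"
    using tendsto_diff[OF s(3) tendsto_const] by (simp add: simple_bochner_integral_diff[OF s(1) c] z)
  ultimately show ?thesis
    unfolding has_vector_bochner_integral_def using s(2)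
    by (intro conjI exI[of _ "\<lambda>i u. s i u - z"]) auto
qed

section \<open>A common rounding of the orthant by simple functions\<close>

definition orth_proj :: "real^'n \<Rightarrow> real^'n" where
  "orth_proj u = (\<chi> i. max 0 (u $ i))"

lemma orth_proj_in [simp]: "orth_proj u \<in> nonneg_orthant"
  by (simp add: orth_proj_def nonneg_orthant_def)

lemma orth_proj_id: "u \<in> nonneg_orthant \<Longrightarrow> orth_proj u = u"
  by (simp add: orth_proj_def nonneg_orthant_def vec_eq_iff)

lemma continuous_on_orth_proj: "continuous_on S (orth_proj :: real^'n \<Rightarrow> real^'n)"
  unfolding orth_proj_def by (intro continuous_intros)

text \<open>One sequence of simple functions serves all finite measures at once, so that identities between
  measures pass to the vector-valued integrals as identities between finite sums.\<close>

definition rnd :: "nat \<Rightarrow> real^'n \<Rightarrow> real^'n" where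
  "rnd = (SOME F. \<forall>i. simple_function borel (F i) \<and> (\<forall>u. F i u \<in> nonneg_orthant) \<and>
     (\<forall>u\<in>nonneg_orthant. (\<lambda>i. F i u) \<longlonglongrightarrow> u))"

lemma rnd:
  shows simple_function_rnd: "simple_function borel (rnd i :: real^'n \<Rightarrow> real^'n)"
    and rnd_in: "rnd i (u :: real^'n) \<in> nonneg_orthant"
    and rnd_tendsto: "(u :: real^'n) \<in> nonneg_orthant \<Longrightarrow> (\<lambda>i. rnd i u) \<longlonglongrightarrow> u"
proof -
  have "(\<lambda>u. u) \<in> borel_measurable (borel :: (real^'n) measure)" by simp
  from borel_measurable_implies_sequence_metric[OF this, of 0]
  obtain F :: "nat \<Rightarrow> real^'n \<Rightarrow> real^'n" where F: "\<And>i. simple_function borel (F i)" "\<And>u. (\<lambda>i. F i u) \<longlonglongrightarrow> u"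
    by auto
  \<comment> \<open>Projecting keeps the rounded points where the semigroup is controlled; the limit
    survives because the projection is continuous and fixes the orthant.\<close>
  have "\<forall>i. simple_function borel (\<lambda>u. orth_proj (F i u)) \<and> (\<forall>u. orth_proj (F i u) \<in> nonneg_orthant) \<and>
     (\<forall>u\<in>nonneg_orthant. (\<lambda>i. orth_proj (F i u)) \<longlonglongrightarrow> u)"
  proof (intro allI conjI ballI)
    show "simple_function borel (\<lambda>u. orth_proj (F i u))" for i
      by (rule simple_function_compose1[OF F(1)])
    show "(\<lambda>i. orth_proj (F i u)) \<longlonglongrightarrow> u" if "u \<in> nonneg_orthant" for u
      using continuous_on_tendsto_compose[OF continuous_on_orth_proj[of UNIV] F(2)[of u]] orth_proj_id[OF that] by simp
  qed auto
  then have "\<forall>i. simple_function borel (rnd i :: real^'n \<Rightarrow> real^'n) \<and> (\<forall>u::real^'n. rnd i u \<in> nonneg_orthant) \<and>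
     (\<forall>u::real^'n\<in>nonneg_orthant. (\<lambda>i. rnd i u) \<longlonglongrightarrow> u)"
    unfolding rnd_def by (rule someI[where P="\<lambda>F. \<forall>i. simple_function borel (F i) \<and> (\<forall>u. F i u \<in> nonneg_orthant) \<and>
     (\<forall>u\<in>nonneg_orthant. (\<lambda>i. F i u) \<longlonglongrightarrow> u)"])
  then show "simple_function borel (rnd i :: real^'n \<Rightarrow> real^'n)" "rnd i u \<in> nonneg_orthant"
    "u \<in> nonneg_orthant \<Longrightarrow> (\<lambda>i. rnd i u) \<longlonglongrightarrow> u" by blast+
qed

lemma finite_range_rnd: "finite (range (rnd i))"
  using simple_functionD(1)[OF simple_function_rnd] by simp

lemma simple_function_rnd_compose:
  "\<phi> \<in> borel_measurable M \<Longrightarrow> simple_function M (\<lambda>x. rnd i (\<phi> x))"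
  by (rule simple_function_comp[OF _ simple_function_rnd])

lemma rnd_vimage_sets [measurable]: "{u. rnd i u = p} \<in> sets borel"
  using simple_functionD(2)[OF simple_function_rnd, of i "{p}"] by (simp add: vimage_def)

lemma bounded_linear_scaleC: "bounded_linear (scaleC c :: 'x \<Rightarrow> 'x::complex_banach)"
proof (rule bounded_linear_intro[where K="cmod c"])
  fix r :: real and x :: 'x
  show "scaleC c (r *\<^sub>R x) = r *\<^sub>R scaleC c x"
    by (simp add: scaleC_of_real[symmetric] scaleC_scaleC mult.commute)
qed (auto simp: scaleC_add_right norm_scaleC mult.commute)

section \<open>Integrals of an n-parameter semigroup against finite measures\<close>

locale orthant_semigroup =
  fixes T :: "real^'n \<Rightarrow> 'x::complex_banach \<Rightarrow> 'x" and C :: real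
  assumes op: "u \<in> nonneg_orthant \<Longrightarrow> bounded_operator (T u)"
    and bound: "u \<in> nonneg_orthant \<Longrightarrow> norm (T u x) \<le> C * norm x"
    and C_nonneg: "0 \<le> C"
    and zero: "T 0 x = x"
    and add: "u \<in> nonneg_orthant \<Longrightarrow> v \<in> nonneg_orthant \<Longrightarrow> T (u + v) x = T u (T v x)"
    and cont: "continuous_on nonneg_orthant (\<lambda>u. T u x)"
begin

lemma linear_T: "u \<in> nonneg_orthant \<Longrightarrow> linear (T u)"
  and scaleC_T: "u \<in> nonneg_orthant \<Longrightarrow> T u (scaleC c x) = scaleC c (T u x)"
  using op by (auto simp: bounded_operator_def bounded_linear.linear)

lemma T_tendsto:
  assumes "u \<in> nonneg_orthant" "\<And>i. w i \<in> nonneg_orthant" "w \<longlonglongrightarrow> u"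
  shows "(\<lambda>i. T (w i) x) \<longlonglongrightarrow> T u x"
  using continuous_on_tendsto_compose[OF cont assms(3,1)] assms(2) by auto

definition V :: "(real^'n) measure \<Rightarrow> 'x \<Rightarrow> 'x" where
  "V M x = vector_bochner_integral M (\<lambda>u. indicator nonneg_orthant u *\<^sub>R T u x)"

text \<open>The rounded integral. It depends on \<open>M\<close> only through the masses of finitely
  many fixed sets, hence is additive in \<open>M\<close>.\<close>

definition Vn :: "nat \<Rightarrow> (real^'n) measure \<Rightarrow> 'x \<Rightarrow> 'x" where
  "Vn i M x = (\<Sum>p\<in>range (rnd i). measure M {u. rnd i u = p} *\<^sub>R T p x)"

lemma measurable_T: "(\<lambda>u. indicator nonneg_orthant u *\<^sub>R T u x) \<in> borel_measurable borel"
  by (intro borel_measurable_continuous_on_indicator cont) simp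

lemma sbi_rnd:
  fixes x :: 'x
  assumes M: "finite_measure M" and \<phi>: "\<phi> \<in> borel_measurable M"
  shows "sbi M (\<lambda>x'. T (rnd i (\<phi> x')) x) = Vn i (distr M borel \<phi>) x"
proof -
  interpret finite_measure M by fact
  have s: "simple_function M (\<lambda>x'. rnd i (\<phi> x'))" by (rule simple_function_rnd_compose[OF \<phi>])
  then have "Bochner_Integration.simple_bochner_integrable M (\<lambda>x'. T (rnd i (\<phi> x')) x)"
    by (intro simple_bochner_integrable_finite M simple_function_compose1[of _ _ "\<lambda>p. T p x"])
  then have "sbi M (\<lambda>x'. T (rnd i (\<phi> x')) x) =
      (\<Sum>p\<in>(\<lambda>x'. rnd i (\<phi> x')) ` space M. measure M {x'\<in>space M. rnd i (\<phi> x') = p} *\<^sub>R T p x)"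
    by (rule simple_bochner_integral_partition[OF _ s]) auto
  also have "\<dots> = (\<Sum>p\<in>range (rnd i). measure M {x'\<in>space M. rnd i (\<phi> x') = p} *\<^sub>R T p x)"
  proof (rule sum.mono_neutral_left)
    show "\<forall>p\<in>range (rnd i) - (\<lambda>x'. rnd i (\<phi> x')) ` space M. measure M {x'\<in>space M. rnd i (\<phi> x') = p} *\<^sub>R T p x = 0"
    proof
      fix p assume p: "p \<in> range (rnd i) - (\<lambda>x'. rnd i (\<phi> x')) ` space M"
      have "rnd i (\<phi> x') \<noteq> p" if "x' \<in> space M" for x' using p that by blast
      then have e: "{x'\<in>space M. rnd i (\<phi> x') = p} = {}" by auto
      show "measure M {x'\<in>space M. rnd i (\<phi> x') = p} *\<^sub>R T p x = 0" unfolding e by simp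
    qed
  qed (auto simp: finite_range_rnd)
  also have "\<dots> = Vn i (distr M borel \<phi>) x"
    unfolding Vn_def using \<phi>
    by (intro sum.cong refl arg_cong2[where f=scaleR])
      (auto simp: measure_distr vimage_def Int_def conj_commute)
  finally show ?thesis .
qed

lemma distr_id_orth: "orth_measure M \<Longrightarrow> distr M borel (\<lambda>u. u) = M"
  by (rule distr_id2) (simp add: orth_measureD(2))

text \<open>A change of variables: rounding after \<phi> turns the integral over \<open>M\<close>
  into a limit of \<open>Vn\<close> for the image measure. It is applied with \<phi> the identity,
  and with \<phi> the addition map on a product space.\<close>

lemma V_image:
  assumes M: "finite_measure M" and \<phi>: "\<phi> \<in> borel_measurable M" and orth: "AE x' in M. \<phi> x' \<in> nonneg_orthant"
  shows "has_vector_bochner_integral M (\<lambda>x'. indicator nonneg_orthant (\<phi> x') *\<^sub>R T (\<phi> x') x) y \<Longrightarrow>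
      (\<lambda>i. Vn i (distr M borel \<phi>) x) \<longlonglongrightarrow> y"
    and "\<exists>y. has_vector_bochner_integral M (\<lambda>x'. indicator nonneg_orthant (\<phi> x') *\<^sub>R T (\<phi> x') x) y"
proof -
  let ?F = "\<lambda>x'. indicator nonneg_orthant (\<phi> x') *\<^sub>R T (\<phi> x') x"
  let ?s = "\<lambda>i x'. T (rnd i (\<phi> x')) x"
  have F: "?F \<in> borel_measurable M" by (rule measurable_compose[OF \<phi> measurable_T])
  have s: "simple_function M (?s i)" for i
    by (rule simple_function_compose1[OF simple_function_rnd_compose[OF \<phi>], of "\<lambda>p. T p x"])
  have lim: "AE x' in M. (\<lambda>i. ?s i x') \<longlonglongrightarrow> ?F x'"
    using orth
  proof eventually_elim
    case (elim x')
    then show ?case using T_tendsto[OF elim rnd_in rnd_tendsto[OF elim]] by simp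
  qed
  note l = bounded_simple_limit[where C="C * norm x", OF M F s bound[OF rnd_in] lim]
  show "\<exists>y. has_vector_bochner_integral M ?F y" by (rule l)
  assume "has_vector_bochner_integral M ?F y"
  from has_vector_bochner_integral_limit[OF this simple_bochner_integrable_finite[OF M s] l(1)]
  show "(\<lambda>i. Vn i (distr M borel \<phi>) x) \<longlonglongrightarrow> y" by (simp add: sbi_rnd[OF M \<phi>])
qed

lemma has_vbi_V:
  assumes M: "orth_measure M"
  shows "has_vector_bochner_integral M (\<lambda>u. indicator nonneg_orthant u *\<^sub>R T u x) (V M x)"
proof -
  have "(\<lambda>u. u) \<in> borel_measurable M" using orth_measureD(2)[OF M] measurable_ident_sets by blast
  from V_image(2)[OF orth_measureD(1)[OF M] this orth_measureD(4)[OF M]]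
  obtain y where "has_vector_bochner_integral M (\<lambda>u. indicator nonneg_orthant u *\<^sub>R T u x) y" by blast
  then show ?thesis unfolding V_def using vector_bochner_integral_eq by metis
qed

lemma Vn_tendsto:
  assumes M: "orth_measure M"
  shows "(\<lambda>i. Vn i M x) \<longlonglongrightarrow> V M x"
proof -
  have "(\<lambda>u. u) \<in> borel_measurable M" using orth_measureD(2)[OF M] measurable_ident_sets by blast
  from V_image(1)[OF orth_measureD(1)[OF M] this orth_measureD(4)[OF M] has_vbi_V[OF M]]
  show ?thesis by (simp add: distr_id_orth[OF M])
qed

text \<open>The integral of \<open>T u z - z\<close> is split at radius \<delta>: inside, the
  assumed closeness to \<open>z\<close>; outside, the crude bound C norm(z) + norm(z).\<close>

lemma V_norm_diff:
  assumes M: "orth_measure M" and \<delta>: "0 < \<delta>" and e: "0 \<le> e"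
    and small: "\<And>u. u \<in> nonneg_orthant \<Longrightarrow> norm u < \<delta> \<Longrightarrow> norm (T u z - z) \<le> e"
  shows "norm (V M z - measure M UNIV *\<^sub>R z) \<le> e * measure M UNIV + (C + 1) * norm z * measure M {u. \<delta> \<le> norm u}"
proof -
  interpret finite_measure M using orth_measureD[OF M] by simp
  have [measurable_cong, simp]: "sets M = sets borel" "space M = UNIV" using orth_measureD[OF M] by auto
  have K: "0 \<le> (C + 1) * norm z" using C_nonneg by simp
  have "ennreal (norm (V M z - measure M UNIV *\<^sub>R z)) \<le> (\<integral>\<^sup>+u. norm (indicator nonneg_orthant u *\<^sub>R T u z - z) \<partial>M)"
    using has_vector_bochner_integral_norm_bound[OF has_vector_bochner_integral_diff_const[OF finite_measure_axioms has_vbi_V[OF M, of z], of z]]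
    by simp
  also have "\<dots> \<le> (\<integral>\<^sup>+u. ennreal e + ennreal ((C + 1) * norm z) * indicator {u. \<delta> \<le> norm u} u \<partial>M)"
  proof (rule nn_integral_mono_AE)
    show "AE u in M. ennreal (norm (indicator nonneg_orthant u *\<^sub>R T u z - z)) \<le>
        ennreal e + ennreal ((C + 1) * norm z) * indicator {u. \<delta> \<le> norm u} u"
      using orth_measureD(4)[OF M]
    proof eventually_elim
      case (elim u)
      show ?case
      proof (cases "\<delta> \<le> norm u")
        case True
        have "norm (T u z - z) \<le> (C + 1) * norm z"
          using norm_triangle_ineq4[of "T u z" z] bound[OF elim, of z] by (simp add: algebra_simps)
        then have "ennreal (norm (T u z - z)) \<le> ennreal ((C + 1) * norm z)" by (rule ennreal_leI)
        then show ?thesis using True elim by (simp add: add_increasing)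
      next
        case False
        then show ?thesis using small[OF elim] elim by (simp add: ennreal_leI)
      qed
    qed
  qed
  also have "\<dots> = ennreal e * emeasure M UNIV + ennreal ((C + 1) * norm z) * emeasure M {u. \<delta> \<le> norm u}"
    by (subst nn_integral_add) (auto simp: nn_integral_cmult_indicator)
  also have "\<dots> = ennreal (e * measure M UNIV + (C + 1) * norm z * measure M {u. \<delta> \<le> norm u})"
    using e K by (simp add: emeasure_eq_measure ennreal_mult)
  finally show ?thesis
    using e K by (subst (asm) ennreal_le_iff) auto
qed

lemma V_norm_le:
  assumes M: "orth_measure M"
  shows "norm (V M x) \<le> C * measure M UNIV * norm x"
proof -
  interpret finite_measure M using orth_measureD[OF M] by simp
  have [simp]: "space M = UNIV" using orth_measureD[OF M] by auto
  have "ennreal (norm (V M x)) \<le> (\<integral>\<^sup>+u. norm (indicator nonneg_orthant u *\<^sub>R T u x) \<partial>M)"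
    by (rule has_vector_bochner_integral_norm_bound[OF has_vbi_V[OF M]])
  also have "\<dots> \<le> (\<integral>\<^sup>+u. ennreal (C * norm x) \<partial>M)"
    using bound C_nonneg by (intro nn_integral_mono ennreal_leI) (auto simp: indicator_def)
  also have "\<dots> = ennreal (C * measure M UNIV * norm x)"
    using C_nonneg by (simp add: emeasure_eq_measure ennreal_mult[symmetric] mult_ac)
  finally show ?thesis using C_nonneg by (subst (asm) ennreal_le_iff) auto
qed

lemma Vn_add: "Vn i M (x + y) = Vn i M x + Vn i M y"
  unfolding Vn_def sum.distrib[symmetric]
  by (intro sum.cong) (auto simp: linear_add[OF linear_T[OF rnd_in]] scaleR_add_right)

lemma Vn_scaleC: "Vn i M (scaleC c x) = scaleC c (Vn i M x)"
proof -
  interpret bounded_linear "scaleC c :: 'x \<Rightarrow> 'x" by (rule bounded_linear_scaleC)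
  show ?thesis unfolding Vn_def sum scale
    by (intro sum.cong) (auto simp: scaleC_T[OF rnd_in])
qed

text \<open>Linearity is inherited from the finite sums \<open>Vn\<close> in the limit.\<close>

lemma bounded_operator_V:
  assumes M: "orth_measure M"
  shows "bounded_operator (V M)"
proof -
  have add: "V M (x + y) = V M x + V M y" for x y
    using LIMSEQ_unique[OF Vn_tendsto[OF M, of "x + y"]] tendsto_add[OF Vn_tendsto[OF M] Vn_tendsto[OF M], of x y]
    by (simp add: Vn_add)
  have scC: "V M (scaleC c x) = scaleC c (V M x)" for c x
    using LIMSEQ_unique[OF Vn_tendsto[OF M, of "scaleC c x"]]
      bounded_linear.tendsto[OF bounded_linear_scaleC Vn_tendsto[OF M, of x], of c]
    by (simp add: Vn_scaleC)
  have "bounded_linear (V M)"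
  proof (rule bounded_linear_intro[OF add])
    show "V M (r *\<^sub>R x) = r *\<^sub>R V M x" for r x using scC[of "complex_of_real r" x] by (simp add: scaleC_of_real)
    show "norm (V M x) \<le> norm x * (C * measure M UNIV)" for x using V_norm_le[OF M, of x] by (simp add: mult.commute)
  qed
  then show ?thesis using scC by (simp add: bounded_operator_def)
qed

lemma V_add_measure:
  assumes a: "orth_measure a" and b: "orth_measure b"
  shows "V (add_measure a b) x = V a x + V b x"
proof -
  interpret a: finite_measure a using orth_measureD[OF a] by simp
  interpret b: finite_measure b using orth_measureD[OF b] by simp
  interpret ab: finite_measure "add_measure a b" using orth_measureD[OF orth_measure_add(1)[OF a b]] by simp
  have "measure (add_measure a b) A = measure a A + measure b A" if A: "A \<in> sets borel" for A
  proof -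
    have "ennreal (measure (add_measure a b) A) = ennreal (measure a A + measure b A)"
      using emeasure_add_measure[OF orth_measureD(2)[OF a] orth_measureD(2)[OF b] A]
      by (simp add: a.emeasure_eq_measure b.emeasure_eq_measure ab.emeasure_eq_measure)
    then show ?thesis by (subst (asm) ennreal_inj) auto
  qed
  then have "Vn i (add_measure a b) x = Vn i a x + Vn i b x" for i
    unfolding Vn_def by (simp add: scaleR_add_left sum.distrib)
  then show ?thesis
    using LIMSEQ_unique[OF Vn_tendsto[OF orth_measure_add(1)[OF a b], of x]] tendsto_add[OF Vn_tendsto[OF a] Vn_tendsto[OF b], of x x]
    by simp
qed

text \<open>The bound is uniform in \<open>i\<close>; this is what allows the iterated
  approximations in \<open>V_conv\<close> to converge together.\<close>

lemma Vn_norm_le: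
  assumes M: "orth_measure M"
  shows "norm (Vn i M x) \<le> C * measure M UNIV * norm x"
proof -
  interpret finite_measure M using orth_measureD[OF M] by simp
  have [measurable_cong, simp]: "sets M = sets borel" "space M = UNIV" using orth_measureD[OF M] by auto
  have "norm (Vn i M x) \<le> (\<Sum>p\<in>range (rnd i). norm (measure M {u. rnd i u = p} *\<^sub>R T p x))"
    unfolding Vn_def by (rule norm_sum)
  also have "\<dots> \<le> (\<Sum>p\<in>range (rnd i). measure M {u. rnd i u = p} * (C * norm x))"
    by (intro sum_mono) (auto simp: bound[OF rnd_in] intro!: mult_left_mono)
  also have "\<dots> = (\<Sum>p\<in>range (rnd i). measure M {u. rnd i u = p}) * (C * norm x)"
    by (rule sum_distrib_right[symmetric])
  also have "(\<Sum>p\<in>range (rnd i). measure M {u. rnd i u = p}) = measure M (\<Union>p\<in>range (rnd i). {u. rnd i u = p})"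
    by (intro finite_measure_finite_Union[symmetric]) (auto simp: finite_range_rnd disjoint_family_on_def)
  also have "(\<Union>p\<in>range (rnd i). {u. rnd i u = p}) = UNIV" by auto
  finally show ?thesis by (simp add: mult_ac)
qed

text \<open>The integral of T(u+v)x over the product measure is approximated in two ways. Rounding
  u+v leads to \<open>V (a \<star> b) x\<close>. Rounding u and v separately gives finite sums that
  factor as \<open>Vn i a (Vn i b x)\<close>, by the semigroup law and because cells of the product
  are rectangles.\<close>

lemma V_conv:
  assumes a: "orth_measure a" and b: "orth_measure b"
  shows "V (a \<star> b) x = V a (V b x)"
proof -
  interpret a: finite_measure a using orth_measureD[OF a] by simp
  interpret b: finite_measure b using orth_measureD[OF b] by simp
  interpret pair_sigma_finite a b ..
  have [measurable_cong, simp]: "sets a = sets borel" "sets b = sets borel" "space a = UNIV" "space b = UNIV"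
    using orth_measureD[OF a] orth_measureD[OF b] by auto
  let ?P = "a \<Otimes>\<^sub>M b"
  let ?\<phi> = "\<lambda>(u, v). u + v :: real^'n"
  have P: "finite_measure ?P" by (rule finite_measure_pair_measure) (unfold_locales)
  have m: "?\<phi> \<in> borel_measurable ?P" by measurable
  have AE: "AE p in ?P. fst p \<in> nonneg_orthant \<and> snd p \<in> nonneg_orthant"
  proof (rule AE_pair_measure)
    show "{p \<in> space ?P. fst p \<in> nonneg_orthant \<and> snd p \<in> nonneg_orthant} \<in> sets ?P" by measurable
    show "AE u in a. AE v in b. fst (u, v) \<in> nonneg_orthant \<and> snd (u, v) \<in> nonneg_orthant"
      using orth_measureD(4)[OF a] by eventually_elim (use orth_measureD(4)[OF b] in auto)
  qed
  have AE': "AE p in ?P. ?\<phi> p \<in> nonneg_orthant"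
    using AE by eventually_elim (auto simp: nonneg_orthant_def)
  obtain y where y: "has_vector_bochner_integral ?P (\<lambda>p. indicator nonneg_orthant (?\<phi> p) *\<^sub>R T (?\<phi> p) x) y"
    using V_image(2)[OF P m AE'] by blast
  have "(\<lambda>i. Vn i (a \<star> b) x) \<longlonglongrightarrow> y"
    using V_image(1)[OF P m AE' y] by (simp add: convolution_def)
  then have Vy: "V (a \<star> b) x = y"
    using Vn_tendsto[OF orth_measure_conv(1)[OF a b]] LIMSEQ_unique by blast
  let ?g = "\<lambda>i p. (rnd i (fst p), rnd i (snd p))"
  let ?s = "\<lambda>i p. T (rnd i (fst p)) (T (rnd i (snd p)) x)"
  have g: "simple_function ?P (?g i)" for i
    by (rule simple_function_Pair) (rule simple_function_rnd_compose, measurable)+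
  have s: "simple_function ?P (?s i)" for i
    using simple_function_compose1[OF g, of "\<lambda>q. T (fst q) (T (snd q) x)" i] by simp
  have F: "(\<lambda>p. indicator nonneg_orthant (?\<phi> p) *\<^sub>R T (?\<phi> p) x) \<in> borel_measurable ?P"
    by (rule measurable_compose[OF m measurable_T])
  have sb: "norm (?s i p) \<le> C * (C * norm x)" for i p
    by (rule order_trans[OF bound[OF rnd_in] mult_left_mono[OF bound[OF rnd_in] C_nonneg]])
  have lim: "AE p in ?P. (\<lambda>i. ?s i p) \<longlonglongrightarrow> indicator nonneg_orthant (?\<phi> p) *\<^sub>R T (?\<phi> p) x"
    using AE
  proof eventually_elim
    case (elim p)
    then have o: "fst p + snd p \<in> nonneg_orthant" by (auto simp: nonneg_orthant_def)
    have "rnd i u + rnd i v \<in> nonneg_orthant" for i and u v :: "real^'n"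
      using rnd_in[of i u] rnd_in[of i v] by (auto simp: nonneg_orthant_def)
    then have "(\<lambda>i. T (rnd i (fst p) + rnd i (snd p)) x) \<longlonglongrightarrow> T (fst p + snd p) x"
      using elim by (intro T_tendsto o tendsto_add rnd_tendsto) auto
    then show ?case using o by (simp add: add[OF rnd_in rnd_in] case_prod_beta)
  qed
  note l = bounded_simple_limit(1)[OF P F s sb lim]
  have si: "Bochner_Integration.simple_bochner_integrable ?P (?s i)" for i
    by (rule simple_bochner_integrable_finite[OF P s])
  have sy: "(\<lambda>i. sbi ?P (?s i)) \<longlonglongrightarrow> y"
    by (rule has_vector_bochner_integral_limit[OF y si l])
  have eq: "sbi ?P (?s i) = Vn i a (Vn i b x)" for i
  proof -
    have "sbi ?P (?s i) = (\<Sum>q\<in>?g i ` space ?P. measure ?P {p\<in>space ?P. ?g i p = q} *\<^sub>R T (fst q) (T (snd q) x))"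
      by (rule simple_bochner_integral_partition[OF si g]) auto
    also have "?g i ` space ?P = range (rnd i) \<times> range (rnd i)"
      using map_prod_surj_on[of "rnd i" UNIV "range (rnd i)" "rnd i" UNIV "range (rnd i)"]
      by (simp add: space_pair_measure map_prod_def case_prod_beta)
    also have "(\<Sum>q\<in>range (rnd i) \<times> range (rnd i). measure ?P {p\<in>space ?P. ?g i p = q} *\<^sub>R T (fst q) (T (snd q) x)) =
      (\<Sum>q\<in>range (rnd i) \<times> range (rnd i). (measure a {u. rnd i u = fst q} * measure b {u. rnd i u = snd q}) *\<^sub>R T (fst q) (T (snd q) x))"
    proof (intro sum.cong refl)
      fix q :: "(real^'n) \<times> (real^'n)"
      have "{p\<in>space ?P. ?g i p = q} = {u. rnd i u = fst q} \<times> {u. rnd i u = snd q}"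
        by (auto simp: space_pair_measure)
      then have "measure ?P {p\<in>space ?P. ?g i p = q} = measure a {u. rnd i u = fst q} * measure b {u. rnd i u = snd q}"
        by (simp add: measure_def b.emeasure_pair_measure_Times enn2real_mult)
      then show "measure ?P {p\<in>space ?P. ?g i p = q} *\<^sub>R T (fst q) (T (snd q) x) =
        (measure a {u. rnd i u = fst q} * measure b {u. rnd i u = snd q}) *\<^sub>R T (fst q) (T (snd q) x)" by simp
    qed
    also have "\<dots> = (\<Sum>p\<in>range (rnd i). \<Sum>q\<in>range (rnd i). (measure a {u. rnd i u = p} * measure b {u. rnd i u = q}) *\<^sub>R T p (T q x))"
      by (simp add: sum.cartesian_product case_prod_beta)
    also have "\<dots> = Vn i a (Vn i b x)"
      unfolding Vn_def
    proof (intro sum.cong refl)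
      fix p :: "real^'n" assume "p \<in> range (rnd i)"
      then have p: "linear (T p)" using linear_T rnd_in by blast
      show "(\<Sum>q\<in>range (rnd i). (measure a {u. rnd i u = p} * measure b {u. rnd i u = q}) *\<^sub>R T p (T q x)) =
        measure a {u. rnd i u = p} *\<^sub>R T p (\<Sum>p\<in>range (rnd i). measure b {u. rnd i u = p} *\<^sub>R T p x)"
        by (simp add: linear_sum[OF p] linear_scale[OF p] scaleR_sum_right)
    qed
    finally show ?thesis .
  qed
  \<comment> \<open>Both approximations move with the same \<open>i\<close>; the inner error is
    absorbed by the uniform bound on \<open>Vn i a\<close>.\<close>
  have "(\<lambda>i. Vn i a (Vn i b x - V b x)) \<longlonglongrightarrow> 0"
  proof (rule tendsto_norm_zero_cancel, rule tendsto_sandwich[OF _ _ tendsto_const])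
    show "eventually (\<lambda>i. norm (Vn i a (Vn i b x - V b x)) \<le> C * measure a UNIV * norm (Vn i b x - V b x)) sequentially"
      by (intro always_eventually allI Vn_norm_le a)
    have "(\<lambda>i. C * measure a UNIV * norm (Vn i b x - V b x)) \<longlonglongrightarrow> C * measure a UNIV * norm (V b x - V b x)"
      by (intro tendsto_intros Vn_tendsto b)
    then show "(\<lambda>i. C * measure a UNIV * norm (Vn i b x - V b x)) \<longlonglongrightarrow> 0" by simp
  qed simp
  from tendsto_add[OF this Vn_tendsto[OF a, of "V b x"]]
  have "(\<lambda>i. Vn i a (Vn i b x)) \<longlonglongrightarrow> V a (V b x)" by (simp add: Vn_add[symmetric])
  then show ?thesis using sy Vy LIMSEQ_unique unfolding eq by blast
qed

end

section \<open>Subordinated semigroups\<close>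

lemma bounded_operator_comp:
  assumes "bounded_operator F" "bounded_operator G"
  shows "bounded_operator (\<lambda>x. F (G x))"
  using assms bounded_linear_compose unfolding bounded_operator_def by auto

lemma bounded_operator_diff:
  assumes "bounded_operator F" "bounded_operator G"
  shows "bounded_operator (\<lambda>x. F x - G x)"
proof -
  have "scaleC c (x - y) = scaleC c x - scaleC c y" for c and x y :: 'a
    using linear_diff[OF bounded_linear.linear[OF bounded_linear_scaleC]] by blast
  then show ?thesis using assms bounded_linear_sub unfolding bounded_operator_def by auto
qed

lemma apply_op_generator:
  assumes "(x, y) \<in> generator U"
  shows "apply_op (generator U) x = y"
  unfolding apply_op_def
proof (rule the_equality[where P="\<lambda>y. (x, y) \<in> generator U", OF assms])
  fix z assume "(x, z) \<in> generator U"
  then show "z = y" using assms tendsto_unique[OF trivial_limit_at_right_real]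
    unfolding generator_def by blast
qed

text \<open>Carries membership in the domain of the generator from a small time to all later
  times.\<close>

lemma generator_semigroup:
  assumes U: "bounded_C0_semigroup U" and xy: "(x, y) \<in> generator U" and r: "0 \<le> r"
  shows "(U r x, U r y) \<in> generator U"
proof -
  interpret r: bounded_linear "U r" using U r by (auto simp: bounded_C0_semigroup_def bounded_operator_def)
  have comm: "U h (U r x) = U r (U h x)" if "0 < h" for h
  proof -
    have "U (h + r) = U h \<circ> U r" "U (r + h) = U r \<circ> U h"
      using U r that unfolding bounded_C0_semigroup_def by auto
    then show ?thesis by (metis add.commute comp_apply)
  qed
  have "((\<lambda>h. U r ((U h x - x) /\<^sub>R h)) \<longlongrightarrow> U r y) (at_right 0)"
    using xy unfolding generator_def by (auto intro: r.tendsto)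
  moreover have "eventually (\<lambda>h. U r ((U h x - x) /\<^sub>R h) = (U h (U r x) - U r x) /\<^sub>R h) (at_right 0)"
    unfolding eventually_at_right_field using comm by (intro exI[of _ 1]) (auto simp: r.scale r.diff)
  ultimately show ?thesis
    unfolding generator_def by (auto elim: Lim_transform_eventually)
qed

text \<open>The lower bound on the transform at (-1,...,-1) forces the share of mass of
  \<open>M h\<close> outside any ball about 0 to vanish as h tends to 0, so normalized averages
  converge to T(0)z = z. Used with \<open>nu \<psi> h\<close> and mass 1 for strong continuity, and
  with \<open>nu_integral h\<close> and mass \<open>h\<close> for the generator.\<close>

lemma (in orthant_semigroup) average_tendsto:
  assumes M: "\<And>h. 0 < h \<Longrightarrow> orth_measure (M h)" and m: "\<And>h. 0 < h \<Longrightarrow> measure (M h) UNIV = c h"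
    and c: "\<And>h::real. 0 < h \<Longrightarrow> 0 < c h"
    and p: "\<And>h. 0 < h \<Longrightarrow> c h * exp (h * p) \<le> (\<integral>u. exp ((- 1) \<bullet> u) \<partial>M h)"
  shows "((\<lambda>h. V (M h) z /\<^sub>R c h) \<longlongrightarrow> z) (at_right 0)"
proof (rule tendstoI)
  fix e :: real assume e: "0 < e"
  have "(0 :: real^'n) \<in> nonneg_orthant" by (simp add: nonneg_orthant_def)
  then obtain \<delta> where \<delta>: "0 < \<delta>"
    "\<And>u. u \<in> nonneg_orthant \<Longrightarrow> dist u 0 < \<delta> \<Longrightarrow> dist (T u z) (T 0 z) < e / 2"
    using cont[of z] e unfolding continuous_on_iff by (metis half_gt_zero)
  have small: "norm (T u z - z) \<le> e / 2" if "u \<in> nonneg_orthant" "norm u < \<delta>" for u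
    using \<delta>(2)[OF that(1)] that(2) by (simp add: zero dist_norm)
  define q where "q = 1 - exp (- \<delta>)"
  have q: "0 < q" using \<delta>(1) by (simp add: q_def)
  \<comment> \<open>By the concentration inequality the tail contributes at most
    \<open>K * (1 - exp (h * p))\<close> times the total mass \<open>c h\<close>.\<close>
  define K where "K = (C + 1) * norm z / q"
  have K: "0 \<le> K" using C_nonneg q by (simp add: K_def)
  have main: "dist (V (M h) z /\<^sub>R c h) z \<le> e / 2 + K * (1 - exp (h * p))" if h: "0 < h" for h
  proof -
    have ch: "0 < c h" by (rule c[OF h])
    have "measure (M h) {u. \<delta> \<le> norm u} * q \<le> c h * (1 - exp (h * p))"
      using orth_measure_concentration[OF M[OF h] \<delta>(1)] p[OF h] m[OF h] by (simp add: q_def algebra_simps)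
    then have "measure (M h) {u. \<delta> \<le> norm u} \<le> c h * (1 - exp (h * p)) / q"
      using q by (simp add: pos_le_divide_eq)
    then have "(C + 1) * norm z * measure (M h) {u. \<delta> \<le> norm u} \<le> (C + 1) * norm z * (c h * (1 - exp (h * p)) / q)"
      using C_nonneg by (intro mult_left_mono) auto
    also have "\<dots> = c h * (K * (1 - exp (h * p)))" by (simp add: K_def)
    finally have "norm (V (M h) z - c h *\<^sub>R z) \<le> c h * (e / 2 + K * (1 - exp (h * p)))"
      using V_norm_diff[OF M[OF h] \<delta>(1) _ small] e m[OF h] by (simp add: algebra_simps)
    moreover have eq: "V (M h) z /\<^sub>R c h - z = (V (M h) z - c h *\<^sub>R z) /\<^sub>R c h"
      using ch by (simp add: scaleR_diff_right)
    ultimately have "norm (V (M h) z /\<^sub>R c h - z) \<le> inverse (c h) * (c h * (e / 2 + K * (1 - exp (h * p))))"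
      unfolding eq norm_scaleR using ch by (simp only: abs_of_pos positive_imp_inverse_positive mult_left_mono less_imp_le)
    also have "\<dots> = e / 2 + K * (1 - exp (h * p))" using ch by simp
    finally show ?thesis by (simp only: dist_norm)
  qed
  have "((\<lambda>h. e / 2 + K * (1 - exp (h * p))) \<longlongrightarrow> e / 2 + K * (1 - exp (0 * p))) (at_right 0)"
    by (intro tendsto_intros)
  then have "eventually (\<lambda>h. e / 2 + K * (1 - exp (h * p)) < e) (at_right 0)"
    by (rule order_tendstoD) (use e in simp)
  moreover have "eventually (\<lambda>h::real. 0 < h) (at_right 0)" by (rule eventually_at_right_less)
  ultimately show "eventually (\<lambda>h. dist (V (M h) z /\<^sub>R c h) z < e) (at_right 0)"
    by eventually_elim (use main in fastforce)
qed

section \<open>The subordinated semigroup and its generator\<close>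

locale subordinated_semigroup =
  levy_density \<psi> \<mu> f + orthant_semigroup T C
  for \<psi> :: "real^'n \<Rightarrow> real" and \<mu> f and T :: "real^'n \<Rightarrow> 'x::complex_banach \<Rightarrow> 'x" and C
begin

definition g :: "real \<Rightarrow> 'x \<Rightarrow> 'x" where
  "g t x = V (nu \<psi> t) x"

lemma g_bounded_operator: "0 \<le> t \<Longrightarrow> bounded_operator (g t)"
  unfolding g_def[abs_def] by (intro bounded_operator_V orth_measure_nu)

lemma g_norm_le:
  assumes t: "0 \<le> t" shows "norm (g t x) \<le> C * norm x"
proof -
  interpret prob_space "nu \<psi> t" by (rule prob_space_nu[OF t])
  have "measure (nu \<psi> t) UNIV = 1"
    using prob_space orth_measureD(3)[OF orth_measure_nu[OF t]] by simp
  then show ?thesis unfolding g_def using V_norm_le[OF orth_measure_nu[OF t], of x] by simp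
qed

lemma g_0: "g 0 x = x"
proof -
  have o: "orth_measure (return borel (0 :: real^'n))" using orth_measure_nu[of 0] by (simp add: nu_0)
  have "Vn i (return borel 0) x = T (rnd i 0) x" for i
  proof -
    have "Vn i (return borel 0) x = (\<Sum>p\<in>range (rnd i). if rnd i 0 = p then T p x else 0)"
      unfolding Vn_def by (intro sum.cong) (auto simp: measure_return)
    also have "\<dots> = T (rnd i 0) x" by (simp add: sum.delta' finite_range_rnd)
    finally show ?thesis .
  qed
  moreover have "(\<lambda>i. T (rnd i 0) x) \<longlonglongrightarrow> T 0 x"
    by (intro T_tendsto rnd_in rnd_tendsto) (auto simp: nonneg_orthant_def)
  ultimately show ?thesis
    unfolding g_def nu_0 using Vn_tendsto[OF o, of x] LIMSEQ_unique by (simp add: zero)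
qed

lemma g_add: "0 \<le> s \<Longrightarrow> 0 \<le> t \<Longrightarrow> g (s + t) x = g s (g t x)"
  unfolding g_def by (simp add: nu_add V_conv orth_measure_nu)

lemma g_tendsto_0: "((\<lambda>h. g h x) \<longlongrightarrow> x) (at_right 0)"
proof -
  have "((\<lambda>h. V (nu \<psi> h) x /\<^sub>R 1) \<longlongrightarrow> x) (at_right 0)"
  proof (rule average_tendsto[where c="\<lambda>_. 1" and p="\<psi> (- 1)"])
    fix h :: real assume h: "0 < h"
    show "orth_measure (nu \<psi> h)" using h by (intro orth_measure_nu) auto
    interpret prob_space "nu \<psi> h" using h by (intro prob_space_nu) auto
    show "measure (nu \<psi> h) UNIV = 1"
      using h prob_space orth_measureD(3)[OF orth_measure_nu[of h]] by simp
    show "1 * exp (h * \<psi> (- 1)) \<le> (\<integral>u. exp ((- 1) \<bullet> u) \<partial>nu \<psi> h)"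
      using laplace_nu[of h "- 1"] h by simp
  qed auto
  then show ?thesis by (simp add: g_def)
qed

lemma g_C0: "bounded_C0_semigroup g"
  unfolding bounded_C0_semigroup_def
proof (intro conjI allI impI)
  show "g 0 = id" by (auto simp: g_0)
  show "g (s + t) = g s \<circ> g t" if "0 \<le> s" "0 \<le> t" for s t using that by (auto simp: g_add)
  show "\<exists>M. \<forall>t\<ge>0. onorm (g t) \<le> M"
    using g_norm_le C_nonneg by (intro exI[of _ C] allI impI onorm_bound) auto
  show "continuous_on {0..} (\<lambda>t. g t x)" for x
    unfolding continuous_on_iff
  proof (intro ballI allI impI)
    fix t e :: real assume t: "t \<in> {0..}" and e: "0 < e"
    \<comment> \<open>Dividing by \<open>C + 1\<close> instead of \<open>C\<close> covers the case
      \<open>C = 0\<close>.\<close>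
    have "eventually (\<lambda>h. dist (g h x) x < e / (C + 1)) (at_right 0)"
      using g_tendsto_0 by (rule tendstoD) (use e C_nonneg in simp)
    then obtain d where d: "0 < d" "\<And>h. 0 < h \<Longrightarrow> h < d \<Longrightarrow> dist (g h x) x < e / (C + 1)"
      unfolding eventually_at_right_field by auto
    \<comment> \<open>Factoring out the earlier time reduces continuity from both sides to right
      continuity at 0, uniformly in the earlier time.\<close>
    have *: "dist (g b x) (g a x) < e" if ab: "0 \<le> a" "a < b" "b - a < d" for a b
    proof -
      interpret a: bounded_linear "g a" using g_bounded_operator[OF ab(1)] by (simp add: bounded_operator_def)
      have "g b x - g a x = g a (g (b - a) x - x)"
        using g_add[of a "b - a" x] ab by (simp add: a.diff)
      then have "dist (g b x) (g a x) \<le> C * dist (g (b - a) x) x"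
        using g_norm_le[OF ab(1)] by (simp add: dist_norm)
      also have "\<dots> \<le> C * (e / (C + 1))"
        using d(2)[of "b - a"] ab C_nonneg by (intro mult_left_mono) auto
      also have "\<dots> < e" using e C_nonneg by (simp add: field_simps)
      finally show ?thesis .
    qed
    have "dist (g t' x) (g t x) < e" if "t' \<in> {0..}" "dist t' t < d" for t'
      using *[of t t'] *[of t' t] that t e
      by (cases t t' rule: linorder_cases) (auto simp: dist_real_def dist_commute)
    then show "\<exists>d>0. \<forall>t'\<in>{0..}. dist t' t < d \<longrightarrow> dist (g t' x) (g t x) < e" using d(1) by blast
  qed
qed (rule g_bounded_operator)

definition Gg :: "real \<Rightarrow> 'x \<Rightarrow> 'x" where
  "Gg t x = V (inc_pos t) x - V (inc_neg t) x"

text \<open>By \<open>nu_increment\<close> the difference quotient of the orbit at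
  \<open>g t x\<close> is exactly the normalized \<open>nu_integral h\<close> average of
  \<open>Gg t x\<close>, so its limit is an instance of \<open>average_tendsto\<close>.\<close>

lemma Gg_generator:
  assumes t: "0 < t" and k: "k_functional (f t) \<mu> < \<infinity>"
  shows "(g t x, Gg t x) \<in> generator g"
proof -
  note o = orth_measure_inc_pos[OF t k] orth_measure_inc_neg[OF t k]
  have "((\<lambda>h. V (nu_integral h) (Gg t x) /\<^sub>R h) \<longlongrightarrow> Gg t x) (at_right 0)"
    by (rule average_tendsto[where p="\<psi> (- 1)"])
      (fact orth_measure_nu_integral measure_nu_integral laplace_nu_integral_ge[OF _ neg_one_in_neg_orthant] | assumption)+
  moreover have "eventually (\<lambda>h. V (nu_integral h) (Gg t x) /\<^sub>R h = (g h (g t x) - g t x) /\<^sub>R h) (at_right 0)"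
    unfolding eventually_at_right_field
  proof (intro exI[of _ 1] conjI allI impI)
    fix h :: real assume h: "0 < h"
    note N = orth_measure_nu_integral[OF h]
    have nu: "orth_measure (nu \<psi> (h + t))" "orth_measure (nu \<psi> t)"
      using h t by (auto intro: orth_measure_nu)
    interpret N: bounded_linear "V (nu_integral h)"
      using bounded_operator_V[OF N] by (simp add: bounded_operator_def)
    have "V (nu \<psi> (h + t)) x + V (nu_integral h \<star> inc_neg t) x = V (nu \<psi> t) x + V (nu_integral h \<star> inc_pos t) x"
      using nu_increment[OF t h k] V_add_measure[OF nu(1) orth_measure_conv(1)[OF N o(2)], of x]
        V_add_measure[OF nu(2) orth_measure_conv(1)[OF N o(1)], of x] by simp
    then have "V (nu_integral h) (Gg t x) = g (h + t) x - g t x"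
      by (simp add: Gg_def N.diff V_conv[OF N o(1)] V_conv[OF N o(2)] g_def algebra_simps)
    then show "V (nu_integral h) (Gg t x) /\<^sub>R h = (g h (g t x) - g t x) /\<^sub>R h"
      using g_add[of h t x] h t by simp
  qed auto
  ultimately show ?thesis
    unfolding generator_def by (auto elim: Lim_transform_eventually)
qed

lemma Gg_bounded_operator:
  assumes t: "0 < t" and k: "k_functional (f t) \<mu> < \<infinity>"
  shows "bounded_operator (Gg t)"
  unfolding Gg_def[abs_def]
  by (intro bounded_operator_diff bounded_operator_V orth_measure_inc_pos[OF t k] orth_measure_inc_neg[OF t k])

lemma Gg_norm_le:
  assumes t: "0 < t" and k: "k_functional (f t) \<mu> < \<infinity>"
  shows "norm (Gg t x) \<le> C * (measure (inc_pos t) UNIV + measure (inc_neg t) UNIV) * norm x"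
  using norm_triangle_ineq4[of "V (inc_pos t) x" "V (inc_neg t) x"]
    V_norm_le[OF orth_measure_inc_pos[OF t k], of x] V_norm_le[OF orth_measure_inc_neg[OF t k], of x]
  by (simp add: Gg_def algebra_simps)

lemma g_condition_Y:
  assumes lim: "Limsup (at_right 0) (\<lambda>t. ennreal t * k_functional (f t) \<mu>) < \<infinity>"
  shows "condition_Y g"
proof -
  \<comment> \<open>A finite bound strictly above the upper limit; it holds for all sufficiently
    small times and becomes the constant in (Y).\<close>
  obtain c where c: "Limsup (at_right 0) (\<lambda>t. ennreal t * k_functional (f t) \<mu>) < c" "c < \<infinity>"
    using dense[OF lim] by blast
  then obtain t0 where t0: "0 < t0" "\<And>t. 0 < t \<Longrightarrow> t < t0 \<Longrightarrow> ennreal t * k_functional (f t) \<mu> < c"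
    using Limsup_lessD[OF c(1)] unfolding eventually_at_right_field by auto
  \<comment> \<open>Here \<open>0 < t\<close> matters: 0 times infinity is 0 in the extended
    nonnegative reals, so the bound at \<open>t = 0\<close> would say nothing about k.\<close>
  have k: "k_functional (f t) \<mu> < \<infinity>" if "0 < t" "t < t0" for t
  proof (rule ccontr)
    assume "\<not> k_functional (f t) \<mu> < \<infinity>"
    then have "k_functional (f t) \<mu> = \<infinity>" by (metis less_top infinity_ennreal_def)
    then have "ennreal t * k_functional (f t) \<mu> = \<infinity>" using that by (simp add: ennreal_mult_top)
    then show False using t0(2)[OF that] c(2) by simp
  qed
  \<comment> \<open>Finiteness of k is known only below \<open>t0\<close>; a later time is reached
    by applying \<open>g (t - s)\<close> after such a time \<open>s\<close>.\<close>
  have gen: "(g t x, g (t - s) (Gg s x)) \<in> generator g" if "0 < s" "s < t0" "s \<le> t" for s t x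
    using generator_semigroup[OF g_C0 Gg_generator[OF that(1) k[OF that(1,2)], of x], of "t - s"]
      g_add[of "t - s" s x] that by simp
  have ex: "\<exists>s. 0 < s \<and> s < t0 \<and> s \<le> t" if "0 < t" for t
    using that t0(1) by (intro exI[of _ "min t (t0 / 2)"]) auto
  have op: "range (g t) \<subseteq> Domain (generator g) \<and> bounded_operator (\<lambda>x. apply_op (generator g) (g t x))" if t: "0 < t" for t
  proof -
    obtain s where s: "0 < s" "s < t0" "s \<le> t" using ex[OF t] by blast
    have "bounded_operator (\<lambda>x. g (t - s) (Gg s x))"
      by (rule bounded_operator_comp[OF g_bounded_operator Gg_bounded_operator[OF s(1) k[OF s(1,2)]]]) (use s in simp)
    then show ?thesis using gen[OF s] apply_op_generator[OF gen[OF s]] by auto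
  qed
  have le: "t * onorm (\<lambda>x. apply_op (generator g) (g t x)) \<le> C * enn2real c" if t: "0 < t" "t < t0" for t
  proof -
    let ?m = "measure (inc_pos t) UNIV + measure (inc_neg t) UNIV"
    have ap: "apply_op (generator g) (g t x) = Gg t x" for x
      using apply_op_generator[OF Gg_generator[OF t(1) k[OF t], of x]] .
    have "onorm (Gg t) \<le> C * ?m"
      by (rule onorm_bound) (use C_nonneg Gg_norm_le[OF t(1) k[OF t]] in auto)
    then have "t * onorm (Gg t) \<le> C * (t * ?m)"
      using t(1) by (simp add: mult_left_mono mult.left_commute)
    moreover have "t * ?m \<le> enn2real c"
    proof -
      have "ennreal (t * ?m) = ennreal t * ennreal ?m" using t(1) by (intro ennreal_mult) auto
      also have "\<dots> \<le> ennreal t * k_functional (f t) \<mu>"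
        by (intro mult_left_mono measure_inc[OF t(1) k[OF t]]) auto
      also have "\<dots> \<le> c" using t0(2)[OF t] by simp
      also have "c = ennreal (enn2real c)" using c(2) by simp
      finally show ?thesis by (subst (asm) ennreal_le_iff) auto
    qed
    ultimately show ?thesis
      unfolding ap using C_nonneg by (meson mult_left_mono order_trans)
  qed
  have "Limsup (at_right 0) (\<lambda>t. ereal (t * onorm (\<lambda>x. apply_op (generator g) (g t x)))) \<le> ereal (C * enn2real c)"
    using le t0(1) by (intro Limsup_bounded) (auto simp: eventually_at_right_field)
  then have "Limsup (at_right 0) (\<lambda>t. ereal (t * onorm (\<lambda>x. apply_op (generator g) (g t x)))) < \<infinity>"
    by (rule le_less_trans) simp
  then show ?thesis
    unfolding condition_Y_def Let_def using op by simp
qed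

end

section \<open>The n-parameter semigroup of commuting generators\<close>

locale commuting_semigroups =
  fixes A :: "'n::finite \<Rightarrow> ('x::complex_banach \<times> 'x) set"
  assumes A: "commuting_generators A"
begin

abbreviation U :: "'n \<Rightarrow> real \<Rightarrow> 'x \<Rightarrow> 'x" where
  "U i \<equiv> semigroup_of (A i)"

lemma U_C0: "bounded_C0_semigroup (U i)"
proof -
  have "\<exists>W. generates (A i) W" using A by (simp add: commuting_generators_def)
  then have "generates (A i) (U i)" unfolding semigroup_of_def by (rule someI_ex)
  then show ?thesis by (simp add: generates_def)
qed

lemma U_commute: "0 \<le> s \<Longrightarrow> 0 \<le> t \<Longrightarrow> U i s (U j t x) = U j t (U i s x)"
  using A unfolding commuting_generators_def by (metis comp_apply)

lemma U_op: "0 \<le> t \<Longrightarrow> bounded_operator (U i t)"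
  and U_0: "U i 0 x = x"
  and U_add: "0 \<le> s \<Longrightarrow> 0 \<le> t \<Longrightarrow> U i (s + t) x = U i s (U i t x)"
  and U_cont: "continuous_on {0..} (\<lambda>t. U i t x)"
  using U_C0[of i] unfolding bounded_C0_semigroup_def by auto

lemma U_bound: "\<exists>B\<ge>0. \<forall>t\<ge>0. \<forall>x. norm (U i t x) \<le> B * norm x"
proof -
  obtain M where M: "\<And>t. t \<ge> 0 \<Longrightarrow> onorm (U i t) \<le> M"
    using U_C0[of i] unfolding bounded_C0_semigroup_def by auto
  have "norm (U i t x) \<le> max 0 M * norm x" if "0 \<le> t" for t x
  proof -
    have "norm (U i t x) \<le> onorm (U i t) * norm x"
      using U_op[OF that] by (intro onorm) (simp add: bounded_operator_def)
    also have "\<dots> \<le> max 0 M * norm x" using M[OF that] by (intro mult_right_mono) auto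
    finally show ?thesis .
  qed
  then show ?thesis by (intro exI[of _ "max 0 M"]) auto
qed

text \<open>The product over a subset of the coordinates, so that properties of
  \<open>multi_semigroup\<close> can be proved by induction on the set of factors.\<close>

definition partial_product :: "'n set \<Rightarrow> real^'n \<Rightarrow> 'x \<Rightarrow> 'x" where
  "partial_product S u = Finite_Set.fold (\<lambda>i S. U i (u $ i) \<circ> S) id S"

lemma partial_product_insert:
  assumes u: "u \<in> nonneg_orthant" and S: "finite S" "i \<notin> S"
  shows "partial_product (insert i S) u x = U i (u $ i) (partial_product S u x)"
proof -
  \<comment> \<open>The fold is independent of the order only for \<open>u\<close> in the orthant,
    since the semigroups commute only at nonnegative times.\<close>
  interpret comp_fun_commute "\<lambda>i S. U i (u $ i) \<circ> S"
    by standard (use u U_commute in \<open>auto simp: fun_eq_iff nonneg_orthant_def\<close>)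
  show ?thesis unfolding partial_product_def fold_insert[OF S] by simp
qed

text \<open>Commutation with every \<open>U j t\<close> is carried through the induction because the
  semigroup law of the enlarged product must move U_i(v_i) past the old product at u. The norm
  bounds of the factors multiply.\<close>

lemma orthant_semigroup_partial_product:
  assumes "finite S"
  shows "(\<exists>C. orthant_semigroup (partial_product S) C) \<and>
    (\<forall>u\<in>nonneg_orthant. \<forall>j. \<forall>t\<ge>0. \<forall>x. U j t (partial_product S u x) = partial_product S u (U j t x))"
  using assms
proof (induction S rule: finite_induct)
  case empty
  have "orthant_semigroup (partial_product {}) 1"
    by standard (auto simp: partial_product_def bounded_operator_def bounded_linear_ident[folded id_def])
  then have "\<exists>C. orthant_semigroup (partial_product {}) C" ..
  moreover have "\<forall>u\<in>nonneg_orthant. \<forall>j. \<forall>t\<ge>0. \<forall>x.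
      U j t (partial_product {} u x) = partial_product {} u (U j t x)"
    by (simp add: partial_product_def)
  ultimately show ?case by blast
next
  case (insert i S)
  let ?P = "partial_product S"
  obtain C where "orthant_semigroup ?P C" using insert by blast
  then interpret P: orthant_semigroup ?P C .
  have comm: "U j t (?P u x) = ?P u (U j t x)" if "u \<in> nonneg_orthant" "0 \<le> t" for u j t x
    using insert.IH that by blast
  obtain B where B: "0 \<le> B" "\<And>t x. 0 \<le> t \<Longrightarrow> norm (U i t x) \<le> B * norm x" using U_bound by blast
  note ins = partial_product_insert[OF _ insert.hyps]
  have nn: "0 \<le> u $ j" if "u \<in> nonneg_orthant" for u :: "real^'n" and j using that by (simp add: nonneg_orthant_def)
  have z: "(0 :: real^'n) \<in> nonneg_orthant" by (simp add: nonneg_orthant_def)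
  have "orthant_semigroup (partial_product (insert i S)) (B * C)"
  proof
    fix u v :: "real^'n" and x :: 'x
    assume u: "u \<in> nonneg_orthant"
    show "bounded_operator (partial_product (insert i S) u)"
      using bounded_operator_comp[OF U_op[OF nn[OF u]] P.op[OF u]] by (simp add: ins[OF u, abs_def])
    have "norm (U i (u $ i) (?P u x)) \<le> B * (C * norm x)"
      by (rule order_trans[OF B(2)[OF nn[OF u]] mult_left_mono[OF P.bound[OF u] B(1)]])
    then show "norm (partial_product (insert i S) u x) \<le> B * C * norm x"
      by (simp add: ins[OF u] mult.assoc)
    assume v: "v \<in> nonneg_orthant"
    have uv: "u + v \<in> nonneg_orthant" using nn[OF u] nn[OF v] by (simp add: nonneg_orthant_def)
    show "partial_product (insert i S) (u + v) x = partial_product (insert i S) u (partial_product (insert i S) v x)"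
      using comm[OF u nn[OF v]] by (simp add: ins u v uv U_add nn P.add)
  next
    show "0 \<le> B * C" using B(1) P.C_nonneg by simp
    show "partial_product (insert i S) 0 x = x" for x by (simp add: ins[OF z] U_0 P.zero)
    fix x :: 'x
    show "continuous_on nonneg_orthant (\<lambda>u. partial_product (insert i S) u x)"
      unfolding continuous_on_def
    proof
      fix u :: "real^'n" assume u: "u \<in> nonneg_orthant"
      let ?F = "at u within nonneg_orthant"
      have Plim: "((\<lambda>v. ?P v x) \<longlongrightarrow> ?P u x) ?F" using P.cont u unfolding continuous_on_def by blast
      have ev: "eventually (\<lambda>v. v \<in> nonneg_orthant) ?F" by (simp add: eventually_at_filter)
      \<comment> \<open>Strong continuity of a product: the change of the inner factor is controlled
        by the uniform bound \<open>B\<close>, and the outer factor then acts on the fixed vector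
        \<open>?P u x\<close>.\<close>
      have "((\<lambda>v. U i (v $ i) (?P v x - ?P u x)) \<longlongrightarrow> 0) ?F"
      proof (rule Lim_null_comparison)
        show "eventually (\<lambda>v. norm (U i (v $ i) (?P v x - ?P u x)) \<le> B * norm (?P v x - ?P u x)) ?F"
          using ev by eventually_elim (use B(2) nn in blast)
        have "((\<lambda>v. B * norm (?P v x - ?P u x)) \<longlongrightarrow> B * norm (?P u x - ?P u x)) ?F"
          by (intro tendsto_intros Plim)
        then show "((\<lambda>v. B * norm (?P v x - ?P u x)) \<longlongrightarrow> 0) ?F" by simp
      qed
      moreover have "((\<lambda>v. U i (v $ i) (?P u x)) \<longlongrightarrow> U i (u $ i) (?P u x)) ?F"
      proof -
        have "continuous_on nonneg_orthant (\<lambda>v. U i (v $ i) (?P u x))"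
          by (rule continuous_on_compose2[OF U_cont]) (auto intro!: continuous_intros simp: nonneg_orthant_def)
        then show ?thesis using u unfolding continuous_on_def by blast
      qed
      ultimately have "((\<lambda>v. U i (v $ i) (?P v x - ?P u x) + U i (v $ i) (?P u x)) \<longlongrightarrow> 0 + U i (u $ i) (?P u x)) ?F"
        by (rule tendsto_add)
      moreover have "eventually (\<lambda>v. U i (v $ i) (?P v x - ?P u x) + U i (v $ i) (?P u x) = partial_product (insert i S) v x) ?F"
        using ev
      proof eventually_elim
        case (elim v)
        interpret v: bounded_linear "U i (v $ i)" using U_op[OF nn[OF elim]] by (simp add: bounded_operator_def)
        show ?case by (simp add: ins[OF elim] v.diff)
      qed
      ultimately show "((\<lambda>v. partial_product (insert i S) v x) \<longlongrightarrow> partial_product (insert i S) u x) ?F"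
        by (simp add: ins[OF u] Lim_transform_eventually)
    qed
  qed
  moreover have "U j t (partial_product (insert i S) u x) = partial_product (insert i S) u (U j t x)"
    if "u \<in> nonneg_orthant" "0 \<le> t" for u j t x
    using U_commute[OF that(2) nn[OF that(1)]] comm[OF that] by (simp add: ins[OF that(1)])
  ultimately show ?case by blast
qed

lemma orthant_semigroup_multi: "\<exists>C. orthant_semigroup (multi_semigroup A) C"
proof -
  have "multi_semigroup A = partial_product UNIV"
    by (simp add: fun_eq_iff multi_semigroup_def partial_product_def)
  then show ?thesis using orthant_semigroup_partial_product[of UNIV] by simp
qed

end

theorem theorem5p4:
  fixes \<psi> :: "real^'n \<Rightarrow> real"
    and \<mu> :: "(real^'n) measure"
    and f :: "real \<Rightarrow> real^'n \<Rightarrow> complex"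
  assumes "\<psi> \<in> Tn0"
    and "represents \<psi> 0 0 \<mu>"
    and "\<And>t. t > 0 \<Longrightarrow> set_integrable lborel nonneg_orthant (f t)"
    and "\<And>t s. t > 0 \<Longrightarrow> s \<in> neg_orthant \<Longrightarrow>
           complex_of_real (exp (t * \<psi> s)) = laplace (f t) (- s)"
    and "Limsup (at_right 0) (\<lambda>t. ennreal t * k_functional (f t) \<mu>) < \<infinity>"
  shows "\<psi> \<in> TnY TYPE('x::complex_banach)"
proof -
  interpret levy_density \<psi> \<mu> f by unfold_locales fact+
  have "generates (psi_op \<psi> A) (g_semigroup \<psi> A) \<and> quasibounded_holomorphic (g_semigroup \<psi> A)"
    if A: "commuting_generators A" for A :: "'n \<Rightarrow> ('x \<times> 'x) set"
  proof -
    interpret commuting_semigroups A by unfold_locales fact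
    obtain C where "orthant_semigroup (multi_semigroup A) C" using orthant_semigroup_multi by blast
    then interpret orthant_semigroup "multi_semigroup A" C .
    interpret subordinated_semigroup \<psi> \<mu> f "multi_semigroup A" C ..
    \<comment> \<open>Both sides are the same integral. As \<open>psi_op\<close> is by definition
      the generator of \<open>g_semigroup\<close>, being generated reduces to the C0 property of
      \<open>g\<close>.\<close>
    have "g_semigroup \<psi> A = g" by (simp add: fun_eq_iff g_semigroup_def g_def V_def)
    then show ?thesis
      using g_C0 g_condition_Y[OF assms(5)]
      by (simp add: generates_def psi_op_def quasibounded_holomorphic_def)
  qed
  then show ?thesis using assms(1) by (simp add: TnY_def)
qed

end
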